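(* Let $\tilde Q$ be an absorptive $n$TBI $q$-matrix satisfying (A-1), (A-2), (A-3) and $B_1(0,\dots,0)>0$. Write $A(y)$ and $B_1(y)$ for $A(y,u_2(y),\dots,u_n(y))$ and $B_1(y,u_2(y),\dots,u_n(y))$. Suppose that $\rho(1,\dots,1)\le0$ and $J=\infty$, where $J=\int_0^1\frac{1}{B_1(y)}e^{\int_0^y\frac{A(x)}{B_1(x)}dx}dy$ (and thus the extinction probability from every $\mathbf i\neq\mathbf 0$ equals $1$). For $\mathbf i\ne\mathbf 0$ let $E_{\mathbf i}[\tau_0]$ be the mean extinction time (mean hitting time of $\mathbf 0$) of the Feller minimal $\tilde Q$-process started at $\mathbf i$. Then for any $\mathbf i\ne\mathbf 0$, $E_{\mathbf i}[\tau_0]<\infty$ if and only if $$\int_0^1\frac{1-y\,u_2(y)\cdots u_n(y)-A(y)}{B_1(y)}\,dy<\infty,$$ in which case $$E_{\mathbf i}[\tau_0]=\int_0^1\frac{1-y^{i_1}u_2(y)^{i_2}\cdots u_n(y)^{i_n}}{B_1(y)}\,e^{-\int_y^1\frac{A(x)}{B_1(x)}dx}\,dy .$$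
   Context: Fix $n\ge1$. For $\mathbf i\in\mathbf Z_+^n$ write $|\mathbf i|=\sum_k i_k$; $\mathbf e_k$ is the $k$-th unit vector and $\chi$ is the indicator function of $\mathbf Z_+^n$. An absorptive $n$TBI $q$-matrix ($n$-type branching with immigration, no resurrection) is a matrix on $\mathbf Z_+^n$ with $q_{\mathbf{0j}}=0$ for all $\mathbf j$ and, for $|\mathbf i|>0$, $$q_{\mathbf{ij}}=\sum_{k=1}^n i_k b^{(k)}_{\mathbf j-\mathbf i+\mathbf e_k}\chi(\mathbf j-\mathbf i+\mathbf e_k)+a_{\mathbf j-\mathbf i}\chi(\mathbf j-\mathbf i),$$ where $a_{\mathbf j}\ge 0$ ($\mathbf j\ne\mathbf 0$), $0<\sum_{\mathbf j\ne\mathbf 0}a_{\mathbf j}=-a_{\mathbf 0}<\infty$, and for each $k$: $b^{(k)}_{\mathbf j}\ge0$ ($\mathbf j\ne\mathbf e_k$), $0<\sum_{\mathbf j\ne\mathbf e_k}b^{(k)}_{\mathbf j}=-b^{(k)}_{\mathbf e_k}<\infty$. Generating functions on $[0,1]^n$: $A(u)=\sum_{\mathbf j}a_{\mathbf j}u_1^{j_1}\cdots u_n^{j_n}$, $B_k(u)=\sum_{\mathbf j}b^{(k)}_{\mathbf j}u_1^{j_1}\cdots u_n^{j_n}$; $B_{ij}=\partial B_i/\partial u_j$, $g_{ij}=\delta_{ij}-B_{ij}/b^{(i)}_{\mathbf e_i}$, $G=(g_{ij})$. $\rho(u)$ is the maximal eigenvalue of the matrix $(B_{ij}(u))$. (A-1)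 $\{B_i\}$ is nonsingular: there is no $n\times n$ matrix $M$ with $(B_1(u),\dots,B_n(u))^{T}=M(u_1,\dots,u_n)^{T}$ for all $u$. (A-2) $B_{ij}(1,\dots,1)<\infty$ for all $i,j$. (A-3) $G(1,\dots,1)$ is positively regular (some power has all entries strictly positive). When $\rho(1,\dots,1)\le 0$ the smallest nonnegative solution in $[0,1]^n$ of $B_1=\dots=B_n=0$ is $(1,\dots,1)$, and $(u_2(u),\dots,u_n(u))$, $u\in[0,1]$, is the unique solution of $u_k'(u)=B_k(u,u_2,\dots,u_n)/B_1(u,u_2,\dots,u_n)$, $u_k(0)=0$ ($2\le k\le n$), extended continuously with $u_k(1)=1$. *)

theory Defs
  imports "HOL-Probability.Probability"
begin

section \<open>Feller minimal processes on a countable state space\<close>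

text \<open>
  Backward Feller iteration for a stable q-matrix \<open>Q\<close>. The \<open>m\<close>-th iterate is the probability of
  being in \<open>j\<close> at time \<open>t\<close>, starting in \<open>i\<close>, after at most \<open>m\<close> jumps; in the recursion
  \<open>s\<close> is the time of the first jump, \<open>k\<close> its target and \<open>- Q i i\<close> the total rate of leaving \<open>i\<close>.
\<close>

primrec feller_iter :: "('s \<Rightarrow> 's \<Rightarrow> real) \<Rightarrow> nat \<Rightarrow> real \<Rightarrow> 's \<Rightarrow> 's \<Rightarrow> ennreal" where
  "feller_iter Q 0 t i j = (if i = j then ennreal (exp (Q i i * t)) else 0)"
| "feller_iter Q (Suc m) t i j =
     (if i = j then ennreal (exp (Q i i * t)) else 0) +
     (\<integral>\<^sup>+ s\<in>{0..t}.
        (\<integral>\<^sup>+ k. ennreal (exp (Q i i * s) * Q i k) * feller_iter Q m (t - s) k j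
          \<partial>count_space (- {i}))
      \<partial>lborel)"

definition feller_minimal :: "('s \<Rightarrow> 's \<Rightarrow> real) \<Rightarrow> real \<Rightarrow> 's \<Rightarrow> 's \<Rightarrow> ennreal" where
  "feller_minimal Q t i j = (SUP m. feller_iter Q m t i j)"

text \<open>
  The value \<open>None\<close> is the cemetery, entered at an explosion. Right-continuity is meant with respect
  to the discrete topology; some path regularity is needed for hitting times to be determined by
  the finite-dimensional distributions.
\<close>

definition feller_minimal_process ::
  "('s \<Rightarrow> 's \<Rightarrow> real) \<Rightarrow> 's \<Rightarrow> 'w measure \<Rightarrow> (real \<Rightarrow> 'w \<Rightarrow> 's option) \<Rightarrow> bool" where
  "feller_minimal_process Q i M X \<longleftrightarrow>
     prob_space M \<and>
     (\<forall>t\<ge>0. X t \<in> M \<rightarrow>\<^sub>M count_space UNIV) \<and>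
     (\<forall>\<omega>\<in>space M. \<forall>t\<ge>0. \<forall>\<^sub>F s in at_right t. X s \<omega> = X t \<omega>) \<and>
     (AE \<omega> in M. X 0 \<omega> = Some i) \<and>
     (\<forall>m t j. t 0 = 0 \<longrightarrow> mono_on {..m} t \<longrightarrow> j 0 = i \<longrightarrow>
        emeasure M {\<omega> \<in> space M. \<forall>l\<le>m. X (t l) \<omega> = Some (j l)} =
          (\<Prod>l<m. feller_minimal Q (t (Suc l) - t l) (j l) (j (Suc l))))"

definition hitting_time :: "(real \<Rightarrow> 'w \<Rightarrow> 's option) \<Rightarrow> 's \<Rightarrow> 'w \<Rightarrow> ennreal" where
  "hitting_time X j \<omega> = Inf {ennreal t | t. t \<ge> 0 \<and> X t \<omega> = Some j}"


section \<open>Multitype branching with immigration\<close>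

text \<open>
  The types are the elements of the finite type \<open>'n\<close>, the states are the elements of \<open>nat ^ 'n\<close>, and
  \<open>axis k 1\<close> is the \<open>k\<close>-th unit vector. The order and the (truncated) subtraction on \<open>nat ^ 'n\<close> are
  componentwise.
\<close>

definition tbi_data :: "(nat ^ 'n \<Rightarrow> real) \<Rightarrow> ('n::finite \<Rightarrow> nat ^ 'n \<Rightarrow> real) \<Rightarrow> bool" where
  "tbi_data a b \<longleftrightarrow>
     (\<forall>j. j \<noteq> 0 \<longrightarrow> a j \<ge> 0) \<and>
     (a has_sum (- a 0)) (- {0}) \<and> 0 < - a 0 \<and>
     (\<forall>k. (\<forall>j. j \<noteq> axis k 1 \<longrightarrow> b k j \<ge> 0) \<and>
          (b k has_sum (- b k (axis k 1))) (- {axis k 1}) \<and> 0 < - b k (axis k 1))"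

text \<open>
  The guards play the role of \<open>\<chi>\<close>: they say that \<open>j - i + e\<^sub>k\<close> respectively \<open>j - i\<close>, formed in the
  integers, is nonnegative, and then the truncated subtractions are exact.
\<close>

definition absorptive_tbi :: "(nat ^ 'n \<Rightarrow> real) \<Rightarrow> ('n::finite \<Rightarrow> nat ^ 'n \<Rightarrow> real) \<Rightarrow>
    nat ^ 'n \<Rightarrow> nat ^ 'n \<Rightarrow> real" where
  "absorptive_tbi a b i j =
     (if i = 0 then 0
      else (\<Sum>k\<in>UNIV. real (i $ k) *
              (if i \<le> j + axis k 1 then b k (j + axis k 1 - i) else 0)) +
           (if i \<le> j then a (j - i) else 0))"

definition monomial :: "nat ^ 'n \<Rightarrow> real ^ 'n \<Rightarrow> real" where
  "monomial j u = (\<Prod>k\<in>UNIV. (u $ k) ^ (j $ k))"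

definition gen_fun :: "(nat ^ 'n \<Rightarrow> real) \<Rightarrow> real ^ 'n \<Rightarrow> real" where
  "gen_fun c u = (\<Sum>\<^sub>\<infinity>j. c j * monomial j u)"

definition set_coord :: "'n \<Rightarrow> real ^ 'n \<Rightarrow> real \<Rightarrow> real ^ 'n" where
  "set_coord l u x = (\<chi> m. if m = l then x else u $ m)"

text \<open>
  Partial derivatives of functions on the unit cube; they are one-sided on the faces of the cube.
\<close>

definition gf_jacobian :: "('n::finite \<Rightarrow> nat ^ 'n \<Rightarrow> real) \<Rightarrow> real ^ 'n \<Rightarrow> real ^ 'n ^ 'n" where
  "gf_jacobian b u = (\<chi> i j. vector_derivative (\<lambda>x. gen_fun (b i) (set_coord j u x))
                            (at (u $ j) within {0..1}))"

definition g_matrix :: "('n::finite \<Rightarrow> nat ^ 'n \<Rightarrow> real) \<Rightarrow> real ^ 'n \<Rightarrow> real ^ 'n ^ 'n" where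
  "g_matrix b u = (\<chi> i j. (if i = j then 1 else 0) - gf_jacobian b u $ i $ j / b i (axis i 1))"

definition max_eigenvalue :: "real ^ 'n ^ 'n \<Rightarrow> real" where
  "max_eigenvalue M = Max {l. \<exists>v. v \<noteq> 0 \<and> M *v v = l *\<^sub>R v}"

text \<open>
  The zeroth power has to be excluded: for a \<open>1 \<times> 1\<close> matrix it is strictly positive.
  The operation \<open>^\<close> on the type \<open>real ^ 'n ^ 'n\<close> would be the entrywise power.
\<close>

definition positively_regular :: "real ^ 'n ^ 'n \<Rightarrow> bool" where
  "positively_regular M \<longleftrightarrow> (\<exists>m\<ge>1. \<forall>i j. (((**) M ^^ m) (mat 1)) $ i $ j > 0)"

text \<open>
  The constant \<open>1\<close> of type \<open>real ^ 'n\<close> is the vector \<open>(1, \<dots>, 1)\<close>, and \<open>cbox 0 1\<close> is the unit cube.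
\<close>

definition nonsingular :: "('n::finite \<Rightarrow> nat ^ 'n \<Rightarrow> real) \<Rightarrow> bool" where
  "nonsingular b \<longleftrightarrow>
     \<not> (\<exists>M :: real ^ 'n ^ 'n. \<forall>u\<in>cbox 0 1. (\<chi> k. gen_fun (b k) u) = M *v u)"

definition finite_first_moments :: "('n::finite \<Rightarrow> nat ^ 'n \<Rightarrow> real) \<Rightarrow> bool" where
  "finite_first_moments b \<longleftrightarrow>
     (\<forall>i j. (\<lambda>x. gen_fun (b i) (set_coord j 1 x)) differentiable (at 1 within {0..1}))"

text \<open>
  The curve \<open>y \<mapsto> (y, u\<^sub>2(y), \<dots>, u\<^sub>n(y))\<close>. The type \<open>k1\<close> is the one numbered \<open>1\<close>: since \<open>'n\<close> carries
  no order, the type whose coordinate parametrises the curve is an explicit argument.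
\<close>

definition branching_curve ::
  "('n::finite \<Rightarrow> nat ^ 'n \<Rightarrow> real) \<Rightarrow> 'n \<Rightarrow> (real \<Rightarrow> real ^ 'n) \<Rightarrow> bool" where
  "branching_curve b k1 u \<longleftrightarrow>
     continuous_on {0..1} u \<and>
     (\<forall>y\<in>{0..1}. u y \<in> cbox 0 1 \<and> u y $ k1 = y) \<and>
     u 0 = 0 \<and> u 1 = 1 \<and>
     (\<forall>k. k \<noteq> k1 \<longrightarrow> (\<forall>y\<in>{0..<1}.
        ((\<lambda>x. u x $ k) has_real_derivative gen_fun (b k) (u y) / gen_fun (b k1) (u y))
          (at y within {0..1})))"

end

theory Submission
  imports Defs
begin

text \<open>
  Write \<open>f y i\<close> for the monomial \<open>u y ^ i\<close>. Along the curve the generator satisfies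
  \<open>Q f = B1 * (d/dy f) + A * f\<close> off the absorbing state. For \<open>z < 1\<close> the bounded function
  \<open>h z i = (integral of (1 - f y i) * exp (- L y) / B1 y over 0 \<le> y \<le> z)\<close>, where \<open>L' = - A / B1\<close> and
  \<open>L 0 = 0\<close>, therefore satisfies \<open>Q (h z) = - exp (- L z) * f z\<close>. Dynkin's formula holds with
  equality since the process does not explode (\<open>1 - f y\<close> is a barrier that tends to 1 at infinity and
  has drift at most \<open>- A (u y)\<close>, which is small for \<open>y\<close> close to 1). It shows first that the survival
  probability times the weight of \<open>h z\<close> is essentially at most \<open>h z i\<close>, so that \<open>J = \<infinity>\<close> forces
  extinction, and then that \<open>exp (L z) * h z i\<close> is the expected integral of \<open>f z\<close> along the path up
  to extinction. As \<open>z\<close> tends to 1 this becomes the mean extinction time.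

  The finiteness criterion also needs that \<open>B1\<close> is positive on the curve before its end point, which
  follows from quasi-monotonicity of the branching mechanism and the uniqueness of its zero, and that
  all the \<open>1 - u y $ k\<close> are comparable, which follows from irreducibility.
\<close>

section \<open>The Feller iteration and its Dynkin formula\<close>

text \<open>Since \<open>J\<close> is infinite, the weight \<open>exp (- L y) / B1 y\<close> has
  infinite mass and the choice \<open>z = 1\<close> could make \<open>h\<close> infinite. The cut at
  \<open>z < 1\<close> keeps \<open>h z\<close> bounded, at the price of the source
  \<open>exp (- L z) * f z\<close> instead of a constant. The two limits are taken in this order:
  time to infinity for fixed \<open>z\<close>, where the remainder (the mean of \<open>h z\<close>
  at time \<open>t\<close>) is at most the mass of the weight up to \<open>z\<close> times the
  survival probability; then \<open>z\<close> to 1, which is monotone because \<open>f z\<close>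
  increases to 1.

  It is built jump by jump on the Feller iterates. There nonnegative functions satisfy a one-sided
  comparison; the reverse inequality comes from the same comparison for a constant minus
  \<open>h\<close>, and this is where loss of mass has to be excluded.

  Everything up to that point lives in \<open>ennreal\<close>. Generator identities are therefore
  written as "jump part plus source equals exit rate times \<open>h\<close>", so that no infinite
  quantities are ever subtracted.\<close>

lemma countable_sum_measurable:
  fixes F :: "'a \<Rightarrow> 's::countable \<Rightarrow> ennreal"
  assumes "\<And>k. (\<lambda>x. F x k) \<in> borel_measurable M"
  shows "(\<lambda>x. \<integral>\<^sup>+ k. F x k \<partial>count_space K) \<in> borel_measurable M"
proof -
  interpret sigma_finite_measure "count_space K"
    by (intro sigma_finite_measure_count_space_countable) auto
  have "(\<lambda>p. F (snd p) (fst p)) \<in> borel_measurable (count_space K \<Otimes>\<^sub>M M)"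
    by (rule measurable_pair_measure_countable1) (use assms in auto)
  then have "(\<lambda>p. F (fst p) (snd p)) \<in> borel_measurable (M \<Otimes>\<^sub>M count_space K)"
    by (subst measurable_pair_swap_iff) (simp add: split_def)
  then show ?thesis
    by (intro borel_measurable_nn_integral) (simp add: split_def)
qed

text \<open>Tonelli on the triangle 0 \<le> s \<le> r \<le> t, followed by a translation by
  \<open>s\<close> in the inner integral.\<close>

lemma nn_integral_convolution:
  fixes \<phi> \<psi> :: "real \<Rightarrow> ennreal"
  assumes [measurable]: "\<phi> \<in> borel_measurable borel" "\<psi> \<in> borel_measurable borel"
  shows "(\<integral>\<^sup>+ r\<in>{0..t}. (\<integral>\<^sup>+ s\<in>{0..r}. \<phi> s * \<psi> (r - s) \<partial>lborel) \<partial>lborel) =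
         (\<integral>\<^sup>+ s\<in>{0..t}. \<phi> s * (\<integral>\<^sup>+ r\<in>{0..t - s}. \<psi> r \<partial>lborel) \<partial>lborel)"
proof -
  define G where "G r s = \<phi> s * \<psi> (r - s) * indicator {p. 0 \<le> snd p \<and> snd p \<le> fst p \<and> fst p \<le> t} (r, s)"
    for r s :: real
  have G[measurable]: "(\<lambda>p. G (fst p) (snd p)) \<in> borel_measurable (lborel \<Otimes>\<^sub>M lborel)"
    unfolding G_def by measurable
  have G': "(\<lambda>p. G (snd p) (fst p)) \<in> borel_measurable (lborel \<Otimes>\<^sub>M lborel)"
    unfolding G_def by measurable
  have "(\<integral>\<^sup>+ r\<in>{0..t}. (\<integral>\<^sup>+ s\<in>{0..r}. \<phi> s * \<psi> (r - s) \<partial>lborel) \<partial>lborel) =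
        (\<integral>\<^sup>+ r. \<integral>\<^sup>+ s. G r s \<partial>lborel \<partial>lborel)"
    unfolding G_def
    by (subst nn_integral_multc[symmetric], measurable)
       (intro nn_integral_cong, auto simp: indicator_def)
  also have "\<dots> = (\<integral>\<^sup>+ s. \<integral>\<^sup>+ r. G r s \<partial>lborel \<partial>lborel)"
    using G' by (intro lborel_pair.Fubini') (simp add: split_def)
  also have "\<dots> = (\<integral>\<^sup>+ s\<in>{0..t}. \<phi> s * (\<integral>\<^sup>+ r\<in>{0..t - s}. \<psi> r \<partial>lborel) \<partial>lborel)"
  proof (rule nn_integral_cong)
    fix s :: real
    have "(\<integral>\<^sup>+ r. G r s \<partial>lborel) = (\<integral>\<^sup>+ r. \<phi> s * indicator {0..t} s * (\<psi> (r - s) * indicator {s..t} r) \<partial>lborel)"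
      unfolding G_def by (intro nn_integral_cong) (auto simp: indicator_def)
    also have "\<dots> = \<phi> s * indicator {0..t} s * (\<integral>\<^sup>+ r. \<psi> (r - s) * indicator {s..t} r \<partial>lborel)"
      by (rule nn_integral_cmult) measurable
    also have "(\<integral>\<^sup>+ r. \<psi> (r - s) * indicator {s..t} r \<partial>lborel) =
        (\<integral>\<^sup>+ r. \<psi> r * indicator {0..t - s} r \<partial>lborel)"
      by (subst nn_integral_real_affine[where c = 1 and t = s])
         (auto intro!: nn_integral_cong simp: indicator_def)
    finally show "(\<integral>\<^sup>+ r. G r s \<partial>lborel) = \<phi> s * (\<integral>\<^sup>+ r\<in>{0..t - s}. \<psi> r \<partial>lborel) * indicator {0..t} s"
      by (simp add: mult_ac)
  qed
  finally show ?thesis .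
qed

text \<open>Splits \<open>x\<close> according to whether an exponential clock of rate
  \<open>- r\<close> rings before \<open>t\<close>. With \<open>r = Q i i\<close> it reassembles the
  holding term and the first-jump term into \<open>h i\<close> in the inductions on the number of
  jumps.\<close>

lemma nn_integral_exp_rate:
  fixes x :: ennreal
  assumes "t \<ge> 0" "r \<le> 0"
  shows "ennreal (exp (r * t)) * x + (\<integral>\<^sup>+ s\<in>{0..t}. ennreal (exp (r * s)) * (ennreal (- r) * x) \<partial>lborel) = x"
proof -
  have "(\<integral>\<^sup>+ s\<in>{0..t}. ennreal (- r * exp (r * s)) \<partial>lborel) = ennreal (- exp (r * t) - - exp (r * 0))"
    using assms by (intro nn_integral_FTC_Icc) (auto intro!: derivative_eq_intros mult_nonpos_nonneg)
  moreover have "(\<integral>\<^sup>+ s\<in>{0..t}. ennreal (exp (r * s)) * (ennreal (- r) * x) \<partial>lborel) =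
      (\<integral>\<^sup>+ s\<in>{0..t}. ennreal (- r * exp (r * s)) \<partial>lborel) * x"
    using assms by (subst nn_integral_multc[symmetric], measurable)
      (intro nn_integral_cong, simp add: ennreal_mult'' mult_ac ennreal_mult[symmetric] del: mult_minus_left)
  moreover have "ennreal (exp (r * t)) + ennreal (- exp (r * t) - - exp (r * 0)) = 1"
    using assms by (subst ennreal_plus[symmetric]) (auto simp: mult_nonpos_nonneg)
  ultimately show ?thesis
    by (simp add: distrib_right[symmetric])
qed

section \<open>Measurability and monotonicity of the iterates\<close>

lemma feller_iter_measurable [measurable]:
  fixes Q :: "'s::countable \<Rightarrow> 's \<Rightarrow> real"
  shows "(\<lambda>t. feller_iter Q m t i j) \<in> borel_measurable borel"
proof (induction m arbitrary: i)
  case 0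
  show ?case by (cases "i = j") auto
next
  case (Suc m)
  note Suc.IH [measurable]
  have [measurable]: "(\<lambda>p. \<integral>\<^sup>+ k. ennreal (exp (Q i i * snd p) * Q i k) * feller_iter Q m (fst p - snd p) k j
          \<partial>count_space (- {i})) \<in> borel_measurable (borel \<Otimes>\<^sub>M borel)"
    by (rule countable_sum_measurable) measurable
  have "(\<lambda>t. \<integral>\<^sup>+ s\<in>{0..t}. (\<integral>\<^sup>+ k. ennreal (exp (Q i i * s) * Q i k) * feller_iter Q m (t - s) k j
          \<partial>count_space (- {i})) \<partial>lborel) =
        (\<lambda>t. \<integral>\<^sup>+ s. (\<integral>\<^sup>+ k. ennreal (exp (Q i i * s) * Q i k) * feller_iter Q m (t - s) k j
          \<partial>count_space (- {i})) * indicator {p. 0 \<le> snd p \<and> snd p \<le> fst p} (t, s) \<partial>lborel)"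
    by (intro ext nn_integral_cong) (auto simp: indicator_def)
  also have "\<dots> \<in> borel_measurable borel"
    by measurable
  finally show ?case
    unfolding feller_iter.simps by (intro borel_measurable_add) auto
qed

lemma feller_iter_Suc_mono: "feller_iter Q m t i j \<le> feller_iter Q (Suc m) t i j"
proof (induction m arbitrary: t i)
  case (Suc m)
  show ?case
    by (subst (1 2) feller_iter.simps(2))
       (intro add_left_mono nn_integral_mono mult_right_mono mult_left_mono Suc.IH; simp)
qed simp

lemma incseq_feller_iter: "incseq (\<lambda>m. feller_iter Q m t i j)"
  by (rule incseq_SucI) (rule feller_iter_Suc_mono)

text \<open>The off-diagonal part of the generator. Keeping the diagonal apart makes
  \<open>ennreal\<close> possible: \<open>Q h = - g\<close> becomes
  \<open>jump_op Q h i + g i = ennreal (- Q i i) * h i\<close>, without subtraction or summability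
  conditions.\<close>

definition jump_op :: "('s \<Rightarrow> 's \<Rightarrow> real) \<Rightarrow> ('s \<Rightarrow> ennreal) \<Rightarrow> 's \<Rightarrow> ennreal" where
  "jump_op Q f i = (\<integral>\<^sup>+ k. ennreal (Q i k) * f k \<partial>count_space (- {i}))"

text \<open>The mean of \<open>f\<close> at time \<open>t\<close> on the event that at most
  \<open>m\<close> jumps have occurred.\<close>

definition feller_op ::
  "('s \<Rightarrow> 's \<Rightarrow> real) \<Rightarrow> nat \<Rightarrow> real \<Rightarrow> ('s \<Rightarrow> ennreal) \<Rightarrow> 's \<Rightarrow> ennreal" where
  "feller_op Q m t f i = (\<integral>\<^sup>+ j. feller_iter Q m t i j * f j \<partial>count_space UNIV)"

definition feller_semigroup ::
  "('s \<Rightarrow> 's \<Rightarrow> real) \<Rightarrow> real \<Rightarrow> ('s \<Rightarrow> ennreal) \<Rightarrow> 's \<Rightarrow> ennreal" where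
  "feller_semigroup Q t f i = (\<integral>\<^sup>+ j. feller_minimal Q t i j * f j \<partial>count_space UNIV)"

section \<open>Calculus of the jump operator and the first-jump recursion\<close>

lemma jump_op_mono: "(\<And>k. k \<noteq> i \<Longrightarrow> f k \<le> g k) \<Longrightarrow> jump_op Q f i \<le> jump_op Q g i"
  unfolding jump_op_def by (intro nn_integral_mono mult_left_mono) auto

lemma jump_op_add: "jump_op Q (\<lambda>k. f k + g k) i = jump_op Q f i + jump_op Q g i"
  unfolding jump_op_def by (subst nn_integral_add[symmetric]) (auto simp: distrib_left)

lemma jump_op_cmult: "jump_op Q (\<lambda>k. c * f k) i = c * jump_op Q f i"
  unfolding jump_op_def by (subst nn_integral_cmult[symmetric]) (auto simp: mult_ac)

lemma jump_op_multc: "jump_op Q (\<lambda>k. f k * c) i = jump_op Q f i * c"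
  using jump_op_cmult[of Q c f i] by (simp add: mult.commute)

lemma jump_op_nn_integral:
  fixes Q :: "'s::countable \<Rightarrow> 's \<Rightarrow> real"
  assumes [measurable]: "\<And>k. F k \<in> borel_measurable M"
  shows "jump_op Q (\<lambda>k. \<integral>\<^sup>+ x. F k x \<partial>M) i = (\<integral>\<^sup>+ x. jump_op Q (\<lambda>k. F k x) i \<partial>M)"
  unfolding jump_op_def
  by (subst nn_integral_count_space_nn_integral)
     (auto intro!: nn_integral_cong simp: nn_integral_cmult)

lemma jump_op_measurable:
  fixes Q :: "'s::countable \<Rightarrow> 's \<Rightarrow> real"
  assumes [measurable]: "\<And>k. (\<lambda>x. F x k) \<in> borel_measurable M"
  shows "(\<lambda>x. jump_op Q (F x) i) \<in> borel_measurable M"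
  unfolding jump_op_def by (rule countable_sum_measurable) measurable

lemma feller_op_measurable [measurable]:
  fixes Q :: "'s::countable \<Rightarrow> 's \<Rightarrow> real"
  shows "(\<lambda>t. feller_op Q m t f i) \<in> borel_measurable borel"
  unfolding feller_op_def by (rule countable_sum_measurable) measurable

lemma feller_op_0: "feller_op Q 0 t f i = ennreal (exp (Q i i * t)) * f i"
proof -
  have "feller_op Q 0 t f i = (\<integral>\<^sup>+ j. ennreal (exp (Q i i * t)) * f j * indicator {i} j \<partial>count_space UNIV)"
    unfolding feller_op_def by (intro nn_integral_cong) (auto simp: indicator_def)
  then show ?thesis
    by simp
qed

text \<open>Conditioning on the first jump, carried over from kernels to functions; all interchanges
  are Tonelli.\<close>

lemma feller_op_Suc:
  fixes Q :: "'s::countable \<Rightarrow> 's \<Rightarrow> real"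
  shows "feller_op Q (Suc m) t f i = ennreal (exp (Q i i * t)) * f i +
    (\<integral>\<^sup>+ s\<in>{0..t}. ennreal (exp (Q i i * s)) * jump_op Q (feller_op Q m (t - s) f) i \<partial>lborel)"
proof -
  have [measurable]: "(\<lambda>s. \<integral>\<^sup>+ k. ennreal (exp (Q i i * s) * Q i k) * feller_iter Q m (t - s) k j
          \<partial>count_space (- {i})) \<in> borel_measurable borel" for j
    by (rule countable_sum_measurable) measurable
  have "feller_op Q (Suc m) t f i = feller_op Q 0 t f i + (\<integral>\<^sup>+ j. (\<integral>\<^sup>+ s\<in>{0..t}. (\<integral>\<^sup>+ k. ennreal (exp (Q i i * s) * Q i k) *
          feller_iter Q m (t - s) k j \<partial>count_space (- {i})) \<partial>lborel) * f j \<partial>count_space UNIV)"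
    unfolding feller_op_def
    by (subst nn_integral_add[symmetric]) (auto simp: distrib_right)
  also have "(\<integral>\<^sup>+ j. (\<integral>\<^sup>+ s\<in>{0..t}. (\<integral>\<^sup>+ k. ennreal (exp (Q i i * s) * Q i k) *
          feller_iter Q m (t - s) k j \<partial>count_space (- {i})) \<partial>lborel) * f j \<partial>count_space UNIV) =
        (\<integral>\<^sup>+ j. (\<integral>\<^sup>+ s. (\<integral>\<^sup>+ k. ennreal (exp (Q i i * s) * Q i k) *
          feller_iter Q m (t - s) k j \<partial>count_space (- {i})) * indicator {0..t} s * f j \<partial>lborel) \<partial>count_space UNIV)"
    by (intro nn_integral_cong nn_integral_multc[symmetric]) measurable
  also have "\<dots> = (\<integral>\<^sup>+ s. (\<integral>\<^sup>+ j. (\<integral>\<^sup>+ k. ennreal (exp (Q i i * s) * Q i k) *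
          feller_iter Q m (t - s) k j \<partial>count_space (- {i})) * indicator {0..t} s * f j \<partial>count_space UNIV) \<partial>lborel)"
    by (rule nn_integral_count_space_nn_integral[symmetric]) auto
  also have "\<dots> = (\<integral>\<^sup>+ s\<in>{0..t}. ennreal (exp (Q i i * s)) * jump_op Q (feller_op Q m (t - s) f) i \<partial>lborel)"
  proof (rule nn_integral_cong)
    fix s :: real
    have "(\<integral>\<^sup>+ j. (\<integral>\<^sup>+ k. ennreal (exp (Q i i * s) * Q i k) *
          feller_iter Q m (t - s) k j \<partial>count_space (- {i})) * indicator {0..t} s * f j \<partial>count_space UNIV) =
      (\<integral>\<^sup>+ j. (\<integral>\<^sup>+ k. ennreal (exp (Q i i * s)) * indicator {0..t} s * (ennreal (Q i k) *
          (feller_iter Q m (t - s) k j * f j)) \<partial>count_space (- {i})) \<partial>count_space UNIV)"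
      by (intro nn_integral_cong, subst nn_integral_multc[symmetric], simp, subst nn_integral_multc[symmetric], simp)
         (intro nn_integral_cong, subst ennreal_mult', simp, simp only: mult_ac)
    also have "\<dots> = (\<integral>\<^sup>+ k. (\<integral>\<^sup>+ j. ennreal (exp (Q i i * s)) * indicator {0..t} s * (ennreal (Q i k) *
          (feller_iter Q m (t - s) k j * f j)) \<partial>count_space UNIV) \<partial>count_space (- {i}))"
      by (rule nn_integral_count_space_nn_integral) auto
    also have "\<dots> = ennreal (exp (Q i i * s)) * indicator {0..t} s * jump_op Q (feller_op Q m (t - s) f) i"
      unfolding jump_op_def feller_op_def by (simp add: nn_integral_cmult)
    finally show "(\<integral>\<^sup>+ j. (\<integral>\<^sup>+ k. ennreal (exp (Q i i * s) * Q i k) *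
          feller_iter Q m (t - s) k j \<partial>count_space (- {i})) * indicator {0..t} s * f j \<partial>count_space UNIV) =
        ennreal (exp (Q i i * s)) * jump_op Q (feller_op Q m (t - s) f) i * indicator {0..t} s"
      by (simp add: mult_ac)
  qed
  finally show ?thesis
    by (simp add: feller_op_0)
qed

text \<open>Terminal value \<open>h\<close> plus accumulated running cost \<open>g\<close>, both
  counted only while at most \<open>m\<close> jumps have occurred: the mean in Dynkin's formula
  before the limit in \<open>m\<close>.\<close>

definition dynkin_op ::
  "('s \<Rightarrow> 's \<Rightarrow> real) \<Rightarrow> nat \<Rightarrow> real \<Rightarrow> ('s \<Rightarrow> ennreal) \<Rightarrow> ('s \<Rightarrow> ennreal) \<Rightarrow> 's \<Rightarrow> ennreal" where
  "dynkin_op Q m t h g i = feller_op Q m t h i + (\<integral>\<^sup>+ s\<in>{0..t}. feller_op Q m s g i \<partial>lborel)"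

lemma dynkin_op_measurable [measurable]:
  fixes Q :: "'s::countable \<Rightarrow> 's \<Rightarrow> real"
  shows "(\<lambda>t. dynkin_op Q m t h g i) \<in> borel_measurable borel"
proof -
  have "(\<lambda>t. \<integral>\<^sup>+ s\<in>{0..t}. feller_op Q m s g i \<partial>lborel) =
    (\<lambda>t. \<integral>\<^sup>+ s. feller_op Q m s g i * indicator {p. 0 \<le> snd p \<and> snd p \<le> fst p} (t, s) \<partial>lborel)"
    by (intro ext nn_integral_cong) (auto simp: indicator_def)
  also have "\<dots> \<in> borel_measurable borel"
    by measurable
  finally show ?thesis
    unfolding dynkin_op_def by measurable
qed

text \<open>Cost accrues at rate \<open>g i\<close> while the process stays in \<open>i\<close> and
  restarts at the target of the first jump. The convolution lemma shifts the clock of the running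
  cost by the time of that jump.\<close>

lemma dynkin_op_Suc:
  fixes Q :: "'s::countable \<Rightarrow> 's \<Rightarrow> real"
  shows "dynkin_op Q (Suc m) t h g i = ennreal (exp (Q i i * t)) * h i +
    (\<integral>\<^sup>+ s\<in>{0..t}. ennreal (exp (Q i i * s)) * (g i + jump_op Q (dynkin_op Q m (t - s) h g) i) \<partial>lborel)"
proof -
  have [measurable]: "(\<lambda>s. jump_op Q (feller_op Q m (t - s) f) i) \<in> borel_measurable borel" 
      "(\<lambda>s. jump_op Q (feller_op Q m s f) i) \<in> borel_measurable borel" for t f
    by (rule jump_op_measurable; measurable)+
  have [measurable]: "(\<lambda>s. jump_op Q (\<lambda>k. \<integral>\<^sup>+ r\<in>{0..t - s}. feller_op Q m r g k \<partial>lborel) i) \<in> borel_measurable borel"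
  proof (rule jump_op_measurable)
    fix k
    have "(\<lambda>s. dynkin_op Q m (t - s) (\<lambda>_. 0) g k) \<in> borel_measurable borel"
      by measurable
    then show "(\<lambda>s. \<integral>\<^sup>+ r\<in>{0..t - s}. feller_op Q m r g k \<partial>lborel) \<in> borel_measurable borel"
      by (simp add: dynkin_op_def feller_op_def)
  qed
  have [measurable]: "(\<lambda>s. \<integral>\<^sup>+ r\<in>{0..s}. ennreal (exp (Q i i * r)) * jump_op Q (feller_op Q m (s - r) g) i \<partial>lborel)
        \<in> borel_measurable borel"
  proof -
    have [measurable]: "(\<lambda>p. jump_op Q (feller_op Q m (fst p - snd p) g) i) \<in> borel_measurable (borel \<Otimes>\<^sub>M borel)"
      by (rule jump_op_measurable; measurable)
    have "(\<lambda>s. \<integral>\<^sup>+ r\<in>{0..s}. ennreal (exp (Q i i * r)) * jump_op Q (feller_op Q m (s - r) g) i \<partial>lborel) =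
      (\<lambda>s. \<integral>\<^sup>+ r. ennreal (exp (Q i i * r)) * jump_op Q (feller_op Q m (s - r) g) i * 
        indicator {p. 0 \<le> snd p \<and> snd p \<le> fst p} (s, r) \<partial>lborel)"
      by (intro ext nn_integral_cong) (auto simp: indicator_def)
    also have "\<dots> \<in> borel_measurable borel"
      by measurable
    finally show ?thesis .
  qed
  have "(\<integral>\<^sup>+ s\<in>{0..t}. feller_op Q (Suc m) s g i \<partial>lborel) =
    (\<integral>\<^sup>+ s\<in>{0..t}. ennreal (exp (Q i i * s)) * g i \<partial>lborel) +
    (\<integral>\<^sup>+ s\<in>{0..t}. (\<integral>\<^sup>+ r\<in>{0..s}. ennreal (exp (Q i i * r)) * jump_op Q (feller_op Q m (s - r) g) i \<partial>lborel) \<partial>lborel)"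
    unfolding feller_op_Suc
    by (subst nn_integral_add[symmetric], measurable) (simp add: distrib_right)
  also have "(\<integral>\<^sup>+ s\<in>{0..t}. (\<integral>\<^sup>+ r\<in>{0..s}. ennreal (exp (Q i i * r)) * jump_op Q (feller_op Q m (s - r) g) i \<partial>lborel) \<partial>lborel) =
    (\<integral>\<^sup>+ s\<in>{0..t}. ennreal (exp (Q i i * s)) * (\<integral>\<^sup>+ r\<in>{0..t - s}. jump_op Q (feller_op Q m r g) i \<partial>lborel) \<partial>lborel)"
    by (rule nn_integral_convolution) measurable
  also have "\<dots> = (\<integral>\<^sup>+ s\<in>{0..t}. ennreal (exp (Q i i * s)) * jump_op Q (\<lambda>k. \<integral>\<^sup>+ r\<in>{0..t - s}. feller_op Q m r g k \<partial>lborel) i \<partial>lborel)"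
    by (subst jump_op_nn_integral, measurable)
       (simp add: jump_op_multc)
  finally have *: "(\<integral>\<^sup>+ s\<in>{0..t}. feller_op Q (Suc m) s g i \<partial>lborel) = 
    (\<integral>\<^sup>+ s\<in>{0..t}. ennreal (exp (Q i i * s)) * g i \<partial>lborel) + \<dots>" .
  define X where "X s = jump_op Q (feller_op Q m (t - s) h) i" for s
  define Z where "Z s = jump_op Q (\<lambda>k. \<integral>\<^sup>+ r\<in>{0..t - s}. feller_op Q m r g k \<partial>lborel) i" for s
  have [measurable]: "X \<in> borel_measurable borel" "Z \<in> borel_measurable borel"
    unfolding X_def Z_def by measurable
  have "dynkin_op Q (Suc m) t h g i =
    feller_op Q (Suc m) t h i + (\<integral>\<^sup>+ s\<in>{0..t}. feller_op Q (Suc m) s g i \<partial>lborel)"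
    by (simp only: dynkin_op_def)
  also have "\<dots> = ennreal (exp (Q i i * t)) * h i + ((\<integral>\<^sup>+ s\<in>{0..t}. ennreal (exp (Q i i * s)) * X s \<partial>lborel) +
    ((\<integral>\<^sup>+ s\<in>{0..t}. ennreal (exp (Q i i * s)) * g i \<partial>lborel) +
     (\<integral>\<^sup>+ s\<in>{0..t}. ennreal (exp (Q i i * s)) * Z s \<partial>lborel)))"
    unfolding * X_def Z_def feller_op_Suc[of Q m t h] by (rule add.assoc)
  also have "(\<integral>\<^sup>+ s\<in>{0..t}. ennreal (exp (Q i i * s)) * X s \<partial>lborel) +
    ((\<integral>\<^sup>+ s\<in>{0..t}. ennreal (exp (Q i i * s)) * g i \<partial>lborel) +
     (\<integral>\<^sup>+ s\<in>{0..t}. ennreal (exp (Q i i * s)) * Z s \<partial>lborel)) =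
    (\<integral>\<^sup>+ s\<in>{0..t}. ennreal (exp (Q i i * s)) * (g i + (X s + Z s)) \<partial>lborel)"
    by (subst nn_integral_add[symmetric], measurable, subst nn_integral_add[symmetric], measurable)
       (intro nn_integral_cong, simp only: distrib_left distrib_right add_ac)
  also have "\<dots> = (\<integral>\<^sup>+ s\<in>{0..t}. ennreal (exp (Q i i * s)) * (g i + jump_op Q (dynkin_op Q m (t - s) h g) i) \<partial>lborel)"
    unfolding X_def Z_def dynkin_op_def by (simp only: jump_op_add)
  finally show ?thesis .
qed

text \<open>A comparison principle for \<open>Q h + g1 \<le> g2\<close>. It is one-sided because
  restricting to at most \<open>m\<close> jumps discards mass. The induction has to range over all
  starting states and times since the process restarts after its first jump.\<close>

lemma dynkin_op_le:
  fixes Q :: "'s::countable \<Rightarrow> 's \<Rightarrow> real"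
  assumes Q: "\<And>i. Q i i \<le> 0"
    and *: "\<And>i. jump_op Q h i + g1 i \<le> ennreal (- Q i i) * h i + g2 i"
    and "t \<ge> 0"
  shows "dynkin_op Q m t h g1 i \<le> h i + dynkin_op Q m t (\<lambda>_. 0) g2 i"
  using \<open>t \<ge> 0\<close>
proof (induction m arbitrary: t i)
  case 0
  have "dynkin_op Q 0 t h g1 i = ennreal (exp (Q i i * t)) * h i +
      (\<integral>\<^sup>+ s\<in>{0..t}. ennreal (exp (Q i i * s)) * g1 i \<partial>lborel)"
    by (simp add: dynkin_op_def feller_op_0)
  also have "\<dots> \<le> ennreal (exp (Q i i * t)) * h i +
      (\<integral>\<^sup>+ s\<in>{0..t}. ennreal (exp (Q i i * s)) * (ennreal (- Q i i) * h i + g2 i) \<partial>lborel)"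
    using *[of i] by (intro add_left_mono nn_integral_mono mult_right_mono mult_left_mono)
      (auto intro: order_trans[rotated])
  also have "\<dots> = (ennreal (exp (Q i i * t)) * h i +
      (\<integral>\<^sup>+ s\<in>{0..t}. ennreal (exp (Q i i * s)) * (ennreal (- Q i i) * h i) \<partial>lborel)) +
      (\<integral>\<^sup>+ s\<in>{0..t}. ennreal (exp (Q i i * s)) * g2 i \<partial>lborel)"
    unfolding add.assoc by (subst nn_integral_add[symmetric], measurable) (simp add: algebra_simps)
  also have "\<dots> = h i + dynkin_op Q 0 t (\<lambda>_. 0) g2 i"
    using Q 0 by (subst nn_integral_exp_rate) (auto simp: dynkin_op_def feller_op_0)
  finally show ?case .
next
  case (Suc m)
  have [measurable]: "(\<lambda>s. jump_op Q (dynkin_op Q m (t - s) f f') i) \<in> borel_measurable borel" for f f'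
    by (rule jump_op_measurable) measurable
  have "g1 i + jump_op Q (dynkin_op Q m (t - s) h g1) i \<le>
      ennreal (- Q i i) * h i + (g2 i + jump_op Q (dynkin_op Q m (t - s) (\<lambda>_. 0) g2) i)" if "s \<in> {0..t}" for s
  proof -
    have "g1 i + jump_op Q (dynkin_op Q m (t - s) h g1) i \<le>
      g1 i + jump_op Q (\<lambda>k. h k + dynkin_op Q m (t - s) (\<lambda>_. 0) g2 k) i"
      using that by (intro add_left_mono jump_op_mono Suc.IH) auto
    also have "\<dots> = (jump_op Q h i + g1 i) + jump_op Q (dynkin_op Q m (t - s) (\<lambda>_. 0) g2) i"
      by (simp add: jump_op_add algebra_simps)
    also have "\<dots> \<le> (ennreal (- Q i i) * h i + g2 i) + jump_op Q (dynkin_op Q m (t - s) (\<lambda>_. 0) g2) i"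
      using * by (intro add_right_mono) auto
    finally show ?thesis
      by (simp add: add.assoc)
  qed
  then have "dynkin_op Q (Suc m) t h g1 i \<le> ennreal (exp (Q i i * t)) * h i +
    (\<integral>\<^sup>+ s\<in>{0..t}. ennreal (exp (Q i i * s)) * (ennreal (- Q i i) * h i +
       (g2 i + jump_op Q (dynkin_op Q m (t - s) (\<lambda>_. 0) g2) i)) \<partial>lborel)"
    unfolding dynkin_op_Suc
    by (intro add_left_mono nn_integral_mono) (auto intro!: mult_left_mono simp: indicator_def)
  also have "\<dots> = (ennreal (exp (Q i i * t)) * h i +
      (\<integral>\<^sup>+ s\<in>{0..t}. ennreal (exp (Q i i * s)) * (ennreal (- Q i i) * h i) \<partial>lborel)) +
      (\<integral>\<^sup>+ s\<in>{0..t}. ennreal (exp (Q i i * s)) * (g2 i + jump_op Q (dynkin_op Q m (t - s) (\<lambda>_. 0) g2) i) \<partial>lborel)"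
    unfolding add.assoc by (subst nn_integral_add[symmetric], measurable) (simp add: algebra_simps)
  also have "\<dots> = h i + dynkin_op Q (Suc m) t (\<lambda>_. 0) g2 i"
    using Q Suc.prems by (subst nn_integral_exp_rate) (auto simp: dynkin_op_Suc)
  finally show ?case .
qed

section \<open>Passage from the iterates to the minimal semigroup\<close>

lemma feller_semigroup_SUP: "feller_semigroup Q t f i = (SUP m. feller_op Q m t f i)"
proof -
  have "feller_semigroup Q t f i = (\<integral>\<^sup>+ j. (SUP m. feller_iter Q m t i j * f j) \<partial>count_space UNIV)"
    unfolding feller_semigroup_def feller_minimal_def by (simp add: SUP_mult_right_ennreal)
  also have "\<dots> = (SUP m. feller_op Q m t f i)"
    unfolding feller_op_def
  proof (rule nn_integral_monotone_convergence_SUP)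
    show "incseq (\<lambda>m j. feller_iter Q m t i j * f j)"
      by (intro monoI le_funI mult_right_mono incseqD[OF incseq_feller_iter]) auto
  qed auto
  finally show ?thesis .
qed

lemma incseq_feller_op: "incseq (\<lambda>m. feller_op Q m t f i)"
  unfolding feller_op_def
  by (intro monoI nn_integral_mono mult_right_mono incseqD[OF incseq_feller_iter]) auto

lemma feller_semigroup_measurable [measurable]:
  fixes Q :: "'s::countable \<Rightarrow> 's \<Rightarrow> real"
  shows "(\<lambda>t. feller_semigroup Q t f i) \<in> borel_measurable borel"
  unfolding feller_semigroup_SUP by measurable

lemma nn_integral_feller_semigroup:
  fixes Q :: "'s::countable \<Rightarrow> 's \<Rightarrow> real"
  assumes [measurable]: "A \<in> sets borel"
  shows "(\<integral>\<^sup>+ s\<in>A. feller_semigroup Q s f i \<partial>lborel) = (SUP m. \<integral>\<^sup>+ s\<in>A. feller_op Q m s f i \<partial>lborel)"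
  unfolding feller_semigroup_SUP SUP_mult_right_ennreal
proof (rule nn_integral_monotone_convergence_SUP)
  show "incseq (\<lambda>m s. feller_op Q m s f i * indicator A s)"
    by (intro monoI le_funI mult_right_mono incseqD[OF incseq_feller_op]) auto
qed measurable

lemma feller_semigroup_add:
  "feller_semigroup Q t (\<lambda>k. f k + g k) i = feller_semigroup Q t f i + feller_semigroup Q t g i"
  unfolding feller_semigroup_def by (subst nn_integral_add[symmetric]) (auto simp: distrib_left)

lemma feller_semigroup_cmult: "feller_semigroup Q t (\<lambda>k. c * f k) i = c * feller_semigroup Q t f i"
  unfolding feller_semigroup_def by (subst nn_integral_cmult[symmetric]) (auto simp: mult_ac)

lemma feller_semigroup_mono: "(\<And>k. f k \<le> g k) \<Longrightarrow> feller_semigroup Q t f i \<le> feller_semigroup Q t g i"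
  unfolding feller_semigroup_def by (intro nn_integral_mono mult_left_mono) auto

lemma dynkin_semigroup_SUP:
  fixes Q :: "'s::countable \<Rightarrow> 's \<Rightarrow> real"
  shows "feller_semigroup Q t h i + (\<integral>\<^sup>+ s\<in>{0..t}. feller_semigroup Q s g i \<partial>lborel) =
    (SUP m. dynkin_op Q m t h g i)"
  unfolding dynkin_op_def
proof (subst nn_integral_feller_semigroup, simp, subst feller_semigroup_SUP, rule ennreal_SUP_add[symmetric])
  show "incseq (\<lambda>m. \<integral>\<^sup>+ s\<in>{0..t}. feller_op Q m s g i \<partial>lborel)"
    by (intro monoI nn_integral_mono mult_right_mono incseqD[OF incseq_feller_op]) auto
qed (rule incseq_feller_op)

lemma dynkin_semigroup_le:
  fixes Q :: "'s::countable \<Rightarrow> 's \<Rightarrow> real"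
  assumes "\<And>i. Q i i \<le> 0"
    and "\<And>i. jump_op Q h i + g1 i \<le> ennreal (- Q i i) * h i + g2 i"
    and "t \<ge> 0"
  shows "feller_semigroup Q t h i + (\<integral>\<^sup>+ s\<in>{0..t}. feller_semigroup Q s g1 i \<partial>lborel)
       \<le> h i + (\<integral>\<^sup>+ s\<in>{0..t}. feller_semigroup Q s g2 i \<partial>lborel)"
proof -
  have "(SUP m. dynkin_op Q m t h g1 i) \<le> h i + (SUP m. dynkin_op Q m t (\<lambda>_. 0) g2 i)"
  proof (rule SUP_least)
    fix m
    have "dynkin_op Q m t h g1 i \<le> h i + dynkin_op Q m t (\<lambda>_. 0) g2 i"
      by (rule dynkin_op_le[OF assms])
    also have "\<dots> \<le> h i + (SUP m. dynkin_op Q m t (\<lambda>_. 0) g2 i)"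
      by (intro add_left_mono SUP_upper) simp
    finally show "dynkin_op Q m t h g1 i \<le> h i + (SUP m. dynkin_op Q m t (\<lambda>_. 0) g2 i)" .
  qed
  then show ?thesis
    unfolding dynkin_semigroup_SUP[symmetric] by (simp add: feller_semigroup_def)
qed

section \<open>Conservative q-matrices: loss of mass and the two-sided Dynkin formula\<close>

locale conservative_q_matrix =
  fixes Q :: "'s::countable \<Rightarrow> 's \<Rightarrow> real"
  assumes diag_nonpos: "Q i i \<le> 0"
    and conservative: "jump_op Q (\<lambda>_. 1) i = ennreal (- Q i i)"
begin

lemma jump_op_const: "jump_op Q (\<lambda>_. c) i = ennreal (- Q i i) * c"
  using jump_op_cmult[of Q c "\<lambda>_. 1" i] conservative by (simp add: mult.commute)

lemma feller_op_const_le: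
  assumes "t \<ge> 0"
  shows "feller_op Q m t (\<lambda>_. c) i \<le> c"
proof -
  have "dynkin_op Q m t (\<lambda>_. c) (\<lambda>_. 0) i \<le> c + dynkin_op Q m t (\<lambda>_. 0) (\<lambda>_. 0) i"
    by (rule dynkin_op_le) (use assms diag_nonpos in \<open>auto simp: jump_op_const\<close>)
  then show ?thesis
    by (simp add: dynkin_op_def feller_op_def)
qed

lemma feller_semigroup_const_le: "t \<ge> 0 \<Longrightarrow> feller_semigroup Q t (\<lambda>_. c) i \<le> c"
  unfolding feller_semigroup_SUP by (rule SUP_least) (rule feller_op_const_le)

text \<open>
  The complement of \<open>dynkin_op Q n t (\<lambda>_. 1) (\<lambda>_. c)\<close> is dominated by the barrier \<open>v\<close> outside a
  finite set, and on this set every step of the iteration contracts the excess over \<open>v\<close>, because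
  the rates of leaving are bounded there.
\<close>

lemma dynkin_op_barrier:
  assumes v: "\<And>i. jump_op Q v i \<le> ennreal (- Q i i) * v i + c"
    and F: "\<And>i. i \<notin> F \<Longrightarrow> 1 \<le> v i + ennreal \<epsilon>"
    and \<theta>: "\<And>i. i \<in> F \<Longrightarrow> 1 - exp (Q i i * T) \<le> \<theta>" "0 \<le> \<theta>"
    and t: "0 \<le> t" "t \<le> T"
  shows "1 \<le> dynkin_op Q n t (\<lambda>_. 1) (\<lambda>_. c) i + v i + ennreal (max \<epsilon> (\<theta> ^ n))"
  using t
proof (induction n arbitrary: t i)
  case 0
  then show ?case
    by (intro add_increasing) (auto simp: max_def ennreal_ge_1)
next
  case (Suc n)
  show ?case
  proof (cases "i \<in> F")
    case False
    have "1 \<le> v i + ennreal \<epsilon>"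
      by (rule F[OF False])
    also have "\<dots> \<le> dynkin_op Q (Suc n) t (\<lambda>_. 1) (\<lambda>_. c) i + v i + ennreal (max \<epsilon> (\<theta> ^ Suc n))"
      by (intro add_mono ennreal_leI) auto
    finally show ?thesis .
  next
    case True
    define M where "M = max \<epsilon> (\<theta> ^ n)"
    define D where "D s = dynkin_op Q n s (\<lambda>_. 1) (\<lambda>_. c)" for s
    let ?e = "\<lambda>s. ennreal (exp (Q i i * s))" and ?q = "ennreal (- Q i i)"
    have [measurable]: "(\<lambda>s. jump_op Q (D (t - s)) i) \<in> borel_measurable borel"
      unfolding D_def by (rule jump_op_measurable) measurable
    have M: "0 \<le> M"
      using zero_le_power[OF \<theta>(2), of n] by (simp add: M_def le_max_iff_disj)
    have step: "?q \<le> c + jump_op Q (D (t - s)) i + ?q * v i + ?q * ennreal M" if "s \<in> {0..t}" for s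
    proof -
      have "?q = jump_op Q (\<lambda>_. 1) i"
        by (simp add: conservative)
      also have "\<dots> \<le> jump_op Q (\<lambda>k. D (t - s) k + v k + ennreal M) i"
        unfolding D_def M_def using that Suc.prems by (intro jump_op_mono Suc.IH) auto
      also have "\<dots> = jump_op Q (D (t - s)) i + jump_op Q v i + ?q * ennreal M"
        by (simp add: jump_op_add jump_op_const)
      also have "\<dots> \<le> jump_op Q (D (t - s)) i + (?q * v i + c) + ?q * ennreal M"
        by (intro add_mono v order_refl)
      finally show ?thesis
        by (simp add: add_ac)
    qed
    have "1 = ?e t * 1 + (\<integral>\<^sup>+ s\<in>{0..t}. ?e s * (?q * 1) \<partial>lborel)"
      by (rule nn_integral_exp_rate[symmetric]) (use Suc.prems diag_nonpos in auto)
    also have "\<dots> \<le> ?e t * 1 + (\<integral>\<^sup>+ s\<in>{0..t}. ?e s * (c + jump_op Q (D (t - s)) i + ?q * v i + ?q * ennreal M) \<partial>lborel)"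
    proof (intro add_left_mono nn_integral_mono)
      fix s
      show "?e s * (?q * 1) * indicator {0..t} s \<le>
          ?e s * (c + jump_op Q (D (t - s)) i + ?q * v i + ?q * ennreal M) * indicator {0..t} s"
        using step[of s] by (cases "s \<in> {0..t}") (simp_all add: mult_left_mono)
    qed
    also have "\<dots> = dynkin_op Q (Suc n) t (\<lambda>_. 1) (\<lambda>_. c) i + (\<integral>\<^sup>+ s\<in>{0..t}. ?e s * (?q * v i) \<partial>lborel) +
        (\<integral>\<^sup>+ s\<in>{0..t}. ?e s * (?q * ennreal M) \<partial>lborel)"
    proof -
      have "(\<integral>\<^sup>+ s\<in>{0..t}. ?e s * (c + jump_op Q (D (t - s)) i + ?q * v i + ?q * ennreal M) \<partial>lborel) =
        (\<integral>\<^sup>+ s. ?e s * (c + jump_op Q (D (t - s)) i) * indicator {0..t} s + ?e s * (?q * v i) * indicator {0..t} s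
           + ?e s * (?q * ennreal M) * indicator {0..t} s \<partial>lborel)"
        by (intro nn_integral_cong) (simp only: distrib_left distrib_right)
      also have "\<dots> = (\<integral>\<^sup>+ s\<in>{0..t}. ?e s * (c + jump_op Q (D (t - s)) i) \<partial>lborel) +
        (\<integral>\<^sup>+ s\<in>{0..t}. ?e s * (?q * v i) \<partial>lborel) + (\<integral>\<^sup>+ s\<in>{0..t}. ?e s * (?q * ennreal M) \<partial>lborel)"
        by (subst nn_integral_add, measurable, subst nn_integral_add, measurable)
      finally show ?thesis
        unfolding dynkin_op_Suc D_def by (simp only: add.assoc)
    qed
    also have "\<dots> \<le> dynkin_op Q (Suc n) t (\<lambda>_. 1) (\<lambda>_. c) i + v i + ennreal (max \<epsilon> (\<theta> ^ Suc n))"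
    proof (intro add_mono order_refl)
      have "(\<integral>\<^sup>+ s\<in>{0..t}. ?e s * (?q * v i) \<partial>lborel) \<le> ?e t * v i + (\<integral>\<^sup>+ s\<in>{0..t}. ?e s * (?q * v i) \<partial>lborel)"
        by (rule add_increasing) simp_all
      also have "\<dots> = v i"
        by (rule nn_integral_exp_rate) (use Suc.prems diag_nonpos in auto)
      finally show "(\<integral>\<^sup>+ s\<in>{0..t}. ?e s * (?q * v i) \<partial>lborel) \<le> v i" .
      \<comment> \<open>The first jump happens before \<open>t\<close> with probability
        \<open>1 - exp (Q i i * t)\<close>, and only then is the excess \<open>M\<close> of the
        previous step incurred.\<close>
      have "ennreal (exp (Q i i * t) * M) + (\<integral>\<^sup>+ s\<in>{0..t}. ?e s * (?q * ennreal M) \<partial>lborel) = ennreal M"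
        by (subst ennreal_mult, simp, rule M, rule nn_integral_exp_rate) (use Suc.prems diag_nonpos in auto)
      then have "(\<integral>\<^sup>+ s\<in>{0..t}. ?e s * (?q * ennreal M) \<partial>lborel) = ennreal M - ennreal (exp (Q i i * t) * M)"
        by (metis ennreal_add_diff_cancel_left ennreal_neq_top)
      also have "\<dots> = ennreal ((1 - exp (Q i i * t)) * M)"
        using M by (subst ennreal_minus) (auto simp: algebra_simps)
      also have "\<dots> \<le> ennreal (max \<epsilon> (\<theta> ^ Suc n))"
      proof (rule ennreal_leI)
        have "exp (Q i i * T) \<le> exp (Q i i * t)"
          using Suc.prems diag_nonpos[of i] by (simp add: mult_left_mono_neg)
        then have 1: "1 - exp (Q i i * t) \<le> \<theta>"
          using \<theta>(1)[OF True] by linarith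
        have 2: "0 \<le> 1 - exp (Q i i * t)" "1 - exp (Q i i * t) \<le> 1"
          using Suc.prems diag_nonpos[of i] by (auto simp: mult_nonpos_nonneg)
        show "(1 - exp (Q i i * t)) * M \<le> max \<epsilon> (\<theta> ^ Suc n)"
        \<comment> \<open>While \<open>\<theta> ^ n\<close> dominates, the factor
          \<open>\<theta>\<close> contracts it; once \<open>\<epsilon>\<close> dominates,
          \<open>M = \<epsilon>\<close> and the trivial factor 1 suffices.\<close>
        proof (cases "\<epsilon> \<le> \<theta> ^ n")
          case True
          then have "(1 - exp (Q i i * t)) * M \<le> \<theta> * \<theta> ^ n"
            using 1 \<theta>(2) by (auto simp: M_def max_def intro!: mult_right_mono)
          then show ?thesis
            by simp
        next
          case False
          have "(1 - exp (Q i i * t)) * M \<le> 1 * M"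
            by (intro mult_right_mono 2 M)
          then show ?thesis
            using False by (simp add: M_def)
        qed
      qed
      finally show "(\<integral>\<^sup>+ s\<in>{0..t}. ?e s * (?q * ennreal M) \<partial>lborel) \<le> ennreal (max \<epsilon> (\<theta> ^ Suc n))" .
    qed
    finally show ?thesis .
  qed
qed

text \<open>Mass can be lost only through infinity, where \<open>v\<close> is at least about 1,
  while the mean of \<open>v\<close> grows at most at rate \<open>c\<close>. Hence the loss up to
  time \<open>t\<close> is at most \<open>v i + c * t\<close>.\<close>

lemma feller_semigroup_barrier:
  assumes v: "\<And>i. jump_op Q v i \<le> ennreal (- Q i i) * v i + c"
    and fin: "\<And>\<epsilon>::real. \<epsilon> > 0 \<Longrightarrow> finite {i. v i + ennreal \<epsilon> < 1}"
    and t: "0 \<le> t"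
  shows "1 \<le> feller_semigroup Q t (\<lambda>_. 1) i + c * ennreal t + v i"
proof (rule ennreal_le_epsilon)
  fix \<epsilon> :: real assume \<epsilon>: "\<epsilon> > 0"
  define F where "F = {i. v i + ennreal \<epsilon> < 1}"
  have F: "finite F" "\<And>i. i \<notin> F \<Longrightarrow> 1 \<le> v i + ennreal \<epsilon>"
    using fin[OF \<epsilon>] by (auto simp: F_def)
  \<comment> \<open>The element 0 makes the maximum exist for empty \<open>F\<close> and keeps it
    nonnegative. Finiteness of \<open>F\<close> is what gives \<open>\<theta> < 1\<close>, so that
    the excess dies out in \<open>n\<close>.\<close>
  define \<theta> where "\<theta> = Max (insert 0 ((\<lambda>i. 1 - exp (Q i i * t)) ` F))"
  have \<theta>: "1 - exp (Q i i * t) \<le> \<theta>" if "i \<in> F" for i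
    unfolding \<theta>_def using F that by (intro Max_ge) auto
  have "0 \<le> \<theta>"
    unfolding \<theta>_def using F by (intro Max_ge) auto
  have "\<theta> < 1"
    unfolding \<theta>_def using F by (subst Max_less_iff) auto
  then obtain n where n: "\<theta> ^ n < \<epsilon>"
    using real_arch_pow_inv[OF \<epsilon>] by blast
  have "1 \<le> dynkin_op Q n t (\<lambda>_. 1) (\<lambda>_. c) i + v i + ennreal (max \<epsilon> (\<theta> ^ n))"
    by (rule dynkin_op_barrier[OF v F(2) \<theta> \<open>0 \<le> \<theta>\<close> t order_refl])
  also have "dynkin_op Q n t (\<lambda>_. 1) (\<lambda>_. c) i \<le> feller_semigroup Q t (\<lambda>_. 1) i + c * ennreal t"
    unfolding dynkin_op_def
  proof (rule add_mono)
    show "feller_op Q n t (\<lambda>_. 1) i \<le> feller_semigroup Q t (\<lambda>_. 1) i"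
      unfolding feller_semigroup_SUP by (rule SUP_upper) simp
    have "(\<integral>\<^sup>+ s\<in>{0..t}. feller_op Q n s (\<lambda>_. c) i \<partial>lborel) \<le> (\<integral>\<^sup>+ s\<in>{0..t}. c \<partial>lborel)"
      by (intro nn_integral_mono) (auto simp: indicator_def feller_op_const_le)
    then show "(\<integral>\<^sup>+ s\<in>{0..t}. feller_op Q n s (\<lambda>_. c) i \<partial>lborel) \<le> c * ennreal t"
      using t by (simp add: nn_integral_cmult)
  qed
  finally show "1 \<le> feller_semigroup Q t (\<lambda>_. 1) i + c * ennreal t + v i + ennreal \<epsilon>"
    using n by (simp add: max_absorb1 add_mono order_trans)
qed

text \<open>The comparison gives one inequality. The other is the same comparison for
  \<open>H - h\<close>, with the source \<open>g\<close> moved to the opposite side; honesty makes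
  the mean of the constant \<open>H\<close> equal to \<open>H\<close>, and boundedness of
  \<open>h\<close> permits the cancellations.\<close>

lemma dynkin_formula:
  assumes honest: "feller_semigroup Q t (\<lambda>_. 1) i = 1"
    and H: "\<And>k. h k \<le> ennreal H"
    and g: "\<And>k. jump_op Q h k + g k = ennreal (- Q k k) * h k"
    and t: "t \<ge> 0"
  shows "feller_semigroup Q t h i + (\<integral>\<^sup>+ s\<in>{0..t}. feller_semigroup Q s g i \<partial>lborel) = h i"
proof (rule antisym)
  have "feller_semigroup Q t h i + (\<integral>\<^sup>+ s\<in>{0..t}. feller_semigroup Q s g i \<partial>lborel) \<le>
      h i + (\<integral>\<^sup>+ s\<in>{0..t}. feller_semigroup Q s (\<lambda>_. 0) i \<partial>lborel)"
    by (rule dynkin_semigroup_le) (use g t diag_nonpos in auto)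
  then show "feller_semigroup Q t h i + (\<integral>\<^sup>+ s\<in>{0..t}. feller_semigroup Q s g i \<partial>lborel) \<le> h i"
    by (simp add: feller_semigroup_def)
  define h' where "h' k = ennreal H - h k" for k
  have h': "h k + h' k = ennreal H" for k
    using H[of k] unfolding h'_def by (rule add_diff_inverse_ennreal)
  have "jump_op Q h' k \<le> ennreal (- Q k k) * h' k + g k" for k
  proof -
    have fin: "jump_op Q h k \<noteq> \<top>"
    proof -
      have "jump_op Q h k \<le> jump_op Q (\<lambda>_. ennreal H) k"
        by (rule jump_op_mono) (rule H)
      also have "\<dots> < \<top>"
        by (simp add: jump_op_const ennreal_mult_less_top)
      finally show ?thesis
        by simp
    qed
    have "jump_op Q h k + jump_op Q h' k = jump_op Q (\<lambda>_. ennreal H) k"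
      by (simp add: jump_op_add[symmetric] h')
    also have "\<dots> = ennreal (- Q k k) * (h k + h' k)"
      by (simp add: jump_op_const h')
    also have "\<dots> = jump_op Q h k + (ennreal (- Q k k) * h' k + g k)"
      by (simp only: distrib_left g[symmetric] add_ac)
    finally show ?thesis
      using fin by (simp add: ennreal_add_left_cancel)
  qed
  then have "feller_semigroup Q t h' i + (\<integral>\<^sup>+ s\<in>{0..t}. feller_semigroup Q s (\<lambda>_. 0) i \<partial>lborel) \<le>
      h' i + (\<integral>\<^sup>+ s\<in>{0..t}. feller_semigroup Q s g i \<partial>lborel)"
    by (intro dynkin_semigroup_le) (use t diag_nonpos in auto)
  then have *: "feller_semigroup Q t h' i \<le> h' i + (\<integral>\<^sup>+ s\<in>{0..t}. feller_semigroup Q s g i \<partial>lborel)"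
    by (simp add: feller_semigroup_def)
  have "h' i + h i = feller_semigroup Q t (\<lambda>k. ennreal H * 1) i"
    by (subst feller_semigroup_cmult) (simp add: honest h' add.commute)
  also have "\<dots> = feller_semigroup Q t h i + feller_semigroup Q t h' i"
    by (simp add: h' feller_semigroup_add[symmetric])
  also have "\<dots> \<le> h' i + (feller_semigroup Q t h i + (\<integral>\<^sup>+ s\<in>{0..t}. feller_semigroup Q s g i \<partial>lborel))"
    using add_left_mono[OF *, of "feller_semigroup Q t h i"] by (simp only: add_ac)
  finally show "h i \<le> feller_semigroup Q t h i + (\<integral>\<^sup>+ s\<in>{0..t}. feller_semigroup Q s g i \<partial>lborel)"
    by (simp add: h'_def ennreal_add_left_cancel_le)
qed

end

section \<open>Hitting times of an absorbing state\<close>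

lemma feller_minimal_absorbing:
  assumes "\<And>j. Q z j = 0"
  shows "feller_minimal Q t z z = 1"
proof -
  have "feller_iter Q m t z z = 1" for m
    by (cases m) (simp_all add: assms)
  then show ?thesis
    by (simp add: feller_minimal_def)
qed

locale minimal_process_absorbing =
  fixes Q :: "'s::countable \<Rightarrow> 's \<Rightarrow> real" and i z :: 's and M :: "'w measure"
    and X :: "real \<Rightarrow> 'w \<Rightarrow> 's option"
  assumes process: "feller_minimal_process Q i M X"
    and absorbing: "\<And>j. Q z j = 0"
begin

sublocale prob_space M
  using process by (simp add: feller_minimal_process_def)

lemma X_measurable [measurable]: "t \<ge> 0 \<Longrightarrow> X t \<in> M \<rightarrow>\<^sub>M count_space UNIV"
  using process by (simp add: feller_minimal_process_def)

lemma right_constant: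
  assumes "\<omega> \<in> space M" "t \<ge> 0"
  obtains b where "b > t" "\<And>s. t < s \<Longrightarrow> s < b \<Longrightarrow> X s \<omega> = X t \<omega>"
  using process assms unfolding feller_minimal_process_def eventually_at_right_field by blast

lemma finite_dim:
  assumes "t 0 = 0" "mono_on {..m} t" "j 0 = i"
  shows "emeasure M {\<omega> \<in> space M. \<forall>l\<le>m. X (t l) \<omega> = Some (j l)} =
          (\<Prod>l<m. feller_minimal Q (t (Suc l) - t l) (j l) (j (Suc l)))"
  using process assms unfolding feller_minimal_process_def by blast

lemma AE_start: "AE \<omega> in M. X 0 \<omega> = Some i"
  using process by (simp add: feller_minimal_process_def)

lemma marginal:
  assumes t: "t \<ge> 0"
  shows "emeasure M {\<omega> \<in> space M. X t \<omega> = Some j} = feller_minimal Q t i j"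
proof -
  define t' where "t' l = (if l = 0 then 0 else t)" for l :: nat
  define j' where "j' l = (if l = 0 then i else j)" for l :: nat
  have "emeasure M {\<omega> \<in> space M. \<forall>l\<le>1. X (t' l) \<omega> = Some (j' l)} =
          (\<Prod>l<1. feller_minimal Q (t' (Suc l) - t' l) (j' l) (j' (Suc l)))"
    by (rule finite_dim) (use t in \<open>auto simp: t'_def j'_def mono_on_def\<close>)
  also have "\<dots> = feller_minimal Q t i j"
    by (simp add: t'_def j'_def)
  also have "{\<omega> \<in> space M. \<forall>l\<le>1. X (t' l) \<omega> = Some (j' l)} =
      {\<omega> \<in> space M. X 0 \<omega> = Some i \<and> X t \<omega> = Some j}"
    by (auto simp: t'_def j'_def le_Suc_eq)
  also have "emeasure M \<dots> = emeasure M {\<omega> \<in> space M. X t \<omega> = Some j}"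
    using t AE_start by (intro emeasure_eq_AE) auto
  finally show ?thesis .
qed

text \<open>Being in \<open>z\<close> at both times has the same probability as being in
  \<open>z\<close> at time \<open>s\<close>, because
  \<open>feller_minimal Q (t - s) z z = 1\<close>; the first event is contained in the
  second.\<close>

lemma AE_absorbed:
  assumes s: "0 \<le> s" "s \<le> t"
  shows "AE \<omega> in M. X s \<omega> = Some z \<longrightarrow> X t \<omega> = Some z"
proof -
  define t' where "t' l = (if l = 0 then 0 else if l = 1 then s else t)" for l :: nat
  define j' where "j' l = (if l = 0 then i else z)" for l :: nat
  have "emeasure M {\<omega> \<in> space M. \<forall>l\<le>2. X (t' l) \<omega> = Some (j' l)} =
          (\<Prod>l<2. feller_minimal Q (t' (Suc l) - t' l) (j' l) (j' (Suc l)))"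
    by (rule finite_dim) (use s in \<open>auto simp: t'_def j'_def mono_on_def\<close>)
  also have "\<dots> = feller_minimal Q s i z"
    using absorbing by (simp add: t'_def j'_def numeral_2_eq_2 feller_minimal_absorbing)
  also have "{\<omega> \<in> space M. \<forall>l\<le>2. X (t' l) \<omega> = Some (j' l)} =
      {\<omega> \<in> space M. X 0 \<omega> = Some i \<and> X s \<omega> = Some z \<and> X t \<omega> = Some z}"
    by (auto simp: t'_def j'_def le_Suc_eq numeral_2_eq_2)
  also have "emeasure M \<dots> = emeasure M {\<omega> \<in> space M. X s \<omega> = Some z \<and> X t \<omega> = Some z}"
    using s AE_start by (intro emeasure_eq_AE) auto
  finally have "emeasure M {\<omega> \<in> space M. X s \<omega> = Some z \<and> X t \<omega> = Some z} =
      emeasure M {\<omega> \<in> space M. X s \<omega> = Some z}"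
    using s by (simp add: marginal)
  then have "emeasure M ({\<omega> \<in> space M. X s \<omega> = Some z} - {\<omega> \<in> space M. X s \<omega> = Some z \<and> X t \<omega> = Some z}) = 0"
    using s by (subst emeasure_Diff) auto
  moreover have "{\<omega> \<in> space M. \<not> (X s \<omega> = Some z \<longrightarrow> X t \<omega> = Some z)} =
    {\<omega> \<in> space M. X s \<omega> = Some z} - {\<omega> \<in> space M. X s \<omega> = Some z \<and> X t \<omega> = Some z}"
    by auto
  ultimately show ?thesis
    using s by (subst AE_iff_measurable[OF _ refl]) auto
qed

text \<open>By right-continuity in the discrete topology a visit to \<open>z\<close> lasts for a
  while, so it is also seen at rational times just after it. The countable infimum yields
  measurability.\<close>

lemma hitting_time_INF:
  assumes \<omega>: "\<omega> \<in> space M"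
  shows "hitting_time X z \<omega> = (INF r\<in>\<rat> \<inter> {0..}. if X r \<omega> = Some z then ennreal r else \<infinity>)"
proof (rule antisym)
  show "hitting_time X z \<omega> \<le> (INF r\<in>\<rat> \<inter> {0..}. if X r \<omega> = Some z then ennreal r else \<infinity>)"
    unfolding hitting_time_def by (rule INF_greatest) (auto intro!: Inf_lower)
  show "(INF r\<in>\<rat> \<inter> {0..}. if X r \<omega> = Some z then ennreal r else \<infinity>) \<le> hitting_time X z \<omega>"
    unfolding hitting_time_def
  proof (rule Inf_greatest, clarify)
    fix t :: real assume t: "0 \<le> t" "X t \<omega> = Some z"
    show "(INF r\<in>\<rat> \<inter> {0..}. if X r \<omega> = Some z then ennreal r else \<infinity>) \<le> ennreal t"
    proof (rule ennreal_le_epsilon)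
      fix e :: real assume e: "e > 0"
      obtain b where b: "b > t" "\<And>s. t < s \<Longrightarrow> s < b \<Longrightarrow> X s \<omega> = X t \<omega>"
        by (rule right_constant[OF \<omega> t(1)]) blast
      obtain r where r: "r \<in> \<rat>" "t < r" "r < min b (t + e)"
        using Rats_dense_in_real[of t "min b (t + e)"] b e by auto
      have "(INF r\<in>\<rat> \<inter> {0..}. if X r \<omega> = Some z then ennreal r else \<infinity>) \<le> ennreal r"
        using r t b(2)[of r] by (intro INF_lower2[of r]) auto
      also have "\<dots> \<le> ennreal t + ennreal e"
        using r t e by (subst ennreal_plus[symmetric]) (auto simp del: ennreal_plus intro!: ennreal_leI)
      finally show "(INF r\<in>\<rat> \<inter> {0..}. if X r \<omega> = Some z then ennreal r else \<infinity>) \<le> ennreal t + ennreal e" .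
    qed
  qed
qed

lemma hitting_time_measurable [measurable]: "hitting_time X z \<in> borel_measurable M"
proof -
  have "(\<lambda>\<omega>. INF r\<in>\<rat> \<inter> {0..}. if X r \<omega> = Some z then ennreal r else \<infinity>) \<in> borel_measurable M"
  proof (rule borel_measurable_INF)
    show "countable (\<rat> \<inter> {0::real..})"
      by (intro countable_Int1 countable_rat)
  qed auto
  then show ?thesis
    by (subst measurable_cong[OF hitting_time_INF])
qed

lemma feller_minimal_le_hitting:
  assumes "t \<ge> 0"
  shows "feller_minimal Q t i z \<le> emeasure M {\<omega> \<in> space M. hitting_time X z \<omega> < \<infinity>}"
proof -
  have "hitting_time X z \<omega> < \<infinity>" if "X t \<omega> = Some z" for \<omega>
  proof (rule le_less_trans)
    show "hitting_time X z \<omega> \<le> ennreal t"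
      unfolding hitting_time_def using that assms by (intro Inf_lower) auto
  qed simp
  then show ?thesis
    unfolding marginal[OF assms, symmetric] by (intro emeasure_mono) auto
qed

text \<open>One null set has to serve all real \<open>t\<close>. Absorption is therefore required
  almost surely at the countably many pairs of rational times, and right-continuity extends it to
  all times of the path.\<close>

lemma AE_hitting_time_le_iff:
  "AE \<omega> in M. \<forall>t\<ge>0. hitting_time X z \<omega> \<le> ennreal t \<longleftrightarrow> X t \<omega> = Some z"
proof -
  have "AE \<omega> in M. \<forall>s\<in>\<rat> \<inter> {0..}. \<forall>t\<in>\<rat> \<inter> {s..}. X s \<omega> = Some z \<longrightarrow> X t \<omega> = Some z"
    by (intro AE_ball_countable[THEN iffD2] countable_Int1 countable_rat ballI AE_absorbed) auto
  then show ?thesis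
  proof (rule AE_mp, intro AE_I2 impI allI)
    fix \<omega> and t :: real
    assume \<omega>: "\<omega> \<in> space M" and t: "0 \<le> t"
      and *: "\<forall>s\<in>\<rat> \<inter> {0..}. \<forall>t\<in>\<rat> \<inter> {s..}. X s \<omega> = Some z \<longrightarrow> X t \<omega> = Some z"
    have absorbed: "X s' \<omega> = Some z" if s: "0 \<le> s" "s < s'" "X s \<omega> = Some z" for s s'
    proof -
      obtain b where b: "b > s" "\<And>r. s < r \<Longrightarrow> r < b \<Longrightarrow> X r \<omega> = X s \<omega>"
        by (rule right_constant[OF \<omega> s(1)]) blast
      obtain b' where b': "b' > s'" "\<And>r. s' < r \<Longrightarrow> r < b' \<Longrightarrow> X r \<omega> = X s' \<omega>"
        using right_constant[OF \<omega>, of s'] s by auto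
      obtain r where r: "r \<in> \<rat>" "s < r" "r < min b s'"
        using Rats_dense_in_real[of s "min b s'"] b s by auto
      obtain r' where r': "r' \<in> \<rat>" "s' < r'" "r' < b'"
        using Rats_dense_in_real[OF b'(1)] by auto
      have "X r \<omega> = Some z"
        using b(2)[of r] r s by simp
      then have "X r' \<omega> = Some z"
        using bspec[OF bspec[OF *, of r], of r'] r r' s by simp
      then show ?thesis
        using b'(2)[of r'] r' by simp
    qed
    show "hitting_time X z \<omega> \<le> ennreal t \<longleftrightarrow> X t \<omega> = Some z"
    proof
      show "hitting_time X z \<omega> \<le> ennreal t" if "X t \<omega> = Some z"
        unfolding hitting_time_def using that t by (intro Inf_lower) auto
      assume hit: "hitting_time X z \<omega> \<le> ennreal t"
      obtain b where b: "b > t" "\<And>s. t < s \<Longrightarrow> s < b \<Longrightarrow> X s \<omega> = X t \<omega>"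
        by (rule right_constant[OF \<omega> t(1)]) blast
      \<comment> \<open>An infimum at most \<open>t\<close> guarantees visits only before every time
        later than \<open>t\<close>. So the path is inspected at such a later time \<open>r\<close>,
        still inside its interval of constancy to the right of \<open>t\<close>.\<close>
      define r where "r = (t + b) / 2"
      have r: "t < r" "r < b"
        using b by (auto simp: r_def)
      have "hitting_time X z \<omega> < ennreal r"
        by (rule le_less_trans[OF hit]) (use r t in \<open>auto simp: ennreal_less_iff\<close>)
      then obtain s where s: "0 \<le> s" "X s \<omega> = Some z" "ennreal s < ennreal r"
        unfolding hitting_time_def by (auto simp: Inf_less_iff)
      then have "s < r"
        using ennreal_less_iff by blast
      then have "X r \<omega> = Some z"
        by (rule absorbed[OF s(1) _ s(2)])
      then show "X t \<omega> = Some z"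
        using b(2)[of r] r by simp
    qed
  qed
qed

lemma nn_integral_hitting_time:
  "(\<integral>\<^sup>+ \<omega>. hitting_time X z \<omega> \<partial>M) = (\<integral>\<^sup>+ t\<in>{0..}. (1 - feller_minimal Q t i z) \<partial>lborel)"
proof -
  interpret pair_sigma_finite M lborel by unfold_locales
  \<comment> \<open>The length of the interval [0, T), valid also for infinite \<open>T\<close>;
    with Tonelli this is the layer-cake formula, without integrability.\<close>
  have T: "T = (\<integral>\<^sup>+ t. indicator {t. 0 \<le> t \<and> ennreal t < T} t \<partial>lborel)" for T
  proof (cases T rule: ennreal_cases)
    case (real r)
    then have "{t. 0 \<le> t \<and> ennreal t < T} = {0..<r}"
      by (auto simp: ennreal_less_iff)
    then show ?thesis
      using real by simp
  next
    case top
    then have "{t. 0 \<le> t \<and> ennreal t < T} = {0..}"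
      by auto
    moreover have "emeasure lborel {0::real..} = \<infinity>"
    proof (rule ccontr)
      assume "emeasure lborel {0::real..} \<noteq> \<infinity>"
      then obtain n where n: "emeasure lborel {0::real..} < of_nat n"
        using ennreal_Ex_less_of_nat[of "emeasure lborel {0::real..}"] by (auto simp: less_top)
      have "of_nat n = emeasure lborel {0::real..real n}"
        by (simp add: ennreal_of_nat_eq_real_of_nat)
      also have "\<dots> \<le> emeasure lborel {0::real..}"
        by (intro emeasure_mono) auto
      finally show False
        using n by simp
    qed
    ultimately show ?thesis
      using top by simp
  qed
  have "(\<integral>\<^sup>+ \<omega>. hitting_time X z \<omega> \<partial>M) =
    (\<integral>\<^sup>+ \<omega>. \<integral>\<^sup>+ t. indicator {p \<in> space (M \<Otimes>\<^sub>M lborel). 0 \<le> snd p \<and> ennreal (snd p) < hitting_time X z (fst p)} (\<omega>, t) \<partial>lborel \<partial>M)"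
    by (intro nn_integral_cong, subst T[of "hitting_time X z _"], intro nn_integral_cong)
       (auto simp: indicator_def space_pair_measure)
  also have "\<dots> = (\<integral>\<^sup>+ t. \<integral>\<^sup>+ \<omega>. indicator {p \<in> space (M \<Otimes>\<^sub>M lborel). 0 \<le> snd p \<and> ennreal (snd p) < hitting_time X z (fst p)} (\<omega>, t) \<partial>M \<partial>lborel)"
    by (rule Fubini'[symmetric]) measurable
  also have "\<dots> = (\<integral>\<^sup>+ t\<in>{0..}. (1 - feller_minimal Q t i z) \<partial>lborel)"
  proof (rule nn_integral_cong)
    fix t :: real
    show "(\<integral>\<^sup>+ \<omega>. indicator {p \<in> space (M \<Otimes>\<^sub>M lborel). 0 \<le> snd p \<and> ennreal (snd p) < hitting_time X z (fst p)} (\<omega>, t) \<partial>M) =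
      (1 - feller_minimal Q t i z) * indicator {0..} t"
    proof (cases "t \<ge> 0")
      case True
      have "(\<integral>\<^sup>+ \<omega>. indicator {p \<in> space (M \<Otimes>\<^sub>M lborel). 0 \<le> snd p \<and> ennreal (snd p) < hitting_time X z (fst p)} (\<omega>, t) \<partial>M) =
        (\<integral>\<^sup>+ \<omega>. indicator (space M - {\<omega> \<in> space M. X t \<omega> = Some z}) \<omega> \<partial>M)"
        using AE_hitting_time_le_iff
        by (intro nn_integral_cong_AE, elim AE_mp, intro AE_I2)
           (use True in \<open>auto simp: indicator_def space_pair_measure not_le[symmetric]\<close>)
      also have "\<dots> = emeasure M (space M - {\<omega> \<in> space M. X t \<omega> = Some z})"
        using True by (intro nn_integral_indicator) auto
      also have "\<dots> = 1 - feller_minimal Q t i z"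
        using True emeasure_finite[of "{\<omega> \<in> space M. X t \<omega> = Some z}"]
        by (subst emeasure_Diff) (auto simp: marginal emeasure_space_1)
      finally show ?thesis
        using True by simp
    qed (simp add: indicator_def)
  qed
  finally show ?thesis .
qed

end

section \<open>Generating functions and the branching generator\<close>

lemma mem_cbox_01: "u \<in> cbox 0 (1 :: real ^ 'n) \<longleftrightarrow> (\<forall>k. 0 \<le> u $ k \<and> u $ k \<le> 1)"
  by (auto simp: mem_box_cart)

lemma monomial_one [simp]: "monomial j 1 = 1"
  by (simp add: monomial_def)

lemma monomial_0 [simp]: "monomial 0 u = 1"
  by (simp add: monomial_def)

lemma monomial_axis [simp]: "monomial (axis k 1) u = u $ k"
proof -
  have "monomial (axis k 1) u = (\<Prod>l\<in>UNIV. if l = k then u $ k else 1)"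
    unfolding monomial_def by (rule prod.cong) (auto simp: axis_def)
  then show ?thesis
    by simp
qed

lemmas monomial_axis_Suc [simp] = monomial_axis[unfolded One_nat_def]

lemma monomial_add: "monomial (i + j) u = monomial i u * monomial j u"
  by (simp add: monomial_def power_add prod.distrib)

lemma monomial_zero: "j \<noteq> 0 \<Longrightarrow> monomial j 0 = 0"
  by (auto simp: monomial_def vec_eq_iff power_0_left)

lemma monomial_nonneg: "u \<in> cbox 0 1 \<Longrightarrow> 0 \<le> monomial j u"
  by (auto simp: monomial_def mem_cbox_01 intro!: prod_nonneg)

lemma monomial_le_1: "u \<in> cbox 0 1 \<Longrightarrow> monomial j u \<le> 1"
  by (auto simp: monomial_def mem_cbox_01 intro!: prod_le_1 power_le_one)

lemma monomial_mono: "u \<in> cbox 0 1 \<Longrightarrow> (\<And>k. u $ k \<le> v $ k) \<Longrightarrow> monomial j u \<le> monomial j v"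
  by (auto simp: monomial_def mem_cbox_01 intro!: prod_mono power_mono)

lemma monomial_le_power:
  assumes "u \<in> cbox 0 1"
  shows "monomial j u \<le> (u $ k) ^ (j $ k)"
proof -
  have "monomial j u = (u $ k) ^ (j $ k) * (\<Prod>l\<in>UNIV - {k}. (u $ l) ^ (j $ l))"
    unfolding monomial_def by (subst prod.remove[of _ k]) auto
  also have "\<dots> \<le> (u $ k) ^ (j $ k) * 1"
    using assms by (intro mult_left_mono prod_le_1) (auto simp: mem_cbox_01 intro: power_le_one)
  finally show ?thesis
    by simp
qed

lemma monomial_le_coord:
  assumes "u \<in> cbox 0 1" "j $ k > 0"
  shows "monomial j u \<le> u $ k"
proof -
  have "(u $ k) ^ (j $ k) \<le> (u $ k) ^ 1"
    using assms by (intro power_decreasing) (auto simp: mem_cbox_01)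
  then show ?thesis
    using monomial_le_power[OF assms(1), of j k] by simp
qed

lemma continuous_on_monomial [continuous_intros]:
  "continuous_on A f \<Longrightarrow> continuous_on A (\<lambda>y. monomial j (f y))"
  unfolding monomial_def by (intro continuous_intros)

text \<open>Replace one factor at a time. The positive parts matter: a factor with
  \<open>x a < y a\<close> costs nothing, which is the source of the quasi-monotonicity of the
  branching functions.\<close>

lemma prod_diff_le:
  fixes x y :: "'a \<Rightarrow> real"
  assumes "finite A" "\<And>a. a \<in> A \<Longrightarrow> 0 \<le> x a \<and> x a \<le> 1" "\<And>a. a \<in> A \<Longrightarrow> 0 \<le> y a \<and> y a \<le> 1"
  shows "(\<Prod>a\<in>A. x a) - (\<Prod>a\<in>A. y a) \<le> (\<Sum>a\<in>A. max 0 (x a - y a))"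
  using assms
proof (induction A)
  case (insert a A)
  have P: "0 \<le> (\<Prod>a\<in>A. x a)" "(\<Prod>a\<in>A. x a) \<le> 1"
    using insert.prems by (auto intro!: prod_nonneg prod_le_1)
  have "(x a - y a) * (\<Prod>a\<in>A. x a) \<le> max 0 (x a - y a) * 1"
    using P by (intro mult_mono) auto
  moreover have "y a * ((\<Prod>a\<in>A. x a) - (\<Prod>a\<in>A. y a)) \<le> 1 * (\<Sum>a\<in>A. max 0 (x a - y a))"
  proof -
    have "y a * ((\<Prod>a\<in>A. x a) - (\<Prod>a\<in>A. y a)) \<le> y a * (\<Sum>a\<in>A. max 0 (x a - y a))"
      using insert by (intro mult_left_mono) auto
    also have "\<dots> \<le> 1 * (\<Sum>a\<in>A. max 0 (x a - y a))"
      using insert by (intro mult_right_mono sum_nonneg) auto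
    finally show ?thesis .
  qed
  moreover have "x a * (\<Prod>a\<in>A. x a) - y a * (\<Prod>a\<in>A. y a) =
      (x a - y a) * (\<Prod>a\<in>A. x a) + y a * ((\<Prod>a\<in>A. x a) - (\<Prod>a\<in>A. y a))"
    by (simp add: algebra_simps)
  ultimately show ?case
    using insert by simp
qed simp

lemma power_diff_le:
  fixes x y :: real
  assumes "0 \<le> x" "x \<le> 1" "0 \<le> y" "y \<le> 1"
  shows "x ^ n - y ^ n \<le> real n * max 0 (x - y)"
  using prod_diff_le[of "{..<n}" "\<lambda>_. x" "\<lambda>_. y"] assms by simp

lemma monomial_diff_le:
  assumes "x \<in> cbox 0 1" "y \<in> cbox 0 1"
  shows "monomial j x - monomial j y \<le> (\<Sum>l\<in>UNIV. real (j $ l) * max 0 (x $ l - y $ l))"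
proof -
  have "monomial j x - monomial j y \<le> (\<Sum>l\<in>UNIV. max 0 ((x $ l) ^ (j $ l) - (y $ l) ^ (j $ l)))"
    unfolding monomial_def using assms by (intro prod_diff_le) (auto simp: mem_cbox_01 power_le_one)
  also have "\<dots> \<le> (\<Sum>l\<in>UNIV. real (j $ l) * max 0 (x $ l - y $ l))"
    using assms by (intro sum_mono max.boundedI power_diff_le) (auto simp: mem_cbox_01)
  finally show ?thesis .
qed

lemma one_minus_monomial_le:
  assumes "u \<in> cbox 0 1"
  shows "1 - monomial j u \<le> (\<Sum>l\<in>UNIV. real (j $ l) * (1 - u $ l))"
  using monomial_diff_le[of 1 u j] assms by (simp add: mem_cbox_01)

section \<open>Power series whose coefficients are jump rates\<close>

lemma has_sum_diff_real:
  fixes f g :: "'a \<Rightarrow> real"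
  assumes "(f has_sum x) A" "(g has_sum y) A"
  shows "((\<lambda>k. f k - g k) has_sum (x - y)) A"
  using has_sum_add[OF assms(1), of "\<lambda>k. - g k" "- y"] assms(2) by (simp add: has_sum_uminus)

text \<open>Common shape of the immigration rates \<open>a\<close>, with exceptional index 0, and of
  the branching rates \<open>b k\<close>, with exceptional index \<open>axis k 1\<close>: total mass
  0 and at most one negative coefficient.\<close>

definition rate_coeff :: "nat ^ 'n \<Rightarrow> (nat ^ 'n \<Rightarrow> real) \<Rightarrow> bool" where
  "rate_coeff e c \<longleftrightarrow> (\<forall>j. j \<noteq> e \<longrightarrow> 0 \<le> c j) \<and> (c has_sum (- c e)) (- {e})"

lemma rate_coeff_abs_summable:
  assumes "rate_coeff e c"
  shows "(\<lambda>j. norm (c j)) summable_on UNIV"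
proof -
  have "c summable_on (- {e})"
    using assms by (auto simp: rate_coeff_def summable_on_def)
  then have "(\<lambda>j. norm (c j)) summable_on (- {e})"
    using assms by (subst summable_on_cong[where g = c]) (auto simp: rate_coeff_def)
  moreover have "(\<lambda>j. norm (c j)) summable_on {e}"
    by simp
  ultimately have "(\<lambda>j. norm (c j)) summable_on (- {e} \<union> {e})"
    by (intro summable_on_Un_disjoint) auto
  then show ?thesis
    by (metis Compl_partition2)
qed

lemma abs_monomial_le_1: "u \<in> cbox 0 1 \<Longrightarrow> \<bar>monomial j u\<bar> \<le> 1"
  using monomial_nonneg monomial_le_1 by fastforce

lemma abs_coeff_monomial_le: "u \<in> cbox 0 1 \<Longrightarrow> \<bar>(c :: real) * monomial j u\<bar> \<le> \<bar>c\<bar>"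
  using abs_monomial_le_1[of u j] by (simp add: abs_mult mult_left_le)

context
  fixes e :: "nat ^ 'n" and c :: "nat ^ 'n \<Rightarrow> real"
  assumes c: "rate_coeff e c"
begin

lemma gen_fun_has_sum:
  assumes "u \<in> cbox 0 1"
  shows "((\<lambda>j. c j * monomial j u) has_sum gen_fun c u) UNIV"
proof -
  have "(\<lambda>j. c j * monomial j u) summable_on UNIV"
    by (rule abs_summable_summable, rule Infinite_Sum.abs_summable_on_comparison_test[OF rate_coeff_abs_summable[OF c]])
       (use abs_coeff_monomial_le[OF assms] in auto)
  then show ?thesis
    by (simp add: gen_fun_def)
qed

lemma gen_fun_1 [simp]: "gen_fun c 1 = 0"
proof -
  have "(c has_sum (- c e + c e)) (- {e} \<union> {e})"
    using c has_sum_finite[of "{e}" c] by (intro has_sum_Un_disjoint) (auto simp: rate_coeff_def)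
  then have "(c has_sum 0) UNIV"
    by (metis Compl_partition2 add.left_inverse)
  moreover have "(c has_sum gen_fun c 1) UNIV"
    using gen_fun_has_sum[of 1] by (simp add: mem_cbox_01)
  ultimately show ?thesis
    using has_sum_unique by blast
qed

lemma continuous_on_gen_fun: "continuous_on (cbox 0 1) (gen_fun c)"
proof -
  have "uniform_limit (cbox 0 1) (\<lambda>X u. \<Sum>j\<in>X. c j * monomial j u) (\<lambda>u. \<Sum>\<^sub>\<infinity>j. c j * monomial j u)
     (finite_subsets_at_top UNIV)"
    by (rule Weierstrass_m_test_general[OF _ rate_coeff_abs_summable[OF c]])
       (use abs_coeff_monomial_le in auto)
  then show ?thesis
    unfolding gen_fun_def[abs_def]
    by (rule uniform_limit_theorem[rotated]) (auto intro!: always_eventually continuous_intros)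
qed

text \<open>Only the coefficient at \<open>e\<close> may be negative. With its term split off, the
  remaining series admits termwise comparison.\<close>

lemma gen_fun_diff_has_sum:
  assumes u: "u \<in> cbox 0 1" and v: "v \<in> cbox 0 1"
  shows "((\<lambda>j. c j * (monomial j u - monomial j v)) has_sum
    (gen_fun c u - gen_fun c v - c e * (monomial e u - monomial e v))) (- {e})"
proof -
  have "((\<lambda>j. c j * monomial j u - c j * monomial j v) has_sum (gen_fun c u - gen_fun c v)) UNIV"
    using gen_fun_has_sum u v by (intro has_sum_diff_real) auto
  moreover have "((\<lambda>j. c j * monomial j u - c j * monomial j v) has_sum
      (c e * monomial e u - c e * monomial e v)) {e}"
    using has_sum_finite[of "{e}" "\<lambda>j. c j * monomial j u - c j * monomial j v"] by simp
  ultimately have "((\<lambda>j. c j * monomial j u - c j * monomial j v) has_sum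
     (gen_fun c u - gen_fun c v - (c e * monomial e u - c e * monomial e v))) (UNIV - {e})"
    by (rule has_sum_Diff) auto
  then show ?thesis
    by (simp add: Compl_eq_Diff_UNIV right_diff_distrib)
qed

text \<open>Substituting \<open>j + d\<close> for \<open>j\<close> pulls out the factor
  \<open>monomial d u\<close>. The rows of the q-matrix are sums of such shifted series.\<close>

lemma shifted_has_sum:
  assumes "u \<in> cbox 0 1"
  shows "((\<lambda>j. (if d \<le> j then c (j - d) else 0) * monomial j u) has_sum
    (monomial d u * gen_fun c u)) UNIV"
proof -
  have "((\<lambda>j. monomial d u * (c j * monomial j u)) has_sum (monomial d u * gen_fun c u)) UNIV"
    by (intro has_sum_cmult_right gen_fun_has_sum assms)
  also have "(\<lambda>j. monomial d u * (c j * monomial j u)) = (\<lambda>j. c (j - d) * monomial j u) \<circ> (\<lambda>j. j + d)"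
    by (auto simp: monomial_add vec_eq_iff intro!: ext arg_cong[of _ _ c])
  finally have "((\<lambda>j. c (j - d) * monomial j u) has_sum (monomial d u * gen_fun c u)) (range (\<lambda>j. j + d))"
    by (subst has_sum_reindex) (auto intro!: injI simp: o_def)
  also have "range (\<lambda>j. j + d) = {j. d \<le> j}"
  proof (intro set_eqI iffI)
    fix j assume "j \<in> {j. d \<le> j}"
    then have "j = (j - d) + d"
      by (auto simp: vec_eq_iff less_eq_vec_def)
    then show "j \<in> range (\<lambda>j. j + d)"
      by blast
  qed (auto simp: less_eq_vec_def)
  finally show ?thesis
    by (rule has_sum_cong_neutral[THEN iffD1, rotated 3]) auto
qed

end

lemma has_sum_sum_finite:
  fixes f :: "'k \<Rightarrow> 'a \<Rightarrow> real"
  assumes "finite K" "\<And>k. k \<in> K \<Longrightarrow> (f k has_sum s k) A"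
  shows "((\<lambda>x. \<Sum>k\<in>K. f k x) has_sum (\<Sum>k\<in>K. s k)) A"
  using assms by (induction K) (auto intro!: has_sum_add)

lemma nn_integral_has_sum:
  fixes f :: "'a \<Rightarrow> real"
  assumes "(f has_sum S) A" "\<And>x. x \<in> A \<Longrightarrow> 0 \<le> f x"
  shows "(\<integral>\<^sup>+ x. ennreal (f x) \<partial>count_space A) = ennreal S"
proof -
  have "f summable_on A"
    using assms by (auto simp: summable_on_def)
  then have "(\<lambda>x. norm (f x)) summable_on A"
    using assms(2) by (subst summable_on_cong[where g = f]) auto
  then have *: "Infinite_Set_Sum.abs_summable_on f A"
    by (simp only: abs_summable_equivalent)
  show ?thesis
    using assms nn_integral_conv_infsetsum[OF *] infsetsum_infsum[OF *] infsumI[OF assms(1)] by simp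
qed

text \<open>The generator applied to \<open>j \<mapsto> monomial j u\<close>, evaluated at
  \<open>i\<close>. Where \<open>i $ k = 0\<close> the truncated subtraction
  \<open>i - axis k 1\<close> is harmless, since the factor \<open>i $ k\<close> removes the
  term.\<close>

definition tbi_operator ::
  "(nat ^ 'n \<Rightarrow> real) \<Rightarrow> ('n::finite \<Rightarrow> nat ^ 'n \<Rightarrow> real) \<Rightarrow> real ^ 'n \<Rightarrow> nat ^ 'n \<Rightarrow> real" where
  "tbi_operator a b u i = (if i = 0 then 0 else
     (\<Sum>k\<in>UNIV. real (i $ k) * (monomial (i - axis k 1) u * gen_fun (b k) u)) + gen_fun a u * monomial i u)"

section \<open>The branching q-matrix acting on monomials\<close>

locale tbi =
  fixes a :: "nat ^ 'n \<Rightarrow> real" and b :: "'n::finite \<Rightarrow> nat ^ 'n \<Rightarrow> real"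
  assumes data: "tbi_data a b"
begin

abbreviation "Q \<equiv> absorptive_tbi a b"

lemma a_coeff: "rate_coeff 0 a"
  using data by (auto simp: tbi_data_def rate_coeff_def)

lemma b_coeff: "rate_coeff (axis k 1) (b k)"
  using data by (auto simp: tbi_data_def rate_coeff_def)

lemma a0_neg: "a 0 < 0" and b_neg: "b k (axis k 1) < 0"
  using data by (auto simp: tbi_data_def)

text \<open>The only negative coefficients are \<open>a 0\<close> and \<open>b k (axis k 1)\<close>,
  and in row \<open>i\<close> they can enter only in column \<open>i\<close>.\<close>

lemma Q_offdiag_nonneg:
  assumes "j \<noteq> i"
  shows "0 \<le> Q i j"
proof -
  have b: "0 \<le> (if i \<le> j + axis k 1 then b k (j + axis k 1 - i) else 0)" for k
  proof (cases "i \<le> j + axis k 1 \<and> j + axis k 1 - i = axis k 1")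
    case True
    have "j $ l = i $ l" for l
    proof -
      have "i $ l \<le> j $ l + axis k 1 $ l" "j $ l + axis k 1 $ l - i $ l = axis k 1 $ l"
        using True by (auto simp: less_eq_vec_def vec_eq_iff)
      then show ?thesis
        by linarith
    qed
    then show ?thesis
      using assms by (auto simp: vec_eq_iff)
  next
    case False
    then show ?thesis
      using b_coeff[of k] by (auto simp: rate_coeff_def)
  qed
  have a: "0 \<le> (if i \<le> j then a (j - i) else 0)"
  proof (cases "i \<le> j \<and> j - i = 0")
    case True
    have "j $ l = i $ l" for l
    proof -
      have "i $ l \<le> j $ l" "j $ l - i $ l = 0"
        using True by (auto simp: less_eq_vec_def vec_eq_iff)
      then show ?thesis
        by linarith
    qed
    then show ?thesis
      using assms by (auto simp: vec_eq_iff)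
  next
    case False
    then show ?thesis
      using a_coeff by (auto simp: rate_coeff_def)
  qed
  show ?thesis
    unfolding absorptive_tbi_def using a b by (auto intro!: add_nonneg_nonneg sum_nonneg)
qed

lemma Q_diag: "i \<noteq> 0 \<Longrightarrow> Q i i = (\<Sum>k\<in>UNIV. real (i $ k) * b k (axis k 1)) + a 0"
  by (simp add: absorptive_tbi_def less_eq_vec_def)

lemma Q_diag_nonpos: "Q i i \<le> 0"
proof (cases "i = 0")
  case False
  have "(\<Sum>k\<in>UNIV. real (i $ k) * b k (axis k 1)) \<le> 0"
    using b_neg by (intro sum_nonpos) (simp add: mult_nonneg_nonpos less_imp_le)
  then show ?thesis
    using Q_diag[OF False] a0_neg by linarith
qed (simp add: absorptive_tbi_def)

lemma Q_monomial_has_sum: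
  assumes u: "u \<in> cbox 0 1"
  shows "((\<lambda>j. Q i j * monomial j u) has_sum tbi_operator a b u i) UNIV"
proof (cases "i = 0")
  case True
  then show ?thesis
    by (simp add: absorptive_tbi_def tbi_operator_def)
next
  case False
  have b: "((\<lambda>j. real (i $ k) * ((if i \<le> j + axis k 1 then b k (j + axis k 1 - i) else 0) * monomial j u))
      has_sum (real (i $ k) * (monomial (i - axis k 1) u * gen_fun (b k) u))) UNIV" for k
  \<comment> \<open>For \<open>i $ k > 0\<close> the subtraction \<open>i - axis k 1\<close> is
    exact, so the coefficients are those of a series shifted by it; for \<open>i $ k = 0\<close> the
    prefactor vanishes.\<close>
  proof (cases "i $ k = 0")
    case False
    have "i \<le> j + axis k 1 \<longleftrightarrow> i - axis k 1 \<le> j" for j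
      by (auto simp: less_eq_vec_def le_diff_conv)
    moreover have "j + axis k 1 - i = j - (i - axis k 1)" for j
    proof (rule vec_eq_iff[THEN iffD2], rule allI)
      fix l
      show "(j + axis k 1 - i) $ l = (j - (i - axis k 1)) $ l"
        using False by (cases "l = k") (auto simp: axis_def)
    qed
    ultimately show ?thesis
      by (simp only:) (intro has_sum_cmult_right shifted_has_sum[OF b_coeff u])
  qed simp
  have "((\<lambda>j. (\<Sum>k\<in>UNIV. real (i $ k) * ((if i \<le> j + axis k 1 then b k (j + axis k 1 - i) else 0) * monomial j u))
      + (if i \<le> j then a (j - i) else 0) * monomial j u) has_sum
     ((\<Sum>k\<in>UNIV. real (i $ k) * (monomial (i - axis k 1) u * gen_fun (b k) u)) + monomial i u * gen_fun a u)) UNIV"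
    by (intro has_sum_add has_sum_sum_finite b shifted_has_sum[OF a_coeff u]) auto
  moreover have "(\<lambda>j. (\<Sum>k\<in>UNIV. real (i $ k) * ((if i \<le> j + axis k 1 then b k (j + axis k 1 - i) else 0) * monomial j u))
      + (if i \<le> j then a (j - i) else 0) * monomial j u) = (\<lambda>j. Q i j * monomial j u)"
    using False by (simp add: absorptive_tbi_def distrib_right sum_distrib_right mult.assoc fun_eq_iff)
  ultimately show ?thesis
    using False by (simp add: tbi_operator_def mult.commute)
qed

lemma tbi_operator_1 [simp]: "tbi_operator a b 1 i = 0"
  by (simp add: tbi_operator_def gen_fun_1[OF a_coeff] gen_fun_1[OF b_coeff])

lemma jump_op_has_sum:
  assumes "((\<lambda>j. Q i j * f j) has_sum S) UNIV" "\<And>j. 0 \<le> f j"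
  shows "jump_op Q (\<lambda>j. ennreal (f j)) i = ennreal (S - Q i i * f i)"
proof -
  have "((\<lambda>j. Q i j * f j) has_sum (Q i i * f i)) {i}"
    using has_sum_finite[of "{i}" "\<lambda>j. Q i j * f j"] by simp
  from has_sum_Diff[OF assms(1) this]
  have "((\<lambda>j. Q i j * f j) has_sum (S - Q i i * f i)) (- {i})"
    by (simp add: Compl_eq_Diff_UNIV)
  then have "(\<integral>\<^sup>+ j. ennreal (Q i j * f j) \<partial>count_space (- {i})) = ennreal (S - Q i i * f i)"
    by (rule nn_integral_has_sum) (use Q_offdiag_nonneg assms(2) in auto)
  then show ?thesis
    unfolding jump_op_def using assms(2)
    by (subst (asm) nn_integral_cong[where v = "\<lambda>j. ennreal (Q i j) * ennreal (f j)"])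
       (auto simp: ennreal_mult'')
qed

lemma jump_op_one_minus_monomial:
  assumes u: "u \<in> cbox 0 1"
  shows "jump_op Q (\<lambda>j. ennreal (1 - monomial j u)) i =
    ennreal (- Q i i * (1 - monomial i u) - tbi_operator a b u i)"
proof -
  have "((\<lambda>j. Q i j * monomial j 1 - Q i j * monomial j u) has_sum
      (tbi_operator a b 1 i - tbi_operator a b u i)) UNIV"
    by (intro has_sum_diff_real Q_monomial_has_sum u) (simp add: mem_cbox_01)
  then have "((\<lambda>j. Q i j * (1 - monomial j u)) has_sum (- tbi_operator a b u i)) UNIV"
    by (simp add: right_diff_distrib)
  from jump_op_has_sum[OF this] show ?thesis
    using monomial_le_1[OF u] by (simp add: algebra_simps)
qed

sublocale conservative_q_matrix Q
proof
  show "jump_op Q (\<lambda>_. 1) i = ennreal (- Q i i)" for i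
    using jump_op_has_sum[of i "\<lambda>_. 1" 0] Q_monomial_has_sum[of 1 i] by (simp add: mem_cbox_01)
qed (rule Q_diag_nonpos)

lemma gen_fun_a_nonpos:
  assumes u: "u \<in> cbox 0 1"
  shows "gen_fun a u \<le> 0"
proof -
  have 1: "1 \<in> cbox 0 (1 :: real ^ 'n)"
    by (simp add: mem_cbox_01)
  have "((\<lambda>j. a j * (monomial j u - 1)) has_sum gen_fun a u) (- {0})"
    using gen_fun_diff_has_sum[OF a_coeff u 1] by (simp add: gen_fun_1[OF a_coeff])
  then show ?thesis
    by (rule has_sum_mono[of _ _ _ "\<lambda>_. 0"])
       (use a_coeff monomial_le_1[OF u] in \<open>auto simp: rate_coeff_def mult_nonneg_nonpos\<close>)
qed

end

section \<open>Mean matrix and common zeros\<close>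

text \<open>No nonempty proper set of types is closed under the edges of the graph of
  \<open>M\<close>. In this form irreducibility applies directly to sets such as the zero set of a
  vector, without paths or powers.\<close>

definition irreducible_matrix :: "real ^ 'n ^ 'n \<Rightarrow> bool" where
  "irreducible_matrix M \<longleftrightarrow>
     (\<forall>S. S \<noteq> {} \<longrightarrow> (\<forall>k\<in>S. \<forall>l. l \<notin> S \<longrightarrow> M $ k $ l = 0) \<longrightarrow> S = UNIV)"

text \<open>If no edge leaves \<open>S\<close>, then every power of \<open>M\<close> has zero
  entries from \<open>S\<close> to its complement.\<close>

lemma positively_regular_irreducible:
  fixes M :: "real ^ 'n ^ 'n"
  assumes "positively_regular M"
  shows "irreducible_matrix M"
  unfolding irreducible_matrix_def
proof (intro allI impI)
  fix S :: "'n set"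
  assume "S \<noteq> {}" and S: "\<forall>k\<in>S. \<forall>l. l \<notin> S \<longrightarrow> M $ k $ l = 0"
  then obtain k where k: "k \<in> S"
    by auto
  obtain m where m: "(((**) M ^^ m) (mat 1)) $ i $ j > 0" for i j
    using assms by (auto simp: positively_regular_def)
  have *: "(((**) M ^^ p) (mat 1)) $ i $ l = 0" if "i \<in> S" "l \<notin> S" for p i l
    using that(1)
  proof (induction p arbitrary: i)
    case 0
    then show ?case
      using that by (auto simp: mat_def)
  next
    case (Suc p)
    have "M $ i $ r * (((**) M ^^ p) (mat 1)) $ r $ l = 0" for r
      using S Suc that(2) by (cases "r \<in> S") auto
    then have "(\<Sum>r\<in>UNIV. M $ i $ r * (((**) M ^^ p) (mat 1)) $ r $ l) = 0"
      by (intro sum.neutral) simp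
    then show ?case
      by (subst funpow.simps(2), subst o_apply, subst matrix_matrix_mult_def) simp
  qed
  show "S = UNIV"
  proof (rule ccontr)
    assume "S \<noteq> UNIV"
    then obtain l where "l \<notin> S"
      by auto
    from *[OF k this, of m] m[of k l] show False
      by simp
  qed
qed

text \<open>Perron-Frobenius from Brouwer's theorem on the simplex \<open>K\<close>, applied to the
  normalised action of \<open>M\<close> shifted by \<open>c\<close>. At a zero coordinate of the
  fixed vector all nonnegative terms of its row vanish, so no edge leaves the zero set; by
  irreducibility that set is empty.\<close>

lemma irreducible_metzler_eigenvector:
  fixes M :: "real ^ 'n ^ 'n"
  assumes metzler: "\<And>k l. k \<noteq> l \<Longrightarrow> 0 \<le> M $ k $ l" and irr: "irreducible_matrix M"
  obtains w r where "\<And>k. 0 < w $ k" "M *v w = r *\<^sub>R w"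
proof -
  \<comment> \<open>The shift exceeds every diagonal entry in absolute value. A positive diagonal
    ensures that no point of the simplex is mapped to 0, so normalisation is possible.\<close>
  define c where "c = 1 + (\<Sum>k\<in>UNIV. \<bar>M $ k $ k\<bar>)"
  have c: "0 < M $ k $ k + c" for k
  proof -
    have "\<bar>M $ k $ k\<bar> \<le> (\<Sum>k\<in>UNIV. \<bar>M $ k $ k\<bar>)"
      by (rule member_le_sum) auto
    then show ?thesis
      by (simp add: c_def)
  qed
  define T where "T x = M *v x + c *\<^sub>R x" for x
  define K :: "(real ^ 'n) set" where "K = {x. (\<forall>k. 0 \<le> x $ k) \<and> (\<Sum>k\<in>UNIV. x $ k) = 1}"
  define s where "s x = (\<Sum>k\<in>UNIV. T x $ k)" for x
  have T_eq: "T x $ k = (M $ k $ k + c) * x $ k + (\<Sum>l\<in>UNIV - {k}. M $ k $ l * x $ l)" for x k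
    unfolding T_def matrix_vector_mult_def
    by (simp add: sum.remove[of UNIV k] algebra_simps)
  have T_nonneg: "0 \<le> T x $ k" and T_ge: "(M $ k $ k + c) * x $ k \<le> T x $ k" if "x \<in> K" for x k
  proof -
    have "0 \<le> (\<Sum>l\<in>UNIV - {k}. M $ k $ l * x $ l)"
      using that metzler by (intro sum_nonneg mult_nonneg_nonneg) (auto simp: K_def)
    then show "(M $ k $ k + c) * x $ k \<le> T x $ k"
      by (simp add: T_eq)
    moreover have "0 \<le> (M $ k $ k + c) * x $ k"
      using that c[of k] by (auto simp: K_def intro!: mult_nonneg_nonneg less_imp_le)
    ultimately show "0 \<le> T x $ k"
      by linarith
  qed
  have s_pos: "0 < s x" if x: "x \<in> K" for x
  proof -
    have "\<exists>k. 0 < x $ k"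
    proof (rule ccontr)
      assume "\<not> ?thesis"
      then have "x $ k = 0" for k
        using x by (auto simp: K_def not_less intro: antisym)
      then show False
        using x by (simp add: K_def)
    qed
    then obtain k where "0 < x $ k" ..
    then have "0 < T x $ k"
      using T_ge[OF x, of k] c[of k] by (smt (verit) mult_pos_pos)
    then show ?thesis
      unfolding s_def using T_nonneg[OF x] by (intro sum_pos2[of _ k]) auto
  qed
  have K_le: "x $ k \<le> 1" if "x \<in> K" for x k
    using member_le_sum[of k UNIV "\<lambda>k. x $ k"] that by (auto simp: K_def)
  have "closed K"
    unfolding K_def
    by (intro closed_Collect_conj closed_Collect_all closed_Collect_le closed_Collect_eq continuous_intros)
  moreover have "bounded K"
    by (rule bounded_subset[OF bounded_cbox[of 0 1]]) (use K_le in \<open>auto simp: mem_cbox_01 K_def\<close>)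
  ultimately have "compact K"
    by (simp add: compact_eq_bounded_closed)
  moreover have "convex K"
    unfolding convex_def K_def
    by (auto simp: sum.distrib sum_distrib_left[symmetric])
  moreover have "K \<noteq> {}"
  proof -
    have "(\<chi> k. 1 / real CARD('n)) \<in> K"
      by (simp add: K_def)
    then show ?thesis
      by blast
  qed
  moreover have contT: "continuous_on K T"
    unfolding T_def by (intro continuous_intros bounded_linear.continuous_on[OF matrix_vector_mul_bounded_linear])
  have "continuous_on K (\<lambda>x. (1 / s x) *\<^sub>R T x)"
    using s_pos unfolding s_def by (intro continuous_intros contT) force
  moreover have "(\<lambda>x. (1 / s x) *\<^sub>R T x) \<in> K \<rightarrow> K"
  proof
    fix x assume x: "x \<in> K"
    have "(\<Sum>k\<in>UNIV. T x $ k / s x) = 1"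
      using s_pos[OF x] by (simp add: sum_divide_distrib[symmetric] s_def[symmetric])
    then show "(1 / s x) *\<^sub>R T x \<in> K"
      using T_nonneg[OF x] s_pos[OF x] by (auto simp: K_def)
  qed
  ultimately obtain x where x: "x \<in> K" and fixed: "(1 / s x) *\<^sub>R T x = x"
    using brouwer[of K "\<lambda>x. (1 / s x) *\<^sub>R T x"] by blast
  have "s x *\<^sub>R ((1 / s x) *\<^sub>R T x) = T x"
    using s_pos[OF x] by simp
  then have Tx: "T x = s x *\<^sub>R x"
    by (simp only: fixed)
  have "{k. x $ k = 0} = {}"
  proof (rule ccontr)
    assume "{k. x $ k = 0} \<noteq> {}"
    then have "{k. x $ k = 0} = UNIV"
    proof (rule irr[unfolded irreducible_matrix_def, rule_format])
      fix k l assume k: "k \<in> {k. x $ k = 0}" and l: "l \<notin> {k. x $ k = 0}"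
      have "(\<Sum>l\<in>UNIV - {k}. M $ k $ l * x $ l) = 0"
        using T_eq[of x k] k by (simp add: Tx)
      then have "M $ k $ l * x $ l = 0"
        using k l x metzler by (subst (asm) sum_nonneg_eq_0_iff) (auto simp: K_def)
      then show "M $ k $ l = 0"
        using l by simp
    qed
    then have "x $ k = 0" for k
      by auto
    then show False
      using x by (simp add: K_def)
  qed
  then have "0 < x $ k" for k
    using x by (auto simp: K_def less_le)
  moreover have "M *v x = (s x - c) *\<^sub>R x"
    using Tx by (simp add: T_def algebra_simps)
  ultimately show ?thesis
    by (rule that)
qed

text \<open>\<open>Max\<close> in \<open>max_eigenvalue\<close> is meaningful only for a finite set.
  The eigenvalues are the roots of the characteristic polynomial, which is not zero because no
  number above the operator norm is an eigenvalue.\<close>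

lemma finite_eigenvalues:
  fixes M :: "real ^ 'n ^ 'n"
  shows "finite {l. \<exists>v. v \<noteq> 0 \<and> M *v v = l *\<^sub>R v}"
proof -
  define P :: "real poly" where
    "P = det (\<chi> i j. [:M $ i $ j:] - (if i = j then [:0, 1:] else 0))"
  have P: "poly P l = det (M - mat l)" for l
    unfolding P_def det_def
    by (auto simp: poly_sum poly_prod mat_def intro!: sum.cong prod.cong)
  have root: "poly P l = 0 \<longleftrightarrow> (\<exists>v. v \<noteq> 0 \<and> M *v v = l *\<^sub>R v)" for l
  proof -
    have "mat l *v v = l *\<^sub>R v" for v :: "real ^ 'n"
      by (simp add: vec_eq_iff matrix_vector_mult_def mat_def if_distrib if_distribR cong: if_cong)
    then have "(M - mat l) *v v = M *v v - l *\<^sub>R v" for v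
      by (simp add: matrix_vector_mult_diff_rdistrib)
    then have "(\<exists>B. B ** (M - mat l) = mat 1) \<longleftrightarrow> (\<forall>v. M *v v = l *\<^sub>R v \<longrightarrow> v = 0)"
      by (simp add: matrix_left_invertible_ker)
    then show ?thesis
      by (metis P invertible_det_nz invertible_left_inverse)
  qed
  have "P \<noteq> 0"
  proof
    assume "P = 0"
    define l where "l = onorm ((*v) M) + 1"
    obtain v where v: "v \<noteq> 0" "M *v v = l *\<^sub>R v"
      using root[of l] \<open>P = 0\<close> by auto
    have "norm (M *v v) \<le> onorm ((*v) M) * norm v"
      by (rule onorm) (rule matrix_vector_mul_bounded_linear)
    moreover have "0 \<le> onorm ((*v) M)"
      by (rule onorm_pos_le) (rule matrix_vector_mul_bounded_linear)
    ultimately show False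
      using v by (simp add: l_def distrib_right)
  qed
  then show ?thesis
    using poly_roots_finite[of P] by (simp add: root)
qed

lemma eigenvalue_le_max_eigenvalue:
  assumes "M *v v = l *\<^sub>R v" "v \<noteq> 0"
  shows "l \<le> max_eigenvalue M"
  unfolding max_eigenvalue_def using assms by (intro Max_ge finite_eigenvalues) auto

text \<open>Apply irreducibility to the set where \<open>x / w\<close> is maximal.\<close>

lemma metzler_maximum_principle:
  fixes M :: "real ^ 'n ^ 'n"
  assumes metzler: "\<And>k l. k \<noteq> l \<Longrightarrow> 0 \<le> M $ k $ l" and irr: "irreducible_matrix M"
    and w: "\<And>k. 0 < w $ k" "M *v w = r *\<^sub>R w" "r \<le> 0"
    and x: "\<And>k. 0 \<le> (M *v x) $ k" and pos: "(\<exists>k. 0 < x $ k) \<or> r = 0"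
  obtains c where "x = c *\<^sub>R w" "M *v x = 0"
proof -
  define c where "c = Max (range (\<lambda>k. x $ k / w $ k))"
  define y where "y = c *\<^sub>R w - x"
  have c_ge: "x $ k / w $ k \<le> c" for k
    unfolding c_def by (rule Max_ge) auto
  have y: "0 \<le> y $ k" for k
    using c_ge[of k] w(1)[of k] by (simp add: y_def pos_divide_le_eq)
  have "c \<in> range (\<lambda>k. x $ k / w $ k)"
    unfolding c_def by (rule Max_in) auto
  then obtain k0 where "c = x $ k0 / w $ k0"
    by auto
  then have k0: "y $ k0 = 0"
    using w(1)[of k0] by (simp add: y_def)
  \<comment> \<open>For \<open>r < 0\<close> this needs \<open>c > 0\<close>, which a positive entry
    of \<open>x\<close> provides; for \<open>r = 0\<close> the sign of \<open>c\<close> is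
    irrelevant.\<close>
  have cr: "c * r \<le> 0"
  proof (cases "r = 0")
    case False
    with pos obtain k where "0 < x $ k"
      by auto
    then have "0 < x $ k / w $ k"
      using w(1) by simp
    then have "0 < c"
      using c_ge[of k] by linarith
    then show ?thesis
      using w(3) by (simp add: mult_nonneg_nonpos)
  qed simp
  have "{k. y $ k = 0} = UNIV"
  proof (rule irr[unfolded irreducible_matrix_def, rule_format])
    show "{k. y $ k = 0} \<noteq> {}"
      using k0 by auto
    fix k l assume k: "k \<in> {k. y $ k = 0}" and l: "l \<notin> {k. y $ k = 0}"
    have "(M *v y) $ k = c * r * w $ k - (M *v x) $ k"
      by (simp add: y_def matrix_vector_mult_diff_distrib matrix_vector_mult_scaleR w(2))
    also have "\<dots> \<le> 0"
      using cr w(1)[of k] x[of k] by (smt (verit) mult_nonpos_nonneg)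
    finally have "(\<Sum>l\<in>UNIV. M $ k $ l * y $ l) \<le> 0"
      by (simp add: matrix_vector_mult_def)
    moreover have nonneg: "0 \<le> M $ k $ l * y $ l" for l
      using y metzler k by (cases "l = k") auto
    moreover have "M $ k $ l * y $ l \<le> (\<Sum>l\<in>UNIV. M $ k $ l * y $ l)"
      using nonneg by (intro member_le_sum) auto
    ultimately have "M $ k $ l * y $ l = 0"
      using nonneg[of l] by linarith
    then show "M $ k $ l = 0"
      using l by simp
  qed
  then have "y $ k = 0" for k
    by auto
  then have eq: "x = c *\<^sub>R w"
    by (simp add: y_def vec_eq_iff)
  have "(M *v x) $ k = 0" for k
  proof -
    have "(M *v x) $ k = c * r * w $ k"
      by (simp add: eq matrix_vector_mult_scaleR w(2))
    also have "\<dots> \<le> 0"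
      using cr w(1)[of k] by (simp add: mult_nonpos_nonneg)
    finally show ?thesis
      using x[of k] by simp
  qed
  then show ?thesis
    by (intro that[OF eq]) (simp add: vec_eq_iff)
qed

text \<open>Split off one factor \<open>u $ l\<close>. The linear bound for the remaining exponent
  \<open>j'\<close> comes multiplied by \<open>u $ l < 1\<close>, so equality forces the remaining
  sum \<open>S\<close> to be at most 0, and then \<open>j' = 0\<close>.\<close>

lemma one_minus_monomial_strict:
  assumes u: "\<And>l. 0 \<le> u $ l" "\<And>l. u $ l < 1"
    and eq: "1 - monomial j u = (\<Sum>l\<in>UNIV. real (j $ l) * (1 - u $ l))"
  shows "(\<Sum>l\<in>UNIV. j $ l) \<le> 1"
proof (cases "j = 0")
  case False
  then obtain l where l: "j $ l \<noteq> 0"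
    by (auto simp: vec_eq_iff)
  define j' where "j' = j - axis l 1"
  have j: "j = axis l 1 + j'"
    using l by (auto simp: j'_def vec_eq_iff axis_def)
  have cu: "u \<in> cbox 0 1"
    using u by (auto simp: mem_cbox_01 intro: less_imp_le)
  define S where "S = (\<Sum>m\<in>UNIV. real (j' $ m) * (1 - u $ m))"
  have Sj: "(\<Sum>m\<in>UNIV. real (j $ m) * (1 - u $ m)) = 1 - u $ l + S"
  proof -
    have "(\<Sum>m\<in>UNIV. real (axis l 1 $ m) * (1 - u $ m)) = (\<Sum>m\<in>UNIV. if m = l then 1 - u $ l else 0)"
      by (intro sum.cong) (auto simp: axis_def)
    then show ?thesis
      by (simp add: j S_def distrib_right sum.distrib)
  qed
  have "S \<le> 0"
  proof -
    have "1 - monomial j u = 1 - u $ l + u $ l * (1 - monomial j' u)"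
      by (simp add: j monomial_add algebra_simps)
    also have "\<dots> \<le> 1 - u $ l + u $ l * S"
      unfolding S_def using u by (intro add_left_mono mult_left_mono one_minus_monomial_le cu)
    finally have "(1 - u $ l) * S \<le> 0"
      using eq Sj by (simp add: algebra_simps)
    then show ?thesis
      using u(2)[of l] by (simp add: mult_le_0_iff)
  qed
  moreover have "real (j' $ m) * (1 - u $ m) \<le> S" for m
    unfolding S_def by (rule member_le_sum) (use u(2) in \<open>auto intro!: mult_nonneg_nonneg simp: less_imp_le\<close>)
  ultimately have le: "real (j' $ m) * (1 - u $ m) \<le> 0" for m
    by (rule order_trans[rotated])
  have "j' $ m = 0" for m
    using u(2)[of m] le[of m] by (auto simp: mult_le_0_iff)
  then have "j = axis l 1"
    by (simp add: j vec_eq_iff)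
  moreover have "(\<Sum>m\<in>UNIV. axis l 1 $ m) = (\<Sum>m\<in>UNIV. if m = l then 1 else (0::nat))"
    by (intro sum.cong) (auto simp: axis_def)
  ultimately show ?thesis
    by simp
qed simp

section \<open>First moments and uniqueness of the common zero\<close>

context tbi
begin

lemma monomial_set_coord: "monomial j (set_coord l 1 x) = x ^ (j $ l)"
proof -
  have "monomial j (set_coord l 1 x) = (\<Prod>m\<in>UNIV. if m = l then x ^ (j $ l) else 1)"
    unfolding monomial_def by (rule prod.cong) (auto simp: set_coord_def)
  then show ?thesis
    by simp
qed

text \<open>
  One-sided differentiability at the corner bounds the partial sums of the moments, because
  \<open>(1 - x ^ n) / (1 - x) = (\<Sum>i<n. x ^ i)\<close> increases to \<open>n\<close> as \<open>x\<close> increases to \<open>1\<close>.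
\<close>

lemma moment_has_sum:
  assumes "finite_first_moments b"
  shows "((\<lambda>j. b k j * real (j $ l)) has_sum gf_jacobian b 1 $ k $ l) UNIV"
proof -
  let ?e = "axis k 1 :: nat ^ 'n"
  define g where "g x = gen_fun (b k) (set_coord l 1 x)" for x
  define D where "D = gf_jacobian b 1 $ k $ l"
  \<comment> \<open>The derivative without the term of \<open>?e\<close>, whose coefficient is
    negative. The remaining series has nonnegative terms, so its finite partial sums bound the
    moments by \<open>D'\<close>.\<close>
  define D' where "D' = D - b k ?e * real (?e $ l)"
  define geo where "geo n x = (\<Sum>i<n. x ^ i)" for n and x :: real
  define r where "r x = (g x - g 1) / (x - 1) - b k ?e * geo (?e $ l) x" for x
  have bk: "0 \<le> b k j" if "j \<noteq> ?e" for j
    using b_coeff[of k] that by (auto simp: rate_coeff_def)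
  have geo: "x ^ n - 1 = (x - 1) * geo n x" for n x
    using one_diff_power_eq[of x n] by (simp add: geo_def algebra_simps)
  have "g differentiable (at 1 within {0..1})"
    using assms by (simp add: finite_first_moments_def g_def[abs_def])
  then have "(g has_vector_derivative D) (at 1 within {0..1})"
    by (simp add: vector_derivative_works D_def gf_jacobian_def g_def[abs_def])
  then have "((\<lambda>x. (g x - g 1) / (x - 1)) \<longlongrightarrow> D) (at 1 within {0..1})"
    by (simp add: has_real_derivative_iff_has_vector_derivative[symmetric] has_field_derivative_iff)
  then have lim: "((\<lambda>x. (g x - g 1) / (x - 1)) \<longlongrightarrow> D) (at_left 1)"
    by (simp add: at_within_Icc_at_left)
  have geo_lim: "(geo n \<longlongrightarrow> real n) (at_left 1)" for n
  proof -
    have "isCont (geo n) 1"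
      unfolding geo_def[abs_def] by (intro continuous_intros)
    then have "(geo n \<longlongrightarrow> geo n 1) (at_left 1)"
      by (simp add: isCont_def filterlim_at_split)
    then show ?thesis
      by (simp add: geo_def)
  qed
  have r_lim: "(r \<longlongrightarrow> D') (at_left 1)"
    unfolding r_def[abs_def] D'_def by (intro tendsto_intros lim geo_lim)
  have r_sum: "((\<lambda>j. b k j * geo (j $ l) x) has_sum r x) (- {?e})" if "x \<in> {0..<1}" for x
  proof -
    have cb: "set_coord l 1 x \<in> cbox 0 1" "set_coord l 1 1 \<in> cbox 0 (1 :: real ^ 'n)"
      using that by (auto simp: mem_cbox_01 set_coord_def)
    have "((\<lambda>j. b k j * (x ^ (j $ l) - 1) * (1 / (x - 1))) has_sum
       ((g x - g 1 - b k ?e * (x ^ (?e $ l) - 1)) * (1 / (x - 1)))) (- {?e})"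
      using gen_fun_diff_has_sum[OF b_coeff[of k] cb]
      by (intro has_sum_cmult_left) (simp only: monomial_set_coord g_def power_one)
    also have "(\<lambda>j. b k j * (x ^ (j $ l) - 1) * (1 / (x - 1))) = (\<lambda>j. b k j * geo (j $ l) x)"
      using that by (simp add: geo fun_eq_iff)
    also have "(g x - g 1 - b k ?e * (x ^ (?e $ l) - 1)) * (1 / (x - 1)) = r x"
      using that by (simp add: r_def geo field_simps)
    finally show ?thesis .
  qed
  have ev: "eventually (\<lambda>x. x \<in> {0..<1}) (at_left (1::real))"
    by (rule eventually_at_leftI[of 0]) auto
  have geo_nonneg: "0 \<le> geo n x" and geo_le: "geo n x \<le> real n" if "x \<in> {0..<1}" for n x
    using that sum_bounded_above[of "{..<n}" "\<lambda>i. x ^ i" 1]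
    by (auto simp: geo_def power_le_one intro!: sum_nonneg)
  have partial: "(\<Sum>j\<in>F. b k j * real (j $ l)) \<le> D'" if F: "finite F" "F \<subseteq> - {?e}" for F
  proof (rule tendsto_le[OF _ r_lim])
    show "((\<lambda>x. \<Sum>j\<in>F. b k j * geo (j $ l) x) \<longlongrightarrow> (\<Sum>j\<in>F. b k j * real (j $ l))) (at_left 1)"
      by (intro tendsto_intros geo_lim)
    show "\<forall>\<^sub>F x in at_left 1. (\<Sum>j\<in>F. b k j * geo (j $ l) x) \<le> r x"
      using ev
    proof eventually_elim
      case (elim x)
      show ?case
        by (rule finite_sum_le_has_sum[OF r_sum[OF elim] F]) (use bk geo_nonneg[OF elim] in auto)
    qed
  qed simp
  have "(\<lambda>j. b k j * real (j $ l)) summable_on (- {?e})"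
    by (rule nonneg_bdd_above_summable_on) (use bk partial in \<open>auto intro!: bdd_aboveI[of _ D']\<close>)
  then obtain S where S: "((\<lambda>j. b k j * real (j $ l)) has_sum S) (- {?e})"
    by (auto simp: summable_on_def)
  have "S \<le> D'"
    by (rule has_sum_le_finite_sums[OF S partial])
  moreover have "D' \<le> S"
  proof (rule tendsto_le[OF _ tendsto_const r_lim])
    show "\<forall>\<^sub>F x in at_left 1. r x \<le> S"
      using ev
    proof eventually_elim
      case (elim x)
      show ?case
        by (rule has_sum_mono[OF r_sum[OF elim] S]) (use bk geo_le[OF elim] in \<open>auto intro!: mult_left_mono\<close>)
    qed
  qed simp
  ultimately have "S + b k ?e * real (?e $ l) = D"
    by (simp add: D'_def)
  moreover have "((\<lambda>j. b k j * real (j $ l)) has_sum (S + b k ?e * real (?e $ l))) (- {?e} \<union> {?e})"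
    using S has_sum_finite[of "{?e}" "\<lambda>j. b k j * real (j $ l)"] by (intro has_sum_Un_disjoint) auto
  ultimately show ?thesis
    by (metis Compl_partition2 D_def)
qed

lemma moment_sum_has_sum:
  assumes "finite_first_moments b"
  shows "((\<lambda>j. b k j * (\<Sum>l\<in>UNIV. real (j $ l) * x $ l)) has_sum (gf_jacobian b 1 *v x) $ k) UNIV"
proof -
  have "((\<lambda>j. \<Sum>l\<in>UNIV. b k j * real (j $ l) * x $ l) has_sum (\<Sum>l\<in>UNIV. gf_jacobian b 1 $ k $ l * x $ l)) UNIV"
    by (intro has_sum_sum_finite has_sum_cmult_left moment_has_sum assms) auto
  then show ?thesis
    by (simp add: sum_distrib_left mult.assoc matrix_vector_mult_def)
qed

lemma jacobian_offdiag_nonneg: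
  assumes "finite_first_moments b" "k \<noteq> l"
  shows "0 \<le> gf_jacobian b 1 $ k $ l"
proof (rule has_sum_nonneg[OF moment_has_sum[OF assms(1)]])
  fix j
  show "0 \<le> b k j * real (j $ l)"
    using b_coeff[of k] assms(2) by (cases "j = axis k 1") (auto simp: rate_coeff_def axis_def)
qed

text \<open>Off the diagonal the matrices differ only by the positive factors
  \<open>- 1 / b k (axis k 1)\<close>, and irreducibility does not see the diagonal.\<close>

lemma jacobian_irreducible:
  assumes "positively_regular (g_matrix b 1)"
  shows "irreducible_matrix (gf_jacobian b 1)"
proof -
  have "g_matrix b 1 $ k $ l = 0 \<longleftrightarrow> gf_jacobian b 1 $ k $ l = 0" if "k \<noteq> l" for k l
    using that b_neg[of k] by (simp add: g_matrix_def)
  then show ?thesis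
    using positively_regular_irreducible[OF assms] unfolding irreducible_matrix_def by metis
qed

text \<open>The linear bound \<open>1 - monomial j u \<le> (\<Sum>l. j $ l * (1 - u $ l))\<close>,
  weighted with the rates, gives \<open>?D *v (1 - u) \<ge> 0\<close> at a common zero.
  Subcriticality and the maximum principle force equality, with \<open>1 - u\<close> a positive
  multiple of \<open>w\<close> and \<open>r = 0\<close>. Then the branching functions are affine,
  and a second use of the maximum principle makes them vanish at 0 as well, contradicting
  \<open>pos\<close>.\<close>

lemma common_zero_unique:
  assumes moments: "finite_first_moments b" and reg: "positively_regular (g_matrix b 1)"
    and max: "max_eigenvalue (gf_jacobian b 1) \<le> 0"
    and pos: "gen_fun (b k1) 0 > 0"
    and u: "u \<in> cbox 0 1" and zero: "\<And>k. gen_fun (b k) u = 0"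
  shows "u = 1"
proof (rule ccontr)
  assume "u \<noteq> 1"
  let ?D = "gf_jacobian b 1"
  note metzler = jacobian_offdiag_nonneg[OF moments] and irr = jacobian_irreducible[OF reg]
  obtain w r where w: "\<And>k. 0 < w $ k" and r: "?D *v w = r *\<^sub>R w"
    using irreducible_metzler_eigenvector[OF metzler irr] by blast
  have "w \<noteq> 0"
    using w by (metis less_irrefl zero_index)
  then have "r \<le> 0"
    using eigenvalue_le_max_eigenvalue[OF r] max by simp
  have cb: "0 \<in> cbox 0 (1 :: real ^ 'n)" "1 \<in> cbox 0 (1 :: real ^ 'n)"
    by (auto simp: mem_cbox_01)
  define excess where "excess j = (\<Sum>l\<in>UNIV. real (j $ l) * (1 - u) $ l) - (1 - monomial j u)" for j
  have excess: "0 \<le> excess j" for j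
    using one_minus_monomial_le[OF u, of j] by (simp add: excess_def)
  have excess_axis: "excess (axis k 1) = 0" for k
  proof -
    have "(\<Sum>l\<in>UNIV. real (axis k 1 $ l) * (1 - u) $ l) = (\<Sum>l\<in>UNIV. if l = k then 1 - u $ k else 0)"
      by (intro sum.cong) (auto simp: axis_def)
    then show ?thesis
      by (simp add: excess_def)
  qed
  have b_excess: "0 \<le> b k j * excess j" for k j
    using b_coeff[of k] excess[of j] by (cases "j = axis k 1") (auto simp: rate_coeff_def excess_axis simp del: One_nat_def)
  have excess_sum: "((\<lambda>j. b k j * excess j) has_sum (?D *v (1 - u)) $ k) UNIV" for k
  proof -
    have "((\<lambda>j. b k j * (\<Sum>l\<in>UNIV. real (j $ l) * (1 - u) $ l) - (b k j * monomial j 1 - b k j * monomial j u)) has_sum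
       ((?D *v (1 - u)) $ k - (gen_fun (b k) 1 - gen_fun (b k) u))) UNIV"
      by (intro has_sum_diff_real moment_sum_has_sum moments gen_fun_has_sum[OF b_coeff] u cb)
    then show ?thesis
      by (simp add: gen_fun_1[OF b_coeff] zero excess_def algebra_simps)
  qed
  have D_nonneg: "0 \<le> (?D *v (1 - u)) $ k" for k
    by (rule has_sum_nonneg[OF excess_sum]) (rule b_excess)
  have "\<exists>k. 0 < (1 - u) $ k"
  proof (rule ccontr)
    assume "\<not> ?thesis"
    then have "u $ k = 1" for k
      using u by (auto simp: mem_cbox_01 not_less intro: antisym)
    then show False
      using \<open>u \<noteq> 1\<close> by (simp add: vec_eq_iff)
  qed
  then obtain c where c: "1 - u = c *\<^sub>R w" and D0: "?D *v (1 - u) = 0"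
    using metzler_maximum_principle[OF metzler irr w r \<open>r \<le> 0\<close> D_nonneg] by blast
  obtain k where "0 < (1 - u) $ k"
    using \<open>\<exists>k. 0 < (1 - u) $ k\<close> ..
  then have "c > 0"
    using w[of k] by (simp add: c zero_less_mult_iff)
  have u_less: "u $ k < 1" for k
  proof -
    have "(1 - u) $ k > 0"
      using w[of k] \<open>c > 0\<close> by (simp add: c)
    then show ?thesis
      by simp
  qed
  have "c * r * w $ k = 0"
    using D0 arg_cong[of _ _ "\<lambda>v. v $ k"] by (fastforce simp: c matrix_vector_mult_scaleR r)
  then have "r = 0"
    using \<open>c > 0\<close> w[of k] by simp
  \<comment> \<open>The nonnegative terms of \<open>excess_sum\<close> add up to 0, so each vanishes
    and only monomials of degree at most 1 carry a rate.\<close>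
  have single: "(\<Sum>l\<in>UNIV. j $ l) \<le> 1" if "b k j \<noteq> 0" for k j
  proof -
    have "b k j * excess j \<le> 0"
      using finite_sum_le_has_sum[OF excess_sum[of k], of "{j}"] b_excess D0 by simp
    then have "excess j = 0"
      using b_excess[of k j] that by simp
    then show ?thesis
      using u u_less by (intro one_minus_monomial_strict[of u]) (auto simp: excess_def mem_cbox_01)
  qed
  have B0: "((\<lambda>j. b k j * monomial j 0) has_sum gen_fun (b k) 0) UNIV" for k
    by (rule gen_fun_has_sum[OF b_coeff cb(1)])
  \<comment> \<open>For an affine function that vanishes at the corner 1, the derivative in
    direction \<open>- 1\<close> is its value at the origin.\<close>
  have D1: "(?D *v (- 1)) $ k = gen_fun (b k) 0" for k
  proof -
    have "((\<lambda>j. b k j * monomial j 0 - b k j * monomial j 1) has_sum (gen_fun (b k) 0 - gen_fun (b k) 1)) UNIV"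
      by (intro has_sum_diff_real B0 gen_fun_has_sum[OF b_coeff] cb)
    moreover have "b k j * monomial j 0 - b k j * monomial j 1 = b k j * (\<Sum>l\<in>UNIV. real (j $ l) * (- 1) $ l)" for j
    proof (cases "b k j = 0 \<or> j = 0")
      case False
      then have "(\<Sum>l\<in>UNIV. j $ l) \<noteq> 0"
        by (auto simp: vec_eq_iff)
      then have "(\<Sum>l\<in>UNIV. j $ l) = 1"
        using False single[of k j] by linarith
      then have "(\<Sum>l\<in>UNIV. real (j $ l)) = 1"
        by (metis of_nat_1 of_nat_sum)
      then show ?thesis
        using False by (simp add: monomial_zero sum_negf)
    qed auto
    ultimately have "((\<lambda>j. b k j * (\<Sum>l\<in>UNIV. real (j $ l) * (- 1) $ l)) has_sum gen_fun (b k) 0) UNIV"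
      by (simp add: gen_fun_1[OF b_coeff])
    then show ?thesis
      using has_sum_unique moment_sum_has_sum[OF moments] by blast
  qed
  have B0_nonneg: "0 \<le> gen_fun (b k) 0" for k
  proof (rule has_sum_nonneg[OF B0])
    fix j
    show "0 \<le> b k j * monomial j 0"
      using b_coeff[of k] monomial_nonneg[OF cb(1), of j]
      by (cases "j = axis k 1") (auto simp: rate_coeff_def simp del: One_nat_def)
  qed
  \<comment> \<open>The vector \<open>- 1\<close> has no positive entry; the maximum principle
    applies through its alternative \<open>r = 0\<close>.\<close>
  have "?D *v (- 1) = 0"
    using metzler_maximum_principle[OF metzler irr w r \<open>r \<le> 0\<close>, of "- 1"] D1 B0_nonneg \<open>r = 0\<close> by metis
  then show False
    using D1[of k1] pos by simp
qed

end

section \<open>The branching curve\<close>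

text \<open>Isolates the final excursion of \<open>f\<close> below 0. In the applications negativity
  of \<open>f\<close> on it fixes the sign of a derivative.\<close>

lemma last_nonneg_point:
  fixes f :: "real \<Rightarrow> real"
  assumes cont: "continuous_on {a..b} f" and ab: "a \<le> b" and a: "0 \<le> f a" and b: "f b < 0"
  obtains t where "a \<le> t" "t < b" "0 \<le> f t" "\<And>x. t < x \<Longrightarrow> x \<le> b \<Longrightarrow> f x < 0"
proof -
  have "compact ({a..b} \<inter> f -` {0..})"
    using continuous_closed_preimage[OF cont] by (intro compact_Int_closed[of "{a..b}" "{a..b} \<inter> f -` {0..}", simplified]) auto
  moreover have "a \<in> {a..b} \<inter> f -` {0..}"
    using ab a by simp
  ultimately obtain t where t: "t \<in> {a..b} \<inter> f -` {0..}" "\<And>x. x \<in> {a..b} \<inter> f -` {0..} \<Longrightarrow> x \<le> t"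
    using compact_attains_sup[of "{a..b} \<inter> f -` {0..}"] by blast
  show ?thesis
  proof (rule that[of t])
    show "t < b"
      using t(1) b by (cases "t = b") auto
    show "f x < 0" if "t < x" "x \<le> b" for x
      using t(1) t(2)[of x] that by (auto simp: not_le[symmetric])
  qed (use t(1) in auto)
qed

section \<open>Positivity, monotonicity and comparability along the curve\<close>

locale tbi_curve = tbi a b for a :: "nat ^ 'n \<Rightarrow> real" and b :: "'n::finite \<Rightarrow> nat ^ 'n \<Rightarrow> real" +
  fixes k1 :: 'n and u :: "real \<Rightarrow> real ^ 'n"
  assumes moments: "finite_first_moments b"
    and regular: "positively_regular (g_matrix b 1)"
    and B1_0_pos: "gen_fun (b k1) 0 > 0"
    and subcritical: "max_eigenvalue (gf_jacobian b 1) \<le> 0"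
    and curve: "branching_curve b k1 u"
begin

abbreviation "B k y \<equiv> gen_fun (b k) (u y)"

lemma u_cube: "y \<in> {0..1} \<Longrightarrow> u y \<in> cbox 0 1"
  and u_k1: "y \<in> {0..1} \<Longrightarrow> u y $ k1 = y"
  and u_0: "u 0 = 0" and u_1: "u 1 = 1"
  and u_cont: "continuous_on {0..1} u"
  using curve by (auto simp: branching_curve_def)

lemma u_bounds: "y \<in> {0..1} \<Longrightarrow> 0 \<le> u y $ k" "y \<in> {0..1} \<Longrightarrow> u y $ k \<le> 1"
  using u_cube by (auto simp: mem_cbox_01)

lemma u_coord_cont: "continuous_on {0..1} (\<lambda>y. u y $ k)"
  by (intro continuous_intros u_cont)

lemma gen_fun_u_cont: "rate_coeff e c \<Longrightarrow> continuous_on {0..1} (\<lambda>y. gen_fun c (u y))"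
  by (rule continuous_on_compose2[OF _ u_cont]) (use u_cube in \<open>auto intro: continuous_on_gen_fun\<close>)

lemma B_cont: "continuous_on {0..1} (B k)"
  by (rule gen_fun_u_cont[OF b_coeff])

text \<open>For \<open>k = k1\<close> the quotient must be 1, the derivative of the parameter
  itself; division by 0 would make it 0, hence the condition on \<open>B k1 y\<close>.\<close>

lemma u_deriv:
  assumes "y \<in> {0..<1}" "B k1 y \<noteq> 0"
  shows "((\<lambda>x. u x $ k) has_real_derivative B k y / B k1 y) (at y within {0..1})"
proof (cases "k = k1")
  case True
  have "((\<lambda>x. x) has_real_derivative 1) (at y within {0..1})"
    by (rule DERIV_ident)
  then have "((\<lambda>x. u x $ k1) has_real_derivative 1) (at y within {0..1})"
    by (rule has_field_derivative_transform_within[of _ _ _ _ 1]) (use u_k1 assms in auto)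
  then show ?thesis
    using True assms by simp
next
  case False
  then show ?thesis
    using curve assms unfolding branching_curve_def by blast
qed

lemma u_deriv_at:
  assumes "0 < y" "y < 1" "B k1 y \<noteq> 0"
  shows "((\<lambda>x. u x $ k) has_real_derivative B k y / B k1 y) (at y)"
  using u_deriv[of y k] assms by (simp add: at_within_Icc_at)

lemma B_0_nonneg: "0 \<le> B k 0"
proof (rule has_sum_nonneg)
  have cb: "0 \<in> cbox 0 (1 :: real ^ 'n)"
    by (auto simp: mem_cbox_01)
  show "((\<lambda>j. b k j * monomial j 0) has_sum B k 0) UNIV"
    unfolding u_0 by (rule gen_fun_has_sum[OF b_coeff cb])
  show "0 \<le> b k j * monomial j 0" for j
    using b_coeff[of k] monomial_nonneg[OF cb, of j]
    by (cases "j = axis k 1") (auto simp: rate_coeff_def simp del: One_nat_def)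
qed

text \<open>The first moment in type \<open>l\<close> of the rates of type \<open>k\<close>, without
  the negative coefficient at \<open>axis k 1\<close>; this makes it nonnegative for
  \<open>k = l\<close> too.\<close>

definition mean_rate :: "'n \<Rightarrow> 'n \<Rightarrow> real" where
  "mean_rate k l = gf_jacobian b 1 $ k $ l - b k (axis k 1) * real (axis k 1 $ l)"

lemma mean_rate_has_sum: "((\<lambda>j. b k j * real (j $ l)) has_sum mean_rate k l) (- {axis k 1})"
proof -
  have "((\<lambda>j. b k j * real (j $ l)) has_sum (b k (axis k 1) * real (axis k 1 $ l))) {axis k 1}"
    using has_sum_finite[of "{axis k 1}" "\<lambda>j. b k j * real (j $ l)"] by simp
  from has_sum_Diff[OF moment_has_sum[OF moments] this] show ?thesis
    by (simp add: mean_rate_def Compl_eq_Diff_UNIV)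
qed

lemma mean_rate_nonneg: "0 \<le> mean_rate k l"
  by (rule has_sum_nonneg[OF mean_rate_has_sum]) (use b_coeff[of k] in \<open>auto simp: rate_coeff_def\<close>)

text \<open>Quasi-monotonicity with explicit constants: in the terms with nonnegative coefficients
  only coordinates that decrease from \<open>y\<close> to \<open>x\<close> can lower the sum, by at
  most their first moments. The negative coefficient contributes exactly the term in coordinate
  \<open>k\<close>.\<close>

lemma gen_fun_b_diff_ge:
  assumes x: "x \<in> cbox 0 1" and y: "y \<in> cbox 0 1"
  shows "gen_fun (b k) x - gen_fun (b k) y \<ge>
    b k (axis k 1) * (x $ k - y $ k) - (\<Sum>l\<in>UNIV. mean_rate k l * max 0 (y $ l - x $ l))"
proof -
  have "((\<lambda>j. \<Sum>l\<in>UNIV. b k j * real (j $ l) * max 0 (y $ l - x $ l)) has_sum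
      (\<Sum>l\<in>UNIV. mean_rate k l * max 0 (y $ l - x $ l))) (- {axis k 1})"
    by (intro has_sum_sum_finite has_sum_cmult_left mean_rate_has_sum) auto
  then have 1: "((\<lambda>j. b k j * (\<Sum>l\<in>UNIV. real (j $ l) * max 0 (y $ l - x $ l))) has_sum
      (\<Sum>l\<in>UNIV. mean_rate k l * max 0 (y $ l - x $ l))) (- {axis k 1})"
    by (simp add: sum_distrib_left mult.assoc)
  have "gen_fun (b k) y - gen_fun (b k) x - b k (axis k 1) * (monomial (axis k 1) y - monomial (axis k 1) x)
      \<le> (\<Sum>l\<in>UNIV. mean_rate k l * max 0 (y $ l - x $ l))"
    by (rule has_sum_mono[OF gen_fun_diff_has_sum[OF b_coeff y x] 1])
       (use b_coeff[of k] monomial_diff_le[OF y x] in \<open>auto simp: rate_coeff_def intro!: mult_left_mono\<close>)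
  then show ?thesis
    by (simp add: algebra_simps)
qed

text \<open>
  The maximum of \<open>- exp (- K * y) * B k y\<close> over \<open>y\<close> and \<open>k\<close> cannot be positive if \<open>K\<close> is large:
  since the last zero of that \<open>B k\<close> the coordinate \<open>k\<close> has decreased, so that \<open>B k\<close> decreased only on
  account of the other coordinates, and these drop by at most a multiple of \<open>exp (K * y) / K\<close>.
\<close>

lemma B_nonneg_before:
  assumes y1: "0 \<le> y1" "y1 < 1" and pos: "\<And>y. 0 \<le> y \<Longrightarrow> y \<le> y1 \<Longrightarrow> 0 < B k1 y"
    and y: "0 \<le> y" "y \<le> y1"
  shows "0 \<le> B k y"
proof (rule ccontr)
  assume neg: "\<not> 0 \<le> B k y"
  have cont: "continuous_on {0..y1} (B k)" for k
    by (rule continuous_on_subset[OF B_cont]) (use y1 in auto)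
  obtain z where z: "z \<in> {0..y1}" "\<And>x. x \<in> {0..y1} \<Longrightarrow> B k1 z \<le> B k1 x"
    using continuous_attains_inf[OF _ _ cont[of k1]] y1 by auto
  define c where "c = B k1 z"
  have c: "0 < c" "\<And>x. x \<in> {0..y1} \<Longrightarrow> c \<le> B k1 x"
    using z pos[of z] by (auto simp: c_def)
  define m where "m = (\<Sum>k\<in>UNIV. \<Sum>l\<in>UNIV. mean_rate k l)"
  have m: "(\<Sum>l\<in>UNIV. mean_rate k l) \<le> m" for k
    unfolding m_def by (rule member_le_sum) (auto intro!: sum_nonneg mean_rate_nonneg)
  have m_nonneg: "0 \<le> m"
    unfolding m_def by (intro sum_nonneg mean_rate_nonneg)
  \<comment> \<open>Chosen to make \<open>m < c * K\<close>: the total effect of the other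
    coordinates, \<open>m / (c * K)\<close> times \<open>n * exp (K * y')\<close>, is then strictly
    smaller than the deficit it would have to explain.\<close>
  define K where "K = m / c + 1"
  have K: "0 < K" "m < c * K"
    using c(1) m_nonneg by (auto simp: K_def field_simps add_nonneg_pos)
  define N where "N k y = exp (- K * y) * - B k y" for k y
  have "\<exists>x\<in>{0..y1}. \<forall>x'\<in>{0..y1}. N k x' \<le> N k x" for k
    unfolding N_def using y1 by (intro continuous_attains_sup continuous_intros cont) auto
  then obtain p where p: "\<And>k. p k \<in> {0..y1}" "\<And>k x. x \<in> {0..y1} \<Longrightarrow> N k x \<le> N k (p k)"
    by metis
  have "Max (range (\<lambda>k. N k (p k))) \<in> range (\<lambda>k. N k (p k))"
    by (rule Max_in) auto
  then obtain k' where k': "Max (range (\<lambda>k. N k (p k))) = N k' (p k')"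
    by (elim rangeE)
  define y' where "y' = p k'"
  have y': "y' \<in> {0..y1}"
    using p by (simp add: y'_def)
  have N_le: "N k x \<le> N k' y'" if "x \<in> {0..y1}" for k x
  proof -
    have "N k x \<le> N k (p k)"
      using p(2) that by simp
    also have "\<dots> \<le> N k' (p k')"
      unfolding k'[symmetric] by (rule Max_ge) auto
    finally show ?thesis
      by (simp add: y'_def)
  qed
  define n where "n = N k' y'"
  have "0 < N k y"
    using neg by (simp add: N_def mult_pos_neg)
  then have n: "0 < n"
    using N_le[of y k] y by (simp add: n_def)
  have B_ge: "- (n * exp (K * x)) \<le> B l x" if "x \<in> {0..y1}" for l x
  proof -
    have "exp (K * x) * N l x \<le> exp (K * x) * n"
      unfolding n_def by (intro mult_left_mono N_le that) auto
    moreover have "exp (K * x) * N l x = - B l x"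
      by (simp add: N_def exp_minus)
    ultimately show ?thesis
      by (simp only: mult.commute[of n])
  qed
  have By': "B k' y' = - (n * exp (K * y'))"
    by (simp add: n_def N_def exp_minus)
  obtain t where t: "0 \<le> t" "t < y'" "0 \<le> B k' t" "\<And>x. t < x \<Longrightarrow> x \<le> y' \<Longrightarrow> B k' x < 0"
  proof (rule last_nonneg_point[of 0 y' "B k'"])
    show "continuous_on {0..y'} (B k')"
      by (rule continuous_on_subset[OF cont]) (use y' in auto)
    show "B k' y' < 0"
      using By' n by simp
  qed (use y' B_0_nonneg in auto)
  have deriv: "((\<lambda>x. u x $ l) has_real_derivative B l x / B k1 x) (at x)" if "t < x" "x < y'" for l x
    by (rule u_deriv_at) (use that t y' y1 pos[of x] in auto)
  have u_cont': "continuous_on {t..y'} (\<lambda>x. u x $ l)" for l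
    by (rule continuous_on_subset[OF u_coord_cont]) (use t y' y1 in auto)
  have dec: "u y' $ k' \<le> u t $ k'"
  proof (rule DERIV_nonpos_imp_decreasing_open[of t y' "\<lambda>x. u x $ k'"])
    fix x assume x: "t < x" "x < y'"
    show "\<exists>d. ((\<lambda>x. u x $ k') has_real_derivative d) (at x) \<and> d \<le> 0"
    proof (intro exI conjI)
      have "B k' x < 0"
        using t(4)[of x] x by simp
      then show "B k' x / B k1 x \<le> 0"
        using x pos[of x] y' t(1) by (intro divide_nonpos_pos) auto
    qed (rule deriv[OF x])
  qed (use t u_cont' in auto)
  \<comment> \<open>Integrates the lower bound \<open>- (n * exp (K * x)) / c\<close> for the
    derivative of coordinate \<open>l\<close> from \<open>t\<close> to \<open>y'\<close> and
    discards the contribution of the lower end, which has a favourable sign.\<close>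
  have drop: "u t $ l - u y' $ l \<le> n / (c * K) * exp (K * y')" for l
  proof -
    have "u t $ l + n / (c * K) * exp (K * t) \<le> u y' $ l + n / (c * K) * exp (K * y')"
    proof (rule DERIV_nonneg_imp_increasing_open[of t y' "\<lambda>x. u x $ l + n / (c * K) * exp (K * x)"])
      fix x assume x: "t < x" "x < y'"
      have x': "x \<in> {0..y1}"
        using x t y' by auto
      have "- (n * exp (K * x)) / c \<le> - (n * exp (K * x)) / B k1 x"
        using c(2)[OF x'] c(1) n by (simp add: frac_le)
      also have "\<dots> \<le> B l x / B k1 x"
        using B_ge[OF x'] pos[of x] x' by (intro divide_right_mono) auto
      finally have "0 \<le> B l x / B k1 x + n / (c * K) * (exp (K * x) * K)"
        using K c by (simp add: field_simps)
      then show "\<exists>d. ((\<lambda>x. u x $ l + n / (c * K) * exp (K * x)) has_real_derivative d) (at x) \<and> 0 \<le> d"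
        using deriv[OF x, of l] c K by (intro exI conjI) (auto intro!: derivative_eq_intros)
    next
      show "continuous_on {t..y'} (\<lambda>x. u x $ l + n / (c * K) * exp (K * x))"
        using c K by (intro continuous_on_add u_cont' continuous_intros)
    qed (use t in auto)
    moreover have "0 \<le> n / (c * K) * exp (K * t)"
      using n c K by simp
    ultimately show ?thesis
      by linarith
  qed
  have "B k' y' - B k' t \<ge> b k' (axis k' 1) * (u y' $ k' - u t $ k') -
      (\<Sum>l\<in>UNIV. mean_rate k' l * max 0 (u t $ l - u y' $ l))"
    by (intro gen_fun_b_diff_ge u_cube) (use t y' y1 in auto)
  moreover have "0 \<le> b k' (axis k' 1) * (u y' $ k' - u t $ k')"
    using dec b_neg[of k'] by (intro mult_nonpos_nonpos) auto
  moreover have "(\<Sum>l\<in>UNIV. mean_rate k' l * max 0 (u t $ l - u y' $ l)) \<le>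
      (\<Sum>l\<in>UNIV. mean_rate k' l * (n / (c * K) * exp (K * y')))"
    using drop n c K by (intro sum_mono mult_left_mono mean_rate_nonneg) auto
  moreover have "\<dots> = (\<Sum>l\<in>UNIV. mean_rate k' l) * (n / (c * K) * exp (K * y'))"
    by (rule sum_distrib_right[symmetric])
  moreover have "\<dots> \<le> m * (n / (c * K) * exp (K * y'))"
    using n c K by (intro mult_right_mono m) auto
  moreover have "m * (n / (c * K) * exp (K * y')) < c * K * (n / (c * K) * exp (K * y'))"
    using n c K by (intro mult_strict_right_mono) auto
  moreover have "c * K * (n / (c * K) * exp (K * y')) = n * exp (K * y')"
    using c K by simp
  ultimately show False
    using t(3) By' by linarith
qed

text \<open>The interval is half-open because \<open>y0\<close> is going to be a first zero of
  \<open>B k1\<close>; the end point is reached by continuity of the curve.\<close>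

lemma u_mono_before:
  assumes pos: "\<And>y. 0 \<le> y \<Longrightarrow> y < y0 \<Longrightarrow> 0 < B k1 y" and "y0 \<le> 1"
    and xy: "0 \<le> x" "x \<le> y" "y \<le> y0"
  shows "u x $ k \<le> u y $ k"
proof (rule DERIV_nonneg_imp_increasing_open[OF xy(2)])
  fix z assume z: "x < z" "z < y"
  show "\<exists>d. ((\<lambda>x. u x $ k) has_real_derivative d) (at z) \<and> 0 \<le> d"
  proof (intro exI conjI)
    show "((\<lambda>x. u x $ k) has_real_derivative B k z / B k1 z) (at z)"
      using z xy pos[of z] \<open>y0 \<le> 1\<close> by (intro u_deriv_at) auto
    show "0 \<le> B k z / B k1 z"
      using z xy pos \<open>y0 \<le> 1\<close> by (intro divide_nonneg_nonneg B_nonneg_before[of z z] less_imp_le[OF pos]) auto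
  qed
next
  show "continuous_on {x..y} (\<lambda>x. u x $ k)"
    by (rule continuous_on_subset[OF u_coord_cont]) (use xy \<open>y0 \<le> 1\<close> in auto)
qed

text \<open>
  At a first zero \<open>y0 < 1\<close> of \<open>B k1\<close> some other \<open>B k\<close> is positive. As \<open>B k1 y\<close> is at most linear in
  \<open>y0 - y\<close>, the \<open>k\<close>-th coordinate of the curve would diverge logarithmically.
\<close>

lemma B_k1_pos:
  assumes "0 \<le> y" "y < 1"
  shows "0 < B k1 y"
proof (rule ccontr)
  assume neg: "\<not> 0 < B k1 y"
  have cont: "continuous_on {0..y} (B k)" for k
    by (rule continuous_on_subset[OF B_cont]) (use assms in auto)
  have "compact ({0..y} \<inter> B k1 -` {..0})"
    using continuous_closed_preimage[OF cont[of k1], of "{..0}"]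
    by (intro compact_Int_closed[of "{0..y}" "{0..y} \<inter> B k1 -` {..0}", simplified]) auto
  moreover have "y \<in> {0..y} \<inter> B k1 -` {..0}"
    using neg assms by auto
  ultimately obtain y0 where y0: "y0 \<in> {0..y} \<inter> B k1 -` {..0}"
      "\<And>x. x \<in> {0..y} \<inter> B k1 -` {..0} \<Longrightarrow> y0 \<le> x"
    using compact_attains_inf[of "{0..y} \<inter> B k1 -` {..0}"] by blast
  have pos: "0 < B k1 x" if "0 \<le> x" "x < y0" for x
    using y0(1) y0(2)[of x] that by (auto simp: not_le[symmetric])
  have y0': "0 < y0" "y0 < 1" "B k1 y0 \<le> 0"
    using y0(1) B1_0_pos assms u_0 by (auto simp: less_le)
  have lim: "((\<lambda>x. B k x) \<longlongrightarrow> B k y0) (at_left y0)" for k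
  proof -
    have "continuous_on {0..y0} (B k)"
      by (rule continuous_on_subset[OF B_cont]) (use y0' in auto)
    then have "((\<lambda>x. B k x) \<longlongrightarrow> B k y0) (at y0 within {0..y0})"
      using y0' by (auto simp: continuous_on_def)
    then show ?thesis
      using y0' by (simp add: at_within_Icc_at_left)
  qed
  have nonneg: "0 \<le> B k x" if "0 \<le> x" "x < y0" for k x
    by (rule B_nonneg_before[of x]) (use that pos y0' in auto)
  have nonneg0: "0 \<le> B k y0" for k
  proof (rule tendsto_lowerbound[OF lim])
    show "\<forall>\<^sub>F x in at_left y0. 0 \<le> B k x"
      by (rule eventually_at_leftI[of 0]) (use nonneg y0' in auto)
  qed simp
  \<comment> \<open>Otherwise \<open>u y0\<close> would be a common zero, hence the corner 1,
    whereas its coordinate \<open>k1\<close> is \<open>y0 < 1\<close>.\<close>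
  have "\<exists>k. B k y0 \<noteq> 0"
  proof (rule ccontr)
    assume "\<not> ?thesis"
    then have "u y0 = 1"
      using y0' by (intro common_zero_unique[OF moments regular subcritical B1_0_pos] u_cube) auto
    then show False
      using u_k1[of y0] y0' by simp
  qed
  then obtain k where "B k y0 \<noteq> 0" ..
  then have k: "0 < B k y0"
    using nonneg0[of k] by simp
  define \<epsilon> where "\<epsilon> = B k y0 / 2"
  have \<epsilon>: "0 < \<epsilon>" "\<epsilon> < B k y0"
    using k by (auto simp: \<epsilon>_def)
  have "\<forall>\<^sub>F x in at_left y0. \<epsilon> < B k x"
    by (rule order_tendstoD(1)[OF lim \<epsilon>(2)])
  then obtain y2 where y2: "y2 < y0" "\<And>x. y2 < x \<Longrightarrow> x < y0 \<Longrightarrow> \<epsilon> < B k x"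
    unfolding eventually_at_left_field by blast
  define y3 where "y3 = max y2 0"
  define \<beta> where "\<beta> = - b k1 (axis k1 1)"
  have \<beta>: "0 < \<beta>"
    using b_neg[of k1] by (simp add: \<beta>_def)
  \<comment> \<open>The curve increases up to \<open>y0\<close>, so the positive parts in the
    quasi-monotone bound vanish, and \<open>B k1 y0 \<le> 0\<close>.\<close>
  have B_le: "B k1 x \<le> \<beta> * (y0 - x)" if "0 \<le> x" "x < y0" for x
  proof -
    have "B k1 y0 - B k1 x \<ge> b k1 (axis k1 1) * (u y0 $ k1 - u x $ k1) -
        (\<Sum>l\<in>UNIV. mean_rate k1 l * max 0 (u x $ l - u y0 $ l))"
      by (intro gen_fun_b_diff_ge u_cube) (use that y0' in auto)
    moreover have "u x $ l \<le> u y0 $ l" for l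
      by (rule u_mono_before[OF pos]) (use that y0' in auto)
    ultimately show ?thesis
      using y0' that u_k1[of y0] u_k1[of x] by (simp add: \<beta>_def)
  qed
  \<comment> \<open>Shrinking the distance to \<open>y0\<close> by the factor \<open>E\<close> lets
    \<open>\<epsilon> / \<beta> * ln (y0 - x)\<close> drop by exactly 2, more than a coordinate
    confined to [0, 1] can rise.\<close>
  define E where "E = exp (- 2 * \<beta> / \<epsilon>)"
  define y4 where "y4 = y0 - (y0 - y3) * E"
  have y34: "0 \<le> y3" "y3 < y0"
    using y2 y0' by (auto simp: y3_def)
  have E: "0 < E" "E < 1" "ln E = - 2 * \<beta> / \<epsilon>"
    using \<beta> \<epsilon> by (auto simp: E_def)
  have "0 < (y0 - y3) * (1 - E)"
    using y34 E by simp
  then have y4: "y3 < y4"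
    by (simp add: y4_def algebra_simps)
  have y4': "y4 < y0"
    using y34 E by (simp add: y4_def)
  have "u y3 $ k + \<epsilon> / \<beta> * ln (y0 - y3) \<le> u y4 $ k + \<epsilon> / \<beta> * ln (y0 - y4)"
  proof (rule DERIV_nonneg_imp_increasing_open[of y3 y4 "\<lambda>x. u x $ k + \<epsilon> / \<beta> * ln (y0 - x)"])
    fix x assume x: "y3 < x" "x < y4"
    then have x': "0 < x" "x < y0"
      using y34 y4 y4' by auto
    have "((\<lambda>x. u x $ k) has_real_derivative B k x / B k1 x) (at x)"
      using x' y0' pos[of x] by (intro u_deriv_at) auto
    then have d: "((\<lambda>x. u x $ k + \<epsilon> / \<beta> * ln (y0 - x)) has_real_derivative
        B k x / B k1 x + \<epsilon> / \<beta> * (- 1 / (y0 - x))) (at x)"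
      using x' \<beta> by (auto intro!: derivative_eq_intros)
    have "\<epsilon> / \<beta> * (1 / (y0 - x)) = \<epsilon> / (\<beta> * (y0 - x))"
      by simp
    also have "\<dots> \<le> B k x / B k1 x"
      using y2(2)[of x] x x' y3_def \<epsilon> B_le[of x] pos[of x] by (intro frac_le) auto
    finally show "\<exists>d. ((\<lambda>x. u x $ k + \<epsilon> / \<beta> * ln (y0 - x)) has_real_derivative d) (at x) \<and> 0 \<le> d"
      using d by (intro exI conjI) auto
  next
    have "continuous_on {y3..y4} (\<lambda>x. u x $ k)"
      by (rule continuous_on_subset[OF u_coord_cont]) (use y34 y4 y4' y0' in auto)
    then show "continuous_on {y3..y4} (\<lambda>x. u x $ k + \<epsilon> / \<beta> * ln (y0 - x))"
      using y4 y4' by (intro continuous_on_add continuous_on_mult continuous_on_const continuous_on_ln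
          continuous_on_diff continuous_on_id) auto
  qed (use y4 y4' in auto)
  moreover have "ln (y0 - y4) = ln (y0 - y3) - 2 * \<beta> / \<epsilon>"
    using y34 E by (simp add: y4_def ln_mult)
  moreover have "\<epsilon> / \<beta> * (ln (y0 - y3) - 2 * \<beta> / \<epsilon>) = \<epsilon> / \<beta> * ln (y0 - y3) - 2"
    using \<epsilon> \<beta> by (simp add: field_simps)
  ultimately have "u y3 $ k + 2 \<le> u y4 $ k"
    by simp
  moreover have "u y4 $ k \<le> 1" "0 \<le> u y3 $ k"
    using u_bounds y34 y4 y4' y0' by auto
  ultimately show False
    by simp
qed

lemma B_nonneg: "0 \<le> y \<Longrightarrow> y < 1 \<Longrightarrow> 0 \<le> B k y"
  by (rule B_nonneg_before[of y]) (auto intro: B_k1_pos)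

lemma u_mono: "0 \<le> x \<Longrightarrow> x \<le> y \<Longrightarrow> y \<le> 1 \<Longrightarrow> u x $ k \<le> u y $ k"
  by (rule u_mono_before[of 1]) (auto intro: B_k1_pos)

text \<open>Where the ratio of \<open>1 - u m\<close> to \<open>1 - u l\<close> is large, it decreases along the curve.\<close>

lemma defect_comparable_edge:
  assumes lm: "l \<noteq> m" "0 < gf_jacobian b 1 $ l $ m"
  obtains K where "0 \<le> K" "\<And>y. y \<in> {0..<1} \<Longrightarrow> 1 - u y $ m \<le> K * (1 - u y $ l)"
proof -
  let ?e = "axis l 1 :: nat ^ 'n"
  have "\<exists>j. 0 < b l j * real (j $ m)"
  proof (rule ccontr)
    assume "\<not> ?thesis"
    then have "gf_jacobian b 1 $ l $ m \<le> 0"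
      by (intro has_sum_mono[OF moment_has_sum[OF moments] has_sum_0_simp]) (auto simp: not_less)
    then show False
      using lm by simp
  qed
  then obtain j where "0 < b l j * real (j $ m)" ..
  then have j: "0 < b l j" "0 < j $ m"
    by (auto simp: zero_less_mult_iff)
  then have je: "j \<noteq> ?e"
    using lm by (auto simp: axis_def)
  define \<beta> where "\<beta> = - b l ?e"
  \<comment> \<open>The 1 gives \<open>\<phi> 0 \<ge> 0\<close> for the function
    \<open>\<phi>\<close> below; the quotient makes \<open>B l \<le> 0\<close> wherever
    \<open>\<phi>\<close> is negative, so that \<open>\<phi>\<close> increases there.\<close>
  define K where "K = max 1 (\<beta> / b l j)"
  \<comment> \<open>Of the whole series only the term of \<open>j\<close> is kept; it sees
    coordinate \<open>m\<close> because \<open>j $ m > 0\<close>.\<close>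
  have B_le: "B l y \<le> \<beta> * (1 - u y $ l) - b l j * (1 - u y $ m)" if y: "y \<in> {0..1}" for y
  proof -
    have cb: "1 \<in> cbox 0 (1 :: real ^ 'n)"
      by (simp add: mem_cbox_01)
    have "(\<Sum>i\<in>{j}. b l i * (monomial i 1 - monomial i (u y))) \<le>
        gen_fun (b l) 1 - B l y - b l ?e * (monomial ?e 1 - monomial ?e (u y))"
      by (rule finite_sum_le_has_sum[OF gen_fun_diff_has_sum[OF b_coeff cb u_cube[OF y]]])
         (use je b_coeff[of l] monomial_le_1[OF u_cube[OF y]] in \<open>auto simp: rate_coeff_def\<close>)
    moreover have "b l j * (1 - u y $ m) \<le> b l j * (1 - monomial j (u y))"
      using monomial_le_coord[OF u_cube[OF y] j(2)] j(1) by (intro mult_left_mono) auto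
    ultimately show ?thesis
      by (simp add: \<beta>_def gen_fun_1[OF b_coeff] algebra_simps)
  qed
  define \<phi> where "\<phi> y = K * (1 - u y $ l) - (1 - u y $ m)" for y
  have "0 \<le> \<phi> y" if y: "y \<in> {0..<1}" for y
  proof (rule ccontr)
    assume "\<not> 0 \<le> \<phi> y"
    then have neg: "\<phi> y < 0"
      by simp
    have cont: "continuous_on {0..y} \<phi>"
      unfolding \<phi>_def by (intro continuous_intros continuous_on_subset[OF u_cont]) (use y in auto)
    obtain t where t: "0 \<le> t" "t < y" "0 \<le> \<phi> t" "\<And>x. t < x \<Longrightarrow> x \<le> y \<Longrightarrow> \<phi> x < 0"
      by (rule last_nonneg_point[OF cont _ _ neg]) (use y u_0 in \<open>auto simp: \<phi>_def K_def\<close>)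
    have "\<phi> t \<le> \<phi> y"
    proof (rule DERIV_nonneg_imp_increasing_open[of t y \<phi>])
      fix x assume x: "t < x" "x < y"
      have x': "0 < x" "x < 1" "x \<in> {0..1}"
        using x t y by auto
      have Bpos: "0 < B k1 x"
        using x' by (intro B_k1_pos) auto
      have "((\<lambda>x. u x $ l) has_real_derivative B l x / B k1 x) (at x)"
        "((\<lambda>x. u x $ m) has_real_derivative B m x / B k1 x) (at x)"
        using x' Bpos by (auto intro!: u_deriv_at)
      then have d: "(\<phi> has_real_derivative K * (0 - B l x / B k1 x) - (0 - B m x / B k1 x)) (at x)"
        unfolding \<phi>_def[abs_def] by (auto intro!: derivative_eq_intros)
      have "\<beta> / b l j * (1 - u x $ l) \<le> K * (1 - u x $ l)"
        using u_bounds[OF x'(3)] by (intro mult_right_mono) (auto simp: K_def)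
      also have "\<dots> < 1 - u x $ m"
        using t(4)[of x] x by (simp add: \<phi>_def)
      finally have "B l x \<le> 0"
        using B_le[OF x'(3)] j(1) by (simp add: field_simps)
      moreover have "0 \<le> B m x"
        using x' by (intro B_nonneg) auto
      moreover have "0 \<le> K"
        by (simp add: K_def)
      ultimately have "0 \<le> (K * (- B l x) + B m x) / B k1 x"
        using Bpos by (intro divide_nonneg_pos add_nonneg_nonneg mult_nonneg_nonneg) auto
      also have "\<dots> = K * (0 - B l x / B k1 x) - (0 - B m x / B k1 x)"
        using Bpos by (simp add: field_simps)
      finally show "\<exists>d. (\<phi> has_real_derivative d) (at x) \<and> 0 \<le> d"
        using d by blast
    next
      show "continuous_on {t..y} \<phi>"
        by (rule continuous_on_subset[OF cont]) (use t in auto)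
    qed (use t in auto)
    then show False
      using neg t(3) by simp
  qed
  then show ?thesis
    by (intro that[of K]) (auto simp: \<phi>_def K_def)
qed

text \<open>The types whose defect is bounded by a multiple of that of \<open>l\<close> form a set
  closed under the edges of the mean matrix, hence contain every type. Summing the finitely many
  constants makes the bound uniform; at \<open>y = 1\<close> both defects are 0.\<close>

lemma defect_comparable:
  obtains K where "0 < K" "\<And>y k l. y \<in> {0..1} \<Longrightarrow> 1 - u y $ k \<le> K * (1 - u y $ l)"
proof -
  define S where "S l = {m. \<exists>K\<ge>0. \<forall>y\<in>{0..<1}. 1 - u y $ m \<le> K * (1 - u y $ l)}" for l
  have "S l = UNIV" for l
  proof (rule jacobian_irreducible[OF regular, unfolded irreducible_matrix_def, rule_format])
    have "l \<in> S l"
      by (auto simp: S_def intro!: exI[of _ 1])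
    then show "S l \<noteq> {}"
      by blast
    fix k m assume k: "k \<in> S l" and m: "m \<notin> S l"
    show "gf_jacobian b 1 $ k $ m = 0"
    proof (rule ccontr)
      assume "gf_jacobian b 1 $ k $ m \<noteq> 0"
      moreover have km: "k \<noteq> m"
        using k m by auto
      ultimately have "0 < gf_jacobian b 1 $ k $ m"
        using jacobian_offdiag_nonneg[OF moments km] by simp
      then obtain K where K: "0 \<le> K" "\<And>y. y \<in> {0..<1} \<Longrightarrow> 1 - u y $ m \<le> K * (1 - u y $ k)"
        using defect_comparable_edge[OF km] by blast
      obtain K' where K': "0 \<le> K'" "\<And>y. y \<in> {0..<1} \<Longrightarrow> 1 - u y $ k \<le> K' * (1 - u y $ l)"
        using k by (auto simp: S_def)
      have "1 - u y $ m \<le> (K * K') * (1 - u y $ l)" if "y \<in> {0..<1}" for y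
        using K(2)[OF that] mult_left_mono[OF K'(2)[OF that] K(1)] by simp
      then have "m \<in> S l"
        using K K' by (auto simp: S_def intro!: exI[of _ "K * K'"])
      then show False
        using m by simp
    qed
  qed
  then have "\<forall>l m. \<exists>K. 0 \<le> K \<and> (\<forall>y\<in>{0..<1}. 1 - u y $ m \<le> K * (1 - u y $ l))"
    unfolding S_def by blast
  then obtain F where "\<forall>l m. 0 \<le> F l m \<and> (\<forall>y\<in>{0..<1}. 1 - u y $ m \<le> F l m * (1 - u y $ l))"
    by (auto simp only: choice_iff)
  then have F: "\<And>l m. 0 \<le> F l m" "\<And>l m y. y \<in> {0..<1} \<Longrightarrow> 1 - u y $ m \<le> F l m * (1 - u y $ l)"
    by blast+
  define K where "K = 1 + (\<Sum>l\<in>UNIV. \<Sum>m\<in>UNIV. F l m)"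
  have FK: "F l m \<le> K" for l m
  proof -
    have "F l m \<le> (\<Sum>m\<in>UNIV. F l m)"
      by (rule member_le_sum) (use F in auto)
    also have "\<dots> \<le> (\<Sum>l\<in>UNIV. \<Sum>m\<in>UNIV. F l m)"
      by (rule member_le_sum[of l UNIV "\<lambda>l. \<Sum>m\<in>UNIV. F l m"]) (use F in \<open>auto intro!: sum_nonneg\<close>)
    finally show ?thesis
      by (simp add: K_def)
  qed
  show ?thesis
  proof (rule that[of K])
    show "0 < K"
      using F by (auto simp: K_def intro!: add_pos_nonneg sum_nonneg)
    fix y :: real and k l assume y: "y \<in> {0..1}"
    show "1 - u y $ k \<le> K * (1 - u y $ l)"
    proof (cases "y = 1")
      case False
      have "1 - u y $ k \<le> F l k * (1 - u y $ l)"
        using F(2)[of y k l] y False by simp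
      also have "\<dots> \<le> K * (1 - u y $ l)"
        using u_bounds[OF y] by (intro mult_right_mono FK) auto
      finally show ?thesis .
    qed (simp add: u_1)
  qed
qed

lemma u_less_1:
  assumes "y \<in> {0..<1}"
  shows "u y $ k < 1"
proof -
  obtain K where "0 < K" and K: "\<And>y k l. y \<in> {0..1} \<Longrightarrow> 1 - u y $ k \<le> K * (1 - u y $ l)"
    using defect_comparable by blast
  have "0 < 1 - u y $ k1"
    using u_k1[of y] assms by simp
  also have "\<dots> \<le> K * (1 - u y $ k)"
    using K[of y k1 k] assms by simp
  finally show ?thesis
    using \<open>0 < K\<close> by (simp add: zero_less_mult_iff)
qed

end

section \<open>Action of the generator along the curve\<close>

lemma continuous_on_indicator_measurable:
  fixes f :: "real \<Rightarrow> real"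
  assumes "continuous_on S f" "S \<in> sets borel"
  shows "(\<lambda>y. ennreal (f y) * indicator S y) \<in> borel_measurable borel"
proof -
  have [measurable]: "(\<lambda>y. indicator S y *\<^sub>R f y) \<in> borel_measurable borel"
    by (rule borel_measurable_continuous_on_indicator[OF assms(2,1)])
  have "(\<lambda>y. ennreal (f y) * indicator S y) = (\<lambda>y. ennreal (indicator S y *\<^sub>R f y))"
    by (auto simp: indicator_def)
  also have "\<dots> \<in> borel_measurable borel"
    by measurable
  finally show ?thesis .
qed

lemma nn_integral_continuous_Icc:
  fixes f :: "real \<Rightarrow> real"
  assumes cont: "continuous_on {x..y} f" and nonneg: "\<And>t. t \<in> {x..y} \<Longrightarrow> 0 \<le> f t"
  shows "(\<integral>\<^sup>+ t\<in>{x..y}. ennreal (f t) \<partial>lborel) = ennreal (integral {x..y} f)"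
proof -
  have int: "set_integrable lborel {x..y} f"
    by (rule borel_integrable_atLeastAtMost'[OF cont])
  have "(\<integral>\<^sup>+ t\<in>{x..y}. ennreal (f t) \<partial>lborel) = (\<integral>\<^sup>+ t. ennreal (indicator {x..y} t *\<^sub>R f t) \<partial>lborel)"
    by (intro nn_integral_cong) (auto simp: indicator_def)
  also have "\<dots> = ennreal (LINT t:{x..y}|lborel. f t)"
    unfolding set_lebesgue_integral_def
    by (rule nn_integral_eq_integral) (use int nonneg in \<open>auto simp: set_integrable_def indicator_def\<close>)
  also have "(LINT t:{x..y}|lborel. f t) = integral {x..y} f"
    by (rule set_borel_integral_eq_integral[OF int])
  finally show ?thesis .
qed

lemma monomial_has_derivative:
  fixes v :: "real \<Rightarrow> real ^ 'n"
  assumes "\<And>k. ((\<lambda>x. v x $ k) has_real_derivative v' k) (at y within S)"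
  shows "((\<lambda>x. monomial i (v x)) has_real_derivative
    (\<Sum>k\<in>UNIV. real (i $ k) * (monomial (i - axis k 1) (v y) * v' k))) (at y within S)"
proof -
  have "((\<lambda>x. v x $ k ^ (i $ k)) has_real_derivative real (i $ k) * (v y $ k) ^ (i $ k - 1) * v' k) (at y within S)" for k
    using assms[of k] by (auto intro!: derivative_eq_intros)
  then have "((\<lambda>x. \<Prod>k\<in>UNIV. v x $ k ^ (i $ k)) has_real_derivative
    (\<Sum>k\<in>UNIV. real (i $ k) * (v y $ k) ^ (i $ k - 1) * v' k * (\<Prod>l\<in>UNIV - {k}. v y $ l ^ (i $ l)))) (at y within S)"
    unfolding has_field_derivative_def
    by (intro has_derivative_eq_rhs[OF has_derivative_prod]) (auto simp: fun_eq_iff sum_distrib_right sum_distrib_left mult_ac)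
  moreover have "real (i $ k) * (v y $ k) ^ (i $ k - 1) * v' k * (\<Prod>l\<in>UNIV - {k}. v y $ l ^ (i $ l)) =
      real (i $ k) * (monomial (i - axis k 1) (v y) * v' k)" for k
  proof -
    have "monomial (i - axis k 1) (v y) = (v y $ k) ^ (i $ k - 1) * (\<Prod>l\<in>UNIV - {k}. v y $ l ^ ((i - axis k 1) $ l))"
      unfolding monomial_def by (subst prod.remove[of _ k]) (auto simp: axis_def)
    also have "(\<Prod>l\<in>UNIV - {k}. v y $ l ^ ((i - axis k 1) $ l)) = (\<Prod>l\<in>UNIV - {k}. v y $ l ^ (i $ l))"
      by (rule prod.cong) (auto simp: axis_def)
    finally show ?thesis
      by simp
  qed
  ultimately show ?thesis
    unfolding monomial_def[of i, abs_def] by (simp only:)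
qed

text \<open>The barrier argument requires finite sublevel sets; those of
  \<open>1 - monomial i (u y)\<close> lie in such boxes.\<close>

lemma finite_bounded_vectors: "finite {i :: nat ^ 'n. \<forall>k. i $ k < N}"
proof -
  have "finite (UNIV \<rightarrow>\<^sub>E {..<N} :: ('n \<Rightarrow> nat) set)"
    by (intro finite_PiE) auto
  then have "finite (vec_lambda ` (UNIV \<rightarrow>\<^sub>E {..<N} :: ('n \<Rightarrow> nat) set))"
    by (rule finite_imageI)
  moreover have "{i :: nat ^ 'n. \<forall>k. i $ k < N} \<subseteq> vec_lambda ` (UNIV \<rightarrow>\<^sub>E {..<N})"
  proof
    fix i :: "nat ^ 'n" assume "i \<in> {i. \<forall>k. i $ k < N}"
    then have "vec_nth i \<in> UNIV \<rightarrow>\<^sub>E {..<N}"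
      by auto
    then show "i \<in> vec_lambda ` (UNIV \<rightarrow>\<^sub>E {..<N})"
      by (metis image_eqI vec_nth_inverse)
  qed
  ultimately show ?thesis
    by (rule finite_subset[rotated])
qed

context tbi_curve
begin

abbreviation "A y \<equiv> gen_fun a (u y)"

definition immigration_exponent :: "real \<Rightarrow> real" where
  "immigration_exponent y = integral {0..y} (\<lambda>x. - A x / B k1 x)"

abbreviation "L \<equiv> immigration_exponent"

definition defect_integral :: "real \<Rightarrow> nat ^ 'n \<Rightarrow> ennreal" where
  "defect_integral z i = (\<integral>\<^sup>+ y\<in>{0..z}. ennreal ((1 - monomial i (u y)) * (exp (- L y) / B k1 y)) \<partial>lborel)"

lemma A_nonpos: "y \<in> {0..1} \<Longrightarrow> A y \<le> 0"
  by (rule gen_fun_a_nonpos[OF u_cube])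

lemma A_cont: "continuous_on {0..1} A"
  by (rule gen_fun_u_cont[OF a_coeff])

lemma A_1: "A 1 = 0"
  by (simp add: u_1 gen_fun_1[OF a_coeff])

lemma f_bounds: "y \<in> {0..1} \<Longrightarrow> 0 \<le> monomial i (u y)" "y \<in> {0..1} \<Longrightarrow> monomial i (u y) \<le> 1"
  using monomial_nonneg[OF u_cube] monomial_le_1[OF u_cube] by blast+

lemma f_cont: "continuous_on {0..1} (\<lambda>y. monomial i (u y))"
  by (intro continuous_intros u_cont)

lemma f_mono: "0 \<le> x \<Longrightarrow> x \<le> y \<Longrightarrow> y \<le> 1 \<Longrightarrow> monomial i (u x) \<le> monomial i (u y)"
  by (intro monomial_mono u_cube u_mono) auto

lemma ratio_cont: "z < 1 \<Longrightarrow> continuous_on {0..z} (\<lambda>x. - A x / B k1 x)"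
  using B_k1_pos by (intro continuous_intros continuous_on_subset[OF A_cont] continuous_on_subset[OF B_cont])
    (auto simp: less_le)

lemma ratio_nonneg: "0 \<le> x \<Longrightarrow> x < 1 \<Longrightarrow> 0 \<le> - A x / B k1 x"
  using B_k1_pos[of x] A_nonpos[of x] by (intro divide_nonneg_pos) auto

lemma L_deriv:
  assumes "z < 1" "y \<in> {0..z}"
  shows "(L has_real_derivative - A y / B k1 y) (at y within {0..z})"
  unfolding immigration_exponent_def[abs_def]
  by (rule integral_has_real_derivative[OF ratio_cont]) (use assms in auto)

lemma L_cont: "z < 1 \<Longrightarrow> continuous_on {0..z} L"
  by (rule DERIV_continuous_on[OF L_deriv])

lemma L_eq: "y < 1 \<Longrightarrow> (LINT x:{0..y}|lborel. A x / B k1 x) = - L y"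
proof -
  assume y: "y < 1"
  have "(LINT x:{0..y}|lborel. - A x / B k1 x) = L y"
    unfolding immigration_exponent_def
    by (intro set_borel_integral_eq_integral borel_integrable_atLeastAtMost' ratio_cont y)
  moreover have "(LINT x:{0..y}|lborel. - A x / B k1 x) = - (LINT x:{0..y}|lborel. A x / B k1 x)"
    by (simp add: set_lebesgue_integral_def)
  ultimately show ?thesis
    by simp
qed

lemma L_ennreal:
  assumes "y < 1"
  shows "(\<integral>\<^sup>+ x\<in>{0..y}. ennreal (- A x / B k1 x) \<partial>lborel) = ennreal (L y)"
  unfolding immigration_exponent_def
  by (rule nn_integral_continuous_Icc) (use assms ratio_cont ratio_nonneg in auto)

lemma L_nonneg: "y < 1 \<Longrightarrow> 0 \<le> L y"
  unfolding immigration_exponent_def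
  by (rule integral_nonneg) (use ratio_cont ratio_nonneg in \<open>auto intro!: integrable_continuous_interval\<close>)

lemma L_mono:
  assumes "0 \<le> x" "x \<le> y" "y < 1"
  shows "L x \<le> L y"
  unfolding immigration_exponent_def
proof (rule integral_subset_le)
  show "(\<lambda>x. - A x / B k1 x) integrable_on {0..x}" "(\<lambda>x. - A x / B k1 x) integrable_on {0..y}"
    using assms by (intro integrable_continuous_interval ratio_cont; linarith)+
  show "\<forall>t\<in>{0..y}. 0 \<le> - A t / B k1 t"
    using assms by (intro ballI ratio_nonneg) auto
qed (use assms in auto)

lemma weight_cont: "z < 1 \<Longrightarrow> continuous_on {0..z} (\<lambda>y. exp (- L y) / B k1 y)"
  using B_k1_pos by (intro continuous_intros L_cont continuous_on_subset[OF B_cont]) (auto simp: less_le)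

lemma weight_nonneg: "0 \<le> y \<Longrightarrow> y < 1 \<Longrightarrow> 0 \<le> exp (- L y) / B k1 y"
  using B_k1_pos[of y] by simp

text \<open>With the integrating factor \<open>exp (- L)\<close> the first-order linear equation for
  \<open>f\<close> turns branching and immigration together into one exact derivative.\<close>

lemma tbi_operator_deriv:
  assumes "i \<noteq> 0" "z < 1" "y \<in> {0..z}"
  shows "((\<lambda>x. monomial i (u x) * exp (- L x)) has_real_derivative
    tbi_operator a b (u y) i * (exp (- L y) / B k1 y)) (at y within {0..z})"
proof -
  have pos: "0 < B k1 y"
    using assms by (intro B_k1_pos) auto
  have "((\<lambda>x. u x $ k) has_real_derivative B k y / B k1 y) (at y within {0..z})" for k
    by (rule has_field_derivative_subset[OF u_deriv]) (use assms pos in auto)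
  then have "((\<lambda>x. monomial i (u x)) has_real_derivative
      (\<Sum>k\<in>UNIV. real (i $ k) * (monomial (i - axis k 1) (u y) * (B k y / B k1 y)))) (at y within {0..z})"
    by (rule monomial_has_derivative)
  then have "((\<lambda>x. monomial i (u x) * exp (- L x)) has_real_derivative
     (\<Sum>k\<in>UNIV. real (i $ k) * (monomial (i - axis k 1) (u y) * (B k y / B k1 y))) * exp (- L y) +
     monomial i (u y) * (exp (- L y) * - (- A y / B k1 y))) (at y within {0..z})"
    using L_deriv[OF assms(2,3)] by (auto intro!: derivative_eq_intros)
  also have "(\<Sum>k\<in>UNIV. real (i $ k) * (monomial (i - axis k 1) (u y) * (B k y / B k1 y))) * exp (- L y) +
     monomial i (u y) * (exp (- L y) * - (- A y / B k1 y)) = tbi_operator a b (u y) i * (exp (- L y) / B k1 y)"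
    using assms(1) pos by (simp add: tbi_operator_def sum_divide_distrib[symmetric] field_simps)
  finally show ?thesis .
qed

lemma tbi_operator_cont: "continuous_on {0..1} (\<lambda>y. tbi_operator a b (u y) i)"
  unfolding tbi_operator_def
  by (cases "i = 0") (auto intro!: continuous_intros A_cont B_cont u_cont)

text \<open>The branching part is nonnegative on the curve, and immigration contributes
  \<open>A y\<close> times a number in [0, 1]. This is the drift bound for the barrier
  \<open>1 - f\<close>.\<close>

lemma tbi_operator_ge:
  assumes "0 \<le> y" "y < 1"
  shows "A y \<le> tbi_operator a b (u y) i"
proof (cases "i = 0")
  case True
  then show ?thesis
    using A_nonpos[of y] assms by (simp add: tbi_operator_def)
next
  case False
  have "0 \<le> (\<Sum>k\<in>UNIV. real (i $ k) * (monomial (i - axis k 1) (u y) * B k y))"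
    using assms by (intro sum_nonneg mult_nonneg_nonneg f_bounds B_nonneg) auto
  moreover have "A y * 1 \<le> A y * monomial i (u y)"
    using assms by (intro mult_left_mono_neg f_bounds A_nonpos) auto
  ultimately show ?thesis
    using False by (simp add: tbi_operator_def)
qed

lemma jump_op_defect:
  "y \<in> {0..1} \<Longrightarrow> jump_op Q (\<lambda>j. ennreal (1 - monomial j (u y))) i =
    ennreal (- Q i i * (1 - monomial i (u y)) - tbi_operator a b (u y) i)"
  by (rule jump_op_one_minus_monomial[OF u_cube])

text \<open>In \<open>jump_op_defect\<close> a negative value would be clipped by
  \<open>ennreal\<close>, so the sign is needed for the reals. The quantity is the off-diagonal sum
  of the nonnegative \<open>Q i j * (1 - monomial j (u y))\<close>.\<close>

lemma defect_rate_nonneg: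
  assumes "y \<in> {0..1}"
  shows "0 \<le> - Q i i * (1 - monomial i (u y)) - tbi_operator a b (u y) i"
proof -
  have 1: "((\<lambda>j. Q i j * monomial j 1 - Q i j * monomial j (u y)) has_sum
      (tbi_operator a b 1 i - tbi_operator a b (u y) i)) UNIV"
    by (intro has_sum_diff_real Q_monomial_has_sum u_cube assms) (simp add: mem_cbox_01)
  have 2: "((\<lambda>j. Q i j * monomial j 1 - Q i j * monomial j (u y)) has_sum
      (Q i i * (1 - monomial i (u y)))) {i}"
    using has_sum_finite[of "{i}" "\<lambda>j. Q i j * monomial j 1 - Q i j * monomial j (u y)"]
    by (simp add: algebra_simps)
  have 3: "0 \<le> Q i j * monomial j 1 - Q i j * monomial j (u y)" if "j \<in> UNIV - {i}" for j
    using that Q_offdiag_nonneg[of j i] f_bounds(2)[OF assms, of j] by (simp add: mult_left_le)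
  have "Q i i * (1 - monomial i (u y)) \<le> tbi_operator a b 1 i - tbi_operator a b (u y) i"
    by (rule has_sum_mono2[OF 2 1]) (use 3 in auto)
  then show ?thesis
    by simp
qed

lemma defect_integral_eq:
  assumes "0 \<le> z" "z < 1"
  shows "defect_integral z i = ennreal (integral {0..z} (\<lambda>y. (1 - monomial i (u y)) * (exp (- L y) / B k1 y)))"
  unfolding defect_integral_def
proof (rule nn_integral_continuous_Icc)
  show "continuous_on {0..z} (\<lambda>y. (1 - monomial i (u y)) * (exp (- L y) / B k1 y))"
    using assms by (intro continuous_on_mult continuous_on_diff continuous_on_const weight_cont
        continuous_on_subset[OF f_cont]) auto
  show "0 \<le> (1 - monomial i (u t)) * (exp (- L t) / B k1 t)" if "t \<in> {0..z}" for t
    using that assms f_bounds[of t i] weight_nonneg[of t] by (intro mult_nonneg_nonneg) auto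
qed

text \<open>After exchanging the jump operator with the integral over \<open>y\<close>, the
  generator term is an exact derivative. Its boundary value at \<open>z\<close> is the source; the
  one at 0 vanishes because \<open>u 0 = 0\<close> and \<open>i \<noteq> 0\<close>.\<close>

lemma jump_op_defect_integral:
  assumes i: "i \<noteq> 0" and z: "0 \<le> z" "z < 1"
  shows "jump_op Q (defect_integral z) i + ennreal (exp (- L z) * monomial i (u z)) =
    ennreal (- Q i i) * defect_integral z i"
proof -
  let ?w = "\<lambda>y. exp (- L y) / B k1 y" and ?f = "\<lambda>k y. monomial k (u y)"
    and ?q = "- Q i i" and ?S = "\<lambda>y. tbi_operator a b (u y) i"
  have sub: "y \<in> {0..1}" "y < 1" "0 \<le> y" if "y \<in> {0..z}" for y
    using that z by auto
  have cont1: "continuous_on {0..z} (\<lambda>y. (1 - ?f k y) * ?w y)" for k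
    using z by (intro continuous_on_mult continuous_on_diff continuous_on_const weight_cont
        continuous_on_subset[OF f_cont]) auto
  have cont2: "continuous_on {0..z} (\<lambda>y. ?S y * ?w y)"
    using z by (intro continuous_on_mult weight_cont continuous_on_subset[OF tbi_operator_cont]) auto
  have cont3: "continuous_on {0..z} (\<lambda>y. (?q * (1 - ?f i y) - ?S y) * ?w y)"
    using z by (intro continuous_on_mult continuous_on_diff continuous_on_const weight_cont
        continuous_on_subset[OF f_cont] continuous_on_subset[OF tbi_operator_cont]) auto
  have "jump_op Q (defect_integral z) i =
      jump_op Q (\<lambda>k. \<integral>\<^sup>+ y. ennreal ((1 - ?f k y) * ?w y) * indicator {0..z} y \<partial>lborel) i"
    by (simp add: defect_integral_def[abs_def])
  also have "\<dots> = (\<integral>\<^sup>+ y. jump_op Q (\<lambda>k. ennreal ((1 - ?f k y) * ?w y) * indicator {0..z} y) i \<partial>lborel)"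
    by (rule jump_op_nn_integral) (use continuous_on_indicator_measurable[OF cont1] in auto)
  also have "\<dots> = (\<integral>\<^sup>+ y\<in>{0..z}. ennreal ((?q * (1 - ?f i y) - ?S y) * ?w y) \<partial>lborel)"
  proof (rule nn_integral_cong)
    fix y
    show "jump_op Q (\<lambda>k. ennreal ((1 - ?f k y) * ?w y) * indicator {0..z} y) i =
        ennreal ((?q * (1 - ?f i y) - ?S y) * ?w y) * indicator {0..z} y"
    proof (cases "y \<in> {0..z}")
      case True
      have "jump_op Q (\<lambda>k. ennreal ((1 - ?f k y) * ?w y)) i = jump_op Q (\<lambda>k. ennreal (1 - ?f k y) * ennreal (?w y)) i"
        using weight_nonneg[OF sub(3,2)[OF True]] by (simp only: ennreal_mult'')
      also have "\<dots> = ennreal (?q * (1 - ?f i y) - ?S y) * ennreal (?w y)"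
        by (simp only: jump_op_multc jump_op_defect[OF sub(1)[OF True]])
      also have "\<dots> = ennreal ((?q * (1 - ?f i y) - ?S y) * ?w y)"
        using weight_nonneg[OF sub(3,2)[OF True]] by (simp only: ennreal_mult'')
      finally show ?thesis
        by (simp add: jump_op_multc)
    qed (simp add: jump_op_def)
  qed
  also have "\<dots> = ennreal (integral {0..z} (\<lambda>y. (?q * (1 - ?f i y) - ?S y) * ?w y))"
  proof (rule nn_integral_continuous_Icc[OF cont3])
    show "0 \<le> (?q * (1 - ?f i t) - ?S t) * ?w t" if "t \<in> {0..z}" for t
      by (intro mult_nonneg_nonneg defect_rate_nonneg weight_nonneg sub[OF that])
  qed
  finally have J: "jump_op Q (defect_integral z) i =
      ennreal (integral {0..z} (\<lambda>y. (?q * (1 - ?f i y) - ?S y) * ?w y))" .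
  have eq: "integral {0..z} (\<lambda>y. (?q * (1 - ?f i y) - ?S y) * ?w y) =
      ?q * integral {0..z} (\<lambda>y. (1 - ?f i y) * ?w y) - exp (- L z) * ?f i z"
  proof -
    have "((\<lambda>y. ?S y * ?w y) has_integral ?f i z * exp (- L z) - ?f i 0 * exp (- L 0)) {0..z}"
      by (rule fundamental_theorem_of_calculus[OF z(1)])
         (use tbi_operator_deriv[OF i z(2)] in \<open>simp add: has_real_derivative_iff_has_vector_derivative\<close>)
    moreover have "?f i 0 = 0"
      using i by (simp add: u_0 monomial_zero)
    ultimately have S: "integral {0..z} (\<lambda>y. ?S y * ?w y) = exp (- L z) * ?f i z"
      by (simp add: integral_unique mult.commute)
    have "integral {0..z} (\<lambda>y. (?q * (1 - ?f i y) - ?S y) * ?w y) =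
        integral {0..z} (\<lambda>y. ?q * ((1 - ?f i y) * ?w y) - ?S y * ?w y)"
      by (intro integral_cong) (simp only: left_diff_distrib mult.assoc)
    also have "\<dots> = integral {0..z} (\<lambda>y. ?q * ((1 - ?f i y) * ?w y)) - integral {0..z} (\<lambda>y. ?S y * ?w y)"
      by (intro integral_diff integrable_continuous_interval continuous_on_mult continuous_on_const cont1 cont2)
    finally show ?thesis
      by (simp only: S integral_mult_right)
  qed
  have nonneg: "0 \<le> integral {0..z} (\<lambda>y. (?q * (1 - ?f i y) - ?S y) * ?w y)"
    by (intro integral_nonneg integrable_continuous_interval cont3 mult_nonneg_nonneg defect_rate_nonneg weight_nonneg sub)
  have I: "0 \<le> integral {0..z} (\<lambda>y. (1 - ?f i y) * ?w y)"
  proof (intro integral_nonneg integrable_continuous_interval cont1 mult_nonneg_nonneg)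
    fix y assume "y \<in> {0..z}"
    from sub[OF this] show "0 \<le> 1 - ?f i y" "0 \<le> ?w y"
      using f_bounds[of y i] weight_nonneg[of y] by auto
  qed
  have "jump_op Q (defect_integral z) i + ennreal (exp (- L z) * ?f i z) =
      ennreal (integral {0..z} (\<lambda>y. (?q * (1 - ?f i y) - ?S y) * ?w y) + exp (- L z) * ?f i z)"
    unfolding J using z f_bounds(1)[of z i] nonneg by (intro ennreal_plus[symmetric]) auto
  also have "\<dots> = ennreal (?q * integral {0..z} (\<lambda>y. (1 - ?f i y) * ?w y))"
    by (simp only: eq diff_add_cancel)
  also have "\<dots> = ennreal ?q * defect_integral z i"
    unfolding defect_integral_eq[OF z] using Q_diag_nonpos[of i] I by (intro ennreal_mult) auto
  finally show ?thesis .
qed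

end

section \<open>Extinction and the mean extinction time\<close>

text \<open>An increasing sequence with limit 1 along which monotone convergence is applied. The
  offset 2 starts it at 1/2, so that even its first term lies strictly inside the interval.\<close>

definition approx_one :: "nat \<Rightarrow> real" where
  "approx_one n = 1 - 1 / (real n + 2)"

lemma approx_one_bounds: "0 < approx_one n" "0 \<le> approx_one n" "approx_one n < 1"
  by (auto simp: approx_one_def)

lemma approx_one_mono: "m \<le> n \<Longrightarrow> approx_one m \<le> approx_one n"
  by (simp add: approx_one_def frac_le)

lemma approx_one_exceeds:
  assumes "y < 1"
  obtains N where "\<And>n. n \<ge> N \<Longrightarrow> y < approx_one n"
proof -
  obtain N where N: "1 / real (Suc N) < 1 - y"
    using assms reals_Archimedean[of "1 - y"] by (auto simp: inverse_eq_divide)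
  show ?thesis
  proof (rule that[of N])
    fix n assume "n \<ge> N"
    then have "1 / (real n + 2) \<le> 1 / real (Suc N)"
      by (intro divide_left_mono) auto
    then show "y < approx_one n"
      using N by (simp add: approx_one_def)
  qed
qed

lemma approx_one_at_left: "filterlim approx_one (at_left 1) sequentially"
  unfolding filterlim_at
proof (intro conjI always_eventually allI)
  show "approx_one \<longlonglongrightarrow> 1"
  proof (rule order_tendstoI)
    fix y :: real assume "y < 1"
    then obtain N where "\<And>n. n \<ge> N \<Longrightarrow> y < approx_one n"
      using approx_one_exceeds by blast
    then show "\<forall>\<^sub>F n in sequentially. y < approx_one n"
      by (auto simp: eventually_sequentially)
  next
    fix y :: real assume "1 < y"
    then show "\<forall>\<^sub>F n in sequentially. approx_one n < y"
      using approx_one_bounds(3) by (intro always_eventually allI) (rule less_trans)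
  qed
qed (use approx_one_bounds(3) in \<open>auto simp: less_imp_neq\<close>)

lemma continuous_on_half_open:
  fixes g :: "real \<Rightarrow> real"
  assumes "\<And>z. z < 1 \<Longrightarrow> continuous_on {0..z} g"
  shows "continuous_on {0..<1} g"
  unfolding continuous_on_eq_continuous_within
proof
  fix y :: real assume y: "y \<in> {0..<1}"
  define z where "z = (y + 1) / 2"
  have z: "y < z" "z < 1"
    using y by (auto simp: z_def)
  have "at y within {0..z} = at y within {0..<1}"
    by (rule at_within_nhd[of _ "{..<z}"]) (use y z in auto)
  moreover have "continuous (at y within {0..z}) g"
    using assms[OF z(2)] y z by (auto simp: continuous_on_eq_continuous_within)
  ultimately show "continuous (at y within {0..<1}) g"
    by simp
qed

lemma nn_integral_approx_one:
  fixes \<phi> :: "real \<Rightarrow> ennreal"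
  assumes [measurable]: "(\<lambda>y. \<phi> y * indicator {0..<1} y) \<in> borel_measurable borel"
  shows "(\<integral>\<^sup>+ y\<in>{0..<1}. \<phi> y \<partial>lborel) = (SUP n. \<integral>\<^sup>+ y\<in>{0..approx_one n}. \<phi> y \<partial>lborel)"
proof -
  have "(SUP n. \<phi> y * indicator {0..approx_one n} y) = \<phi> y * indicator {0..<1} y" for y
  proof (cases "y \<in> {0..<1}")
    case True
    then obtain N where N: "\<And>n. n \<ge> N \<Longrightarrow> y < approx_one n"
      using approx_one_exceeds[of y] by auto
    show ?thesis
    proof (rule antisym)
      show "(SUP n. \<phi> y * indicator {0..approx_one n} y) \<le> \<phi> y * indicator {0..<1} y"
        using True by (intro SUP_least mult_left_mono) (auto simp: indicator_def)
      show "\<phi> y * indicator {0..<1} y \<le> (SUP n. \<phi> y * indicator {0..approx_one n} y)"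
        using True N[of N] by (intro SUP_upper2[of N]) auto
    qed
  next
    case False
    then have "y \<notin> {0..approx_one n}" for n
      using approx_one_bounds(3)[of n] by auto
    then show ?thesis
      using False by simp
  qed
  then have "(\<integral>\<^sup>+ y\<in>{0..<1}. \<phi> y \<partial>lborel) = (\<integral>\<^sup>+ y. (SUP n. \<phi> y * indicator {0..approx_one n} y) \<partial>lborel)"
    by simp
  also have "\<dots> = (SUP n. \<integral>\<^sup>+ y\<in>{0..approx_one n}. \<phi> y \<partial>lborel)"
  proof (rule nn_integral_monotone_convergence_SUP)
    show "incseq (\<lambda>n y. \<phi> y * indicator {0..approx_one n} y)"
      by (intro incseq_SucI le_funI mult_left_mono)
        (auto simp: indicator_def intro: order_trans[OF _ approx_one_mono])
    fix n
    have "(\<lambda>y. \<phi> y * indicator {0..approx_one n} y) = (\<lambda>y. \<phi> y * indicator {0..<1} y * indicator {0..approx_one n} y)"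
      using approx_one_bounds(3)[of n] by (auto simp: indicator_def)
    also have "\<dots> \<in> borel_measurable borel"
      by measurable
    finally show "(\<lambda>y. \<phi> y * indicator {0..approx_one n} y) \<in> borel_measurable lborel"
      by simp
  qed
  finally show ?thesis .
qed

text \<open>The integrands of interest divide by \<open>B k1\<close>, which is 0 at the end point;
  their default value there sits on a null set.\<close>

lemma nn_integral_Icc_01:
  fixes \<phi> :: "real \<Rightarrow> ennreal"
  shows "(\<integral>\<^sup>+ y\<in>{0..1}. \<phi> y \<partial>lborel) = (\<integral>\<^sup>+ y\<in>{0..<1}. \<phi> y \<partial>lborel)"
proof (rule nn_integral_cong_AE)
  have "AE y in lborel. y \<noteq> (1 :: real)"
    by (rule AE_lborel_singleton)
  then show "AE y in lborel. \<phi> y * indicator {0..1} y = \<phi> y * indicator {0..<1} y"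
    by eventually_elim (auto simp: indicator_def)
qed

section \<open>Honesty, extinction and the limit of the occupation integrals\<close>

context tbi_curve
begin

lemma curve_limit:
  assumes "continuous_on {0..1} g"
  shows "(g \<longlongrightarrow> g 1) (at_left (1::real))"
proof -
  have "(g \<longlongrightarrow> g 1) (at 1 within {0..1})"
    using assms by (auto simp: continuous_on_def)
  then show ?thesis
    by (simp add: at_within_Icc_at_left)
qed

lemma defect_density_cont:
  assumes "0 \<le> z" "z < 1"
  shows "continuous_on {0..z} (\<lambda>y. (1 - monomial k (u y)) * (exp (- L y) / B k1 y))"
  using assms by (intro continuous_on_mult continuous_on_diff continuous_on_const weight_cont
      continuous_on_subset[OF f_cont]) auto

text \<open>For fixed \<open>t\<close> and every \<open>y < 1\<close> the barrier bounds the lost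
  mass by \<open>- A y * t + (1 - monomial i (u y))\<close>. Both terms tend to 0 as
  \<open>y\<close> tends to 1.\<close>

lemma honest:
  assumes t: "t \<ge> 0"
  shows "feller_semigroup Q t (\<lambda>_. 1) i = 1"
proof -
  have le1: "feller_semigroup Q t (\<lambda>_. 1) i \<le> 1"
    by (rule feller_semigroup_const_le[OF t])
  then obtain r where r: "feller_semigroup Q t (\<lambda>_. 1) i = ennreal r" "0 \<le> r"
    by (cases "feller_semigroup Q t (\<lambda>_. 1) i") (auto simp: top_unique)
  have bound: "1 \<le> r + (- A y * t + (1 - monomial i (u y)))" if y: "y \<in> {0..<1}" for y
  proof -
    have y': "y \<in> {0..1}"
      using y by auto
    have "1 \<le> feller_semigroup Q t (\<lambda>_. 1) i + ennreal (- A y) * ennreal t + ennreal (1 - monomial i (u y))"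
    proof (rule feller_semigroup_barrier[OF _ _ t])
      fix i
      have "- Q i i * (1 - monomial i (u y)) - tbi_operator a b (u y) i \<le>
          - Q i i * (1 - monomial i (u y)) + - A y"
        using tbi_operator_ge[of y i] y by simp
      then show "jump_op Q (\<lambda>j. ennreal (1 - monomial j (u y))) i \<le>
          ennreal (- Q i i) * ennreal (1 - monomial i (u y)) + ennreal (- A y)"
        using Q_diag_nonpos[of i] f_bounds[OF y', of i] A_nonpos[OF y']
        by (simp add: jump_op_defect[OF y'] ennreal_mult[symmetric] ennreal_plus[symmetric] ennreal_leI
            mult_nonpos_nonneg del: ennreal_plus)
    next
      fix \<epsilon> :: real assume \<epsilon>: "0 < \<epsilon>"
      \<comment> \<open>All coordinates of \<open>u y\<close> are at most \<open>r < 1\<close>, so a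
        single entry of \<open>i\<close> of size \<open>N\<close> already makes the monomial smaller
        than \<open>\<epsilon>\<close>.\<close>
      define r where "r = Max (range (\<lambda>k. u y $ k))"
      have r_ge: "u y $ k \<le> r" for k
        unfolding r_def by (rule Max_ge) auto
      have "r < 1"
        unfolding r_def using u_less_1[OF y] by (subst Max_less_iff) auto
      then obtain N where N: "r ^ N < \<epsilon>"
        using real_arch_pow_inv[OF \<epsilon>] by blast
      have r0: "0 \<le> r"
        using r_ge[of k1] u_bounds(1)[OF y', of k1] by linarith
      have "i $ k < N" if i: "ennreal (1 - monomial i (u y)) + ennreal \<epsilon> < 1" for i :: "nat ^ 'n" and k
      proof (rule ccontr)
        assume "\<not> i $ k < N"
        have "monomial i (u y) \<le> (u y $ k) ^ (i $ k)"
          by (rule monomial_le_power[OF u_cube[OF y']])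
        also have "\<dots> \<le> r ^ (i $ k)"
          using u_bounds(1)[OF y'] by (intro power_mono r_ge)
        also have "\<dots> \<le> r ^ N"
          using r0 \<open>r < 1\<close> \<open>\<not> i $ k < N\<close> by (intro power_decreasing) auto
        finally have "1 \<le> (1 - monomial i (u y)) + \<epsilon>"
          using N by simp
        then have "ennreal 1 \<le> ennreal ((1 - monomial i (u y)) + \<epsilon>)"
          by (rule ennreal_leI)
        also have "\<dots> = ennreal (1 - monomial i (u y)) + ennreal \<epsilon>"
          using f_bounds[OF y', of i] \<epsilon> by (intro ennreal_plus) auto
        finally show False
          using i by simp
      qed
      then show "finite {i. ennreal (1 - monomial i (u y)) + ennreal \<epsilon> < 1}"
        by (intro finite_subset[OF _ finite_bounded_vectors[of N]]) auto
    qed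
    also have "\<dots> = ennreal (r + (- A y * t + (1 - monomial i (u y))))"
    proof -
      have "ennreal (r + (c * t + d)) = ennreal r + ennreal c * ennreal t + ennreal d" if "0 \<le> c" "0 \<le> d" for c d
        using that r t by (simp add: ennreal_mult add.assoc)
      from this[of "- A y" "1 - monomial i (u y)"] show ?thesis
        using r A_nonpos[OF y'] f_bounds[OF y', of i] by simp
    qed
    finally show ?thesis
      by (simp add: ennreal_1[symmetric] ennreal_le_iff2 del: ennreal_1)
  qed
  have "((\<lambda>y. r + (- A y * t + (1 - monomial i (u y)))) \<longlongrightarrow>
      r + (- A 1 * t + (1 - monomial i (u 1)))) (at_left 1)"
    by (intro curve_limit continuous_intros A_cont u_cont)
  then have "1 \<le> r + (- A 1 * t + (1 - monomial i (u 1)))"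
  proof (rule tendsto_lowerbound)
    show "\<forall>\<^sub>F y in at_left 1. 1 \<le> r + (- A y * t + (1 - monomial i (u y)))"
      by (rule eventually_at_leftI[of 0]) (use bound in auto)
  qed simp
  then have "1 \<le> r"
    by (simp add: u_1 gen_fun_1[OF a_coeff])
  then show ?thesis
    using le1 r by (intro antisym) auto
qed

definition alive :: "nat ^ 'n \<Rightarrow> ennreal" where
  "alive k = (if k = 0 then 0 else 1)"

definition survival :: "real \<Rightarrow> nat ^ 'n \<Rightarrow> ennreal" where
  "survival t i = feller_semigroup Q t alive i"

text \<open>The source in the equation for \<open>defect_integral z\<close>. It is cut off at the
  absorbing state because the row of the q-matrix is zero there while the monomial is 1.\<close>

definition alive_monomial :: "real \<Rightarrow> nat ^ 'n \<Rightarrow> ennreal" where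
  "alive_monomial z k = (if k = 0 then 0 else ennreal (exp (- L z) * monomial k (u z)))"

text \<open>The integral \<open>J\<close> truncated at \<open>z\<close>.\<close>

definition weight_integral :: "real \<Rightarrow> real" where
  "weight_integral z = integral {0..z} (\<lambda>y. exp (- L y) / B k1 y)"

lemma survival_eq:
  assumes "t \<ge> 0"
  shows "feller_minimal Q t i 0 + survival t i = 1"
proof -
  have "feller_semigroup Q t (\<lambda>k. indicator {0} k + alive k) i =
      feller_semigroup Q t (indicator {0}) i + survival t i"
    by (simp add: survival_def feller_semigroup_add)
  moreover have "(\<lambda>k. indicator {0} k + alive k) = (\<lambda>_. 1)"
    by (auto simp: alive_def indicator_def)
  moreover have "feller_semigroup Q t (indicator {0}) i = feller_minimal Q t i 0"
    by (simp add: feller_semigroup_def)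
  ultimately show ?thesis
    using honest[OF assms, of i] by simp
qed

lemma weight_ennreal:
  assumes "z < 1"
  shows "(\<integral>\<^sup>+ y\<in>{0..z}. ennreal (exp (- L y) / B k1 y) \<partial>lborel) = ennreal (weight_integral z)"
  unfolding weight_integral_def
  by (rule nn_integral_continuous_Icc[OF weight_cont[OF assms]]) (use assms weight_nonneg in auto)

lemma weight_integral_nonneg: "z < 1 \<Longrightarrow> 0 \<le> weight_integral z"
  unfolding weight_integral_def
  by (rule integral_nonneg[OF integrable_continuous_interval[OF weight_cont]]) (use weight_nonneg in auto)

lemma defect_integral_le_weight:
  assumes "z < 1"
  shows "defect_integral z k \<le> ennreal (weight_integral z)"
  unfolding weight_ennreal[OF assms, symmetric] defect_integral_def
proof (rule nn_integral_mono)
  fix y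
  show "ennreal ((1 - monomial k (u y)) * (exp (- L y) / B k1 y)) * indicator {0..z} y \<le>
      ennreal (exp (- L y) / B k1 y) * indicator {0..z} y"
  proof (cases "y \<in> {0..z}")
    case True
    then have "(1 - monomial k (u y)) * (exp (- L y) / B k1 y) \<le> 1 * (exp (- L y) / B k1 y)"
      using assms f_bounds(1)[of y k] weight_nonneg[of y] by (intro mult_right_mono) auto
    then show ?thesis
      using True by (simp add: ennreal_leI)
  qed simp
qed

lemma dynkin_curve:
  assumes z: "0 \<le> z" "z < 1" and t: "t \<ge> 0"
  shows "feller_semigroup Q t (defect_integral z) i +
    (\<integral>\<^sup>+ s\<in>{0..t}. feller_semigroup Q s (alive_monomial z) i \<partial>lborel) = defect_integral z i"
proof (rule dynkin_formula[OF honest[OF t] defect_integral_le_weight[OF z(2)] _ t])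
  fix k
  show "jump_op Q (defect_integral z) k + alive_monomial z k = ennreal (- Q k k) * defect_integral z k"
  proof (cases "k = 0")
    case True
    then show ?thesis
      by (simp add: alive_monomial_def jump_op_def absorptive_tbi_def)
  next
    case False
    then show ?thesis
      using jump_op_defect_integral[OF False z] by (simp add: alive_monomial_def)
  qed
qed

text \<open>Monotonicity of the curve gives \<open>1 \<le> (1 - f y) + f z\<close> for
  \<open>y \<le> z\<close>; integrate this against the weight. The factor \<open>exp (L z)\<close>
  undoes the \<open>exp (- L z)\<close> in \<open>alive_monomial\<close>.\<close>

lemma weight_le_defect:
  assumes z: "0 \<le> z" "z < 1"
  shows "ennreal (weight_integral z) * alive k \<le>
    defect_integral z k + ennreal (weight_integral z) * ennreal (exp (L z)) * alive_monomial z k"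
proof (cases "k = 0")
  case False
  have "ennreal (exp (L z)) * alive_monomial z k = ennreal (monomial k (u z))"
    using False z f_bounds[of z k] by (simp add: alive_monomial_def ennreal_mult'[symmetric] exp_minus)
  moreover have "ennreal (weight_integral z) \<le> defect_integral z k + ennreal (weight_integral z) * ennreal (monomial k (u z))"
  proof -
    have "ennreal (weight_integral z) \<le> (\<integral>\<^sup>+ y. ennreal ((1 - monomial k (u y)) * (exp (- L y) / B k1 y)) * indicator {0..z} y
        + ennreal (exp (- L y) / B k1 y) * indicator {0..z} y * ennreal (monomial k (u z)) \<partial>lborel)"
      unfolding weight_ennreal[OF z(2), symmetric]
    proof (rule nn_integral_mono)
      fix y
      show "ennreal (exp (- L y) / B k1 y) * indicator {0..z} y \<le>
        ennreal ((1 - monomial k (u y)) * (exp (- L y) / B k1 y)) * indicator {0..z} y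
        + ennreal (exp (- L y) / B k1 y) * indicator {0..z} y * ennreal (monomial k (u z))"
      proof (cases "y \<in> {0..z}")
        case True
        then have w: "0 \<le> exp (- L y) / B k1 y" and f: "0 \<le> 1 - monomial k (u y)" "0 \<le> monomial k (u z)"
          using z weight_nonneg[of y] f_bounds[of y k] f_bounds[of z k] by auto
        have distrib: "x \<le> p * x + x * q" if "x * 1 \<le> x * (p + q)" for x p q :: real
          using that by (simp add: algebra_simps)
        have "exp (- L y) / B k1 y * 1 \<le> exp (- L y) / B k1 y * ((1 - monomial k (u y)) + monomial k (u z))"
          using True z w f_mono[of y z k] by (intro mult_left_mono) auto
        then have "ennreal (exp (- L y) / B k1 y) \<le> ennreal ((1 - monomial k (u y)) * (exp (- L y) / B k1 y) +
            exp (- L y) / B k1 y * monomial k (u z))"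
          by (intro ennreal_leI distrib)
        also have "\<dots> = ennreal ((1 - monomial k (u y)) * (exp (- L y) / B k1 y)) +
            ennreal (exp (- L y) / B k1 y) * ennreal (monomial k (u z))"
          using w f by (subst ennreal_plus) (auto simp only: ennreal_mult mult_nonneg_nonneg)
        finally show ?thesis
          using True by simp
      qed simp
    qed
    also have "\<dots> = defect_integral z k + ennreal (weight_integral z) * ennreal (monomial k (u z))"
    proof (subst nn_integral_add)
      show "(\<lambda>y. ennreal ((1 - monomial k (u y)) * (exp (- L y) / B k1 y)) * indicator {0..z} y) \<in> borel_measurable lborel"
        using continuous_on_indicator_measurable[OF defect_density_cont[OF z]] by simp
      have [measurable]: "(\<lambda>y. ennreal (exp (- L y) / B k1 y) * indicator {0..z} y) \<in> borel_measurable borel"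
        using z by (intro continuous_on_indicator_measurable weight_cont) auto
      then show "(\<lambda>y. ennreal (exp (- L y) / B k1 y) * indicator {0..z} y * ennreal (monomial k (u z))) \<in> borel_measurable lborel"
        by measurable
      show "(\<integral>\<^sup>+ y\<in>{0..z}. ennreal ((1 - monomial k (u y)) * (exp (- L y) / B k1 y)) \<partial>lborel) +
        (\<integral>\<^sup>+ y. ennreal (exp (- L y) / B k1 y) * indicator {0..z} y * ennreal (monomial k (u z)) \<partial>lborel) =
        defect_integral z k + ennreal (weight_integral z) * ennreal (monomial k (u z))"
        by (simp add: nn_integral_multc weight_ennreal[OF z(2)] defect_integral_def)
    qed
    finally show ?thesis .
  qed
  ultimately show ?thesis
    using False by (simp add: alive_def mult.assoc)
qed (simp add: alive_def)

text \<open>Take means at time \<open>t\<close> in the previous inequality; by Dynkin's formula the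
  mean of the defect integral does not exceed its initial value.\<close>

lemma survival_bound:
  assumes z: "0 \<le> z" "z < 1" and t: "t \<ge> 0"
  shows "ennreal (weight_integral z) * survival t i \<le> defect_integral z i +
    ennreal (weight_integral z) * ennreal (exp (L z)) * feller_semigroup Q t (alive_monomial z) i"
proof -
  have "ennreal (weight_integral z) * survival t i = feller_semigroup Q t (\<lambda>k. ennreal (weight_integral z) * alive k) i"
    by (simp add: survival_def feller_semigroup_cmult)
  also have "\<dots> \<le> feller_semigroup Q t (\<lambda>k. defect_integral z k +
      ennreal (weight_integral z) * ennreal (exp (L z)) * alive_monomial z k) i"
    by (intro feller_semigroup_mono weight_le_defect z)
  also have "\<dots> = feller_semigroup Q t (defect_integral z) i +
      ennreal (weight_integral z) * ennreal (exp (L z)) * feller_semigroup Q t (alive_monomial z) i"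
    by (simp only: feller_semigroup_add feller_semigroup_cmult)
  also have "feller_semigroup Q t (defect_integral z) i \<le> defect_integral z i"
    unfolding dynkin_curve[OF z t, of i, symmetric] by simp
  finally show ?thesis
    by simp
qed

lemma weight_integral_unbounded:
  assumes J: "(\<integral>\<^sup>+ y\<in>{0..<1}. ennreal (exp (- L y) / B k1 y) \<partial>lborel) = \<infinity>" and z0: "z0 < 1"
  obtains z where "z0 < z" "0 \<le> z" "z < 1" "C < weight_integral z"
proof -
  have "continuous_on {0..<1} (\<lambda>y. exp (- L y) / B k1 y)"
    by (rule continuous_on_half_open[OF weight_cont])
  then have "(\<integral>\<^sup>+ y\<in>{0..<1}. ennreal (exp (- L y) / B k1 y) \<partial>lborel) =
      (SUP n. \<integral>\<^sup>+ y\<in>{0..approx_one n}. ennreal (exp (- L y) / B k1 y) \<partial>lborel)"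
    by (intro nn_integral_approx_one continuous_on_indicator_measurable) auto
  then have "ennreal (max 0 C) < (SUP n. \<integral>\<^sup>+ y\<in>{0..approx_one n}. ennreal (exp (- L y) / B k1 y) \<partial>lborel)"
    using J by simp
  then obtain n where n: "ennreal (max 0 C) < (\<integral>\<^sup>+ y\<in>{0..approx_one n}. ennreal (exp (- L y) / B k1 y) \<partial>lborel)"
    by (auto simp only: less_SUP_iff)
  obtain N where N: "\<And>n. n \<ge> N \<Longrightarrow> z0 < approx_one n"
    using approx_one_exceeds[OF z0] by blast
  have "(\<integral>\<^sup>+ y\<in>{0..approx_one n}. ennreal (exp (- L y) / B k1 y) \<partial>lborel) \<le>
      (\<integral>\<^sup>+ y\<in>{0..approx_one (max n N)}. ennreal (exp (- L y) / B k1 y) \<partial>lborel)"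
    using approx_one_mono[of n "max n N"]
    by (intro nn_integral_mono mult_left_mono) (auto simp: indicator_def)
  then have "ennreal (max 0 C) < ennreal (weight_integral (approx_one (max n N)))"
    using n by (simp add: weight_ennreal approx_one_bounds)
  then have "max 0 C < weight_integral (approx_one (max n N))"
    by (subst (asm) ennreal_less_iff) auto
  then have "C < weight_integral (approx_one (max n N))"
    by simp
  then show thesis
    using N[of "max n N"] by (intro that[of "approx_one (max n N)"]) (auto simp: approx_one_bounds)
qed

text \<open>Up to \<open>z'\<close> the defect is bounded by 1, beyond it by
  \<open>d\<close>.\<close>

lemma defect_integral_split:
  assumes z: "0 \<le> z'" "z' \<le> z" "z < 1" and d: "0 \<le> d" "\<And>y. z' < y \<Longrightarrow> y < 1 \<Longrightarrow> 1 - monomial i (u y) \<le> d"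
  shows "defect_integral z i \<le> ennreal (weight_integral z') + ennreal d * ennreal (weight_integral z)"
proof -
  have [measurable]: "(\<lambda>y. ennreal (exp (- L y) / B k1 y) * indicator {0..x} y) \<in> borel_measurable borel" if "x < 1" for x
    using that by (intro continuous_on_indicator_measurable weight_cont) auto
  have "defect_integral z i \<le> (\<integral>\<^sup>+ y. ennreal (exp (- L y) / B k1 y) * indicator {0..z'} y +
      ennreal d * (ennreal (exp (- L y) / B k1 y) * indicator {0..z} y) \<partial>lborel)"
    unfolding defect_integral_def
  proof (rule nn_integral_mono)
    fix y
    show "ennreal ((1 - monomial i (u y)) * (exp (- L y) / B k1 y)) * indicator {0..z} y \<le>
      ennreal (exp (- L y) / B k1 y) * indicator {0..z'} y +
      ennreal d * (ennreal (exp (- L y) / B k1 y) * indicator {0..z} y)"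
    proof (cases "y \<in> {0..z}")
      case True
      then have w: "0 \<le> exp (- L y) / B k1 y" and f: "0 \<le> monomial i (u y)"
        using z weight_nonneg[of y] f_bounds[of y i] by auto
      show ?thesis
      proof (cases "y \<le> z'")
        case le: True
        have "(1 - monomial i (u y)) * (exp (- L y) / B k1 y) \<le> 1 * (exp (- L y) / B k1 y)"
          using w f by (intro mult_right_mono) auto
        then show ?thesis
          using True le by (simp add: ennreal_leI add_increasing2)
      next
        case False
        have "(1 - monomial i (u y)) * (exp (- L y) / B k1 y) \<le> d * (exp (- L y) / B k1 y)"
          using w False True z by (intro mult_right_mono d) auto
        then show ?thesis
          using True False d(1) w by (simp add: ennreal_leI ennreal_mult[symmetric])
      qed
    qed simp
  qed
  also have "\<dots> = ennreal (weight_integral z') + ennreal d * ennreal (weight_integral z)"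
    using z by (subst nn_integral_add) (auto simp: nn_integral_cmult weight_ennreal)
  finally show ?thesis .
qed

text \<open>
  Divergence of \<open>J\<close> concentrates the weight near \<open>1\<close>, where the defect vanishes. On the other hand
  the defect integral is at least the full weight times the survival probability, up to an error
  which is small at suitable times, since it is integrable in time.
\<close>

lemma survival_small:
  assumes J: "(\<integral>\<^sup>+ y\<in>{0..<1}. ennreal (exp (- L y) / B k1 y) \<partial>lborel) = \<infinity>"
    and e: "0 < (e :: real)"
  obtains t where "0 \<le> t" "survival t i \<le> ennreal e"
proof -
  have "((\<lambda>y. 1 - monomial i (u y)) \<longlongrightarrow> 1 - monomial i (u 1)) (at_left 1)"
    by (intro curve_limit continuous_intros u_cont)
  then have "\<forall>\<^sub>F y in at_left 1. 1 - monomial i (u y) < e / 3"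
    by (rule order_tendstoD(2)) (use e in \<open>simp add: u_1\<close>)
  then obtain z'' where z'': "z'' < 1" "\<And>y. z'' < y \<Longrightarrow> y < 1 \<Longrightarrow> 1 - monomial i (u y) < e / 3"
    unfolding eventually_at_left_field by blast
  define z' where "z' = max z'' 0"
  have z': "0 \<le> z'" "z' < 1" "\<And>y. z' < y \<Longrightarrow> y < 1 \<Longrightarrow> 1 - monomial i (u y) \<le> e / 3"
    using z'' by (auto simp: z'_def less_imp_le)
  \<comment> \<open>The mass below \<open>z'\<close>, where the defect is bounded only by 1, becomes
    at most a fraction \<open>e / 3\<close> of the mass \<open>W\<close> up to \<open>z\<close>. The
    defect beyond \<open>z'\<close> uses a second third of \<open>e\<close>, the error term in time
    the last.\<close>
  obtain z where z: "z' < z" "0 \<le> z" "z < 1" "3 / e * weight_integral z' < weight_integral z"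
    using weight_integral_unbounded[OF J z'(2)] by blast
  define W where "W = weight_integral z"
  have "0 \<le> 3 / e * weight_integral z'"
    using e weight_integral_nonneg[OF z'(2)] by simp
  then have "0 < W"
    unfolding W_def using z(4) by (rule le_less_trans)
  moreover have "weight_integral z' \<le> e / 3 * W"
    using z(4) e by (simp add: W_def field_simps)
  ultimately have W: "0 < W" "weight_integral z' \<le> e / 3 * W"
    by simp_all
  have h: "defect_integral z i \<le> ennreal (2 * e / 3 * W)"
  proof -
    have "defect_integral z i \<le> ennreal (weight_integral z') + ennreal (e / 3) * ennreal W"
      unfolding W_def by (rule defect_integral_split) (use z z' e in auto)
    also have "\<dots> = ennreal (weight_integral z' + e / 3 * W)"
      using weight_integral_nonneg[OF z'(2)] e W by (simp add: ennreal_mult[symmetric])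
    also have "\<dots> \<le> ennreal (2 * e / 3 * W)"
      using W(2) by (intro ennreal_leI) (simp add: field_simps)
    finally show ?thesis .
  qed
  \<comment> \<open>Compensates the factor \<open>exp (L z)\<close> in
    \<open>survival_bound\<close>, leaving the error \<open>W * e / 3\<close>.\<close>
  define d where "d = e / 3 * exp (- L z)"
  have d: "0 < d"
    using e by (simp add: d_def)
  have "\<exists>t\<ge>0. feller_semigroup Q t (alive_monomial z) i \<le> ennreal d"
  proof (rule ccontr)
    assume *: "\<not> ?thesis"
    \<comment> \<open>If the mean stayed above \<open>d\<close> up to this time, its time integral
      would reach \<open>W + 1\<close>, whereas Dynkin's formula bounds it by
      \<open>W\<close>.\<close>
    define T where "T = (W + 1) / d"
    have T: "0 \<le> T"
      using W d by (simp add: T_def)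
    have "ennreal (W + 1) = (\<integral>\<^sup>+ s\<in>{0..T}. ennreal d \<partial>lborel)"
      using T d W by (simp add: nn_integral_cmult ennreal_mult[symmetric] T_def)
    also have "\<dots> \<le> (\<integral>\<^sup>+ s\<in>{0..T}. feller_semigroup Q s (alive_monomial z) i \<partial>lborel)"
    proof (rule nn_integral_mono)
      fix s
      show "ennreal d * indicator {0..T} s \<le> feller_semigroup Q s (alive_monomial z) i * indicator {0..T} s"
      proof (cases "s \<in> {0..T}")
        case True
        then have "\<not> feller_semigroup Q s (alive_monomial z) i \<le> ennreal d"
          using * by (metis atLeastAtMost_iff)
        then show ?thesis
          using True by (simp add: not_le less_imp_le)
      qed simp
    qed
    also have "\<dots> \<le> defect_integral z i"
      unfolding dynkin_curve[OF z(2,3) T, of i, symmetric] by simp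
    also have "\<dots> \<le> ennreal W"
      unfolding W_def by (rule defect_integral_le_weight[OF z(3)])
    finally show False
      using W by (simp add: ennreal_le_iff)
  qed
  then obtain t where t: "0 \<le> t" "feller_semigroup Q t (alive_monomial z) i \<le> ennreal d"
    by blast
  have "ennreal W * survival t i \<le> defect_integral z i +
    ennreal W * ennreal (exp (L z)) * feller_semigroup Q t (alive_monomial z) i"
    unfolding W_def by (rule survival_bound[OF z(2,3) t(1)])
  also have "\<dots> \<le> ennreal (2 * e / 3 * W) + ennreal W * ennreal (exp (L z)) * ennreal d"
    by (intro add_mono mult_left_mono h t) auto
  also have "\<dots> = ennreal (2 * e / 3 * W + W * exp (L z) * d)"
    using W e d by (simp add: ennreal_mult[symmetric])
  also have "2 * e / 3 * W + W * exp (L z) * d = W * e"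
    by (simp add: d_def exp_minus field_simps)
  also have "ennreal (W * e) = ennreal W * ennreal e"
    using W e by (simp add: ennreal_mult)
  finally have "survival t i \<le> ennreal e"
    using W by (subst (asm) ennreal_mult_le_mult_iff) auto
  then show thesis
    using t(1) that by blast
qed

lemma defect_integral_0: "defect_integral z 0 = 0"
  by (simp add: defect_integral_def)

text \<open>In Dynkin's formula the remainder at time \<open>t\<close> is at most \<open>W\<close>
  times the survival probability, because the defect integral vanishes at the absorbing state;
  extinction makes it arbitrarily small.\<close>

lemma total_alive_monomial:
  assumes J: "(\<integral>\<^sup>+ y\<in>{0..<1}. ennreal (exp (- L y) / B k1 y) \<partial>lborel) = \<infinity>"
    and z: "0 \<le> z" "z < 1"
  shows "(\<integral>\<^sup>+ s\<in>{0..}. feller_semigroup Q s (alive_monomial z) i \<partial>lborel) = defect_integral z i"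
proof (rule antisym)
  have "(\<integral>\<^sup>+ s\<in>{0..}. feller_semigroup Q s (alive_monomial z) i \<partial>lborel) =
    (\<integral>\<^sup>+ s. (SUP n. feller_semigroup Q s (alive_monomial z) i * indicator {0..real n} s) \<partial>lborel)"
  proof (rule nn_integral_cong)
    fix s :: real
    have "(SUP n. indicator {0..real n} s :: ennreal) = indicator {0..} s"
    proof (cases "0 \<le> s")
      case True
      obtain n where "s \<le> real n"
        using real_arch_simple by blast
      then have "indicator {0..} s \<le> (SUP n. indicator {0..real n} s :: ennreal)"
        using True by (intro SUP_upper2[of n]) auto
      moreover have "(SUP n. indicator {0..real n} s :: ennreal) \<le> indicator {0..} s"
        by (intro SUP_least) (auto simp: indicator_def)
      ultimately show ?thesis
        by (rule antisym[rotated])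
    qed simp
    then show "feller_semigroup Q s (alive_monomial z) i * indicator {0..} s =
        (SUP n. feller_semigroup Q s (alive_monomial z) i * indicator {0..real n} s)"
      by (simp add: SUP_mult_left_ennreal[symmetric])
  qed
  also have "\<dots> = (SUP n. \<integral>\<^sup>+ s\<in>{0..real n}. feller_semigroup Q s (alive_monomial z) i \<partial>lborel)"
  proof (rule nn_integral_monotone_convergence_SUP)
    show "incseq (\<lambda>n s. feller_semigroup Q s (alive_monomial z) i * indicator {0..real n} s)"
      by (intro incseq_SucI le_funI mult_left_mono) (auto simp: indicator_def)
  qed measurable
  also have "\<dots> \<le> defect_integral z i"
  proof (rule SUP_least)
    fix n
    show "(\<integral>\<^sup>+ s\<in>{0..real n}. feller_semigroup Q s (alive_monomial z) i \<partial>lborel) \<le> defect_integral z i"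
      unfolding dynkin_curve[OF z, of "real n" i, simplified, symmetric] by simp
  qed
  finally show "(\<integral>\<^sup>+ s\<in>{0..}. feller_semigroup Q s (alive_monomial z) i \<partial>lborel) \<le> defect_integral z i" .
next
  define W where "W = weight_integral z"
  have W: "0 \<le> W"
    unfolding W_def by (rule weight_integral_nonneg[OF z(2)])
  show "defect_integral z i \<le> (\<integral>\<^sup>+ s\<in>{0..}. feller_semigroup Q s (alive_monomial z) i \<partial>lborel)"
  proof (rule ennreal_le_epsilon)
    fix e :: real assume e: "0 < e"
    \<comment> \<open>Dividing by \<open>W + 1\<close> covers the case \<open>W = 0\<close>, which
      occurs for \<open>z = 0\<close>.\<close>
    obtain t where t: "0 \<le> t" "survival t i \<le> ennreal (e / (W + 1))"
      using survival_small[OF J, of "e / (W + 1)" i] e W by auto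
    have "feller_semigroup Q t (defect_integral z) i \<le> feller_semigroup Q t (\<lambda>k. ennreal W * alive k) i"
      unfolding W_def
      by (intro feller_semigroup_mono) (auto simp: alive_def defect_integral_0 defect_integral_le_weight z)
    also have "\<dots> = ennreal W * survival t i"
      by (simp add: feller_semigroup_cmult survival_def)
    also have "\<dots> \<le> ennreal W * ennreal (e / (W + 1))"
      by (intro mult_left_mono t) auto
    also have "\<dots> = ennreal (W * (e / (W + 1)))"
      using W e by (intro ennreal_mult[symmetric]) auto
    also have "\<dots> \<le> ennreal e"
      using W e by (intro ennreal_leI) (simp add: field_simps)
    finally have 1: "feller_semigroup Q t (defect_integral z) i \<le> ennreal e" .
    have "defect_integral z i = feller_semigroup Q t (defect_integral z) i +
        (\<integral>\<^sup>+ s\<in>{0..t}. feller_semigroup Q s (alive_monomial z) i \<partial>lborel)"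
      by (rule dynkin_curve[OF z t(1), symmetric])
    also have "\<dots> \<le> ennreal e + (\<integral>\<^sup>+ s\<in>{0..}. feller_semigroup Q s (alive_monomial z) i \<partial>lborel)"
      by (intro add_mono 1 nn_integral_mono mult_left_mono) (auto simp: indicator_def)
    finally show "defect_integral z i \<le>
        (\<integral>\<^sup>+ s\<in>{0..}. feller_semigroup Q s (alive_monomial z) i \<partial>lborel) + ennreal e"
      by (simp add: add.commute)
  qed
qed

text \<open>Without the factor \<open>exp (- L z)\<close> the source is the monomial along the
  curve, which increases to 1 at the corner.\<close>

lemma alive_monomial_SUP:
  "(SUP n. ennreal (exp (L (approx_one n))) * alive_monomial (approx_one n) k) = alive k"
  and alive_monomial_incseq: "incseq (\<lambda>n. ennreal (exp (L (approx_one n))) * alive_monomial (approx_one n) k)"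
proof -
  define F where "F n = (if k = 0 then 0 else ennreal (monomial k (u (approx_one n))))" for n
  have F: "ennreal (exp (L (approx_one n))) * alive_monomial (approx_one n) k = F n" for n
    using f_bounds(1)[of "approx_one n" k] approx_one_bounds[of n]
    by (simp add: F_def alive_monomial_def ennreal_mult[symmetric] exp_minus less_imp_le)
  have inc: "incseq F"
    using f_mono[of "approx_one _" "approx_one _" k] approx_one_mono approx_one_bounds
    by (intro monoI) (auto simp: F_def less_imp_le intro!: ennreal_leI)
  have "F \<longlonglongrightarrow> alive k"
  proof (cases "k = 0")
    case False
    have "((\<lambda>y. monomial k (u y)) \<longlongrightarrow> monomial k (u 1)) (at_left 1)"
      by (intro curve_limit f_cont)
    then have "(\<lambda>n. monomial k (u (approx_one n))) \<longlonglongrightarrow> 1"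
      using filterlim_compose[OF _ approx_one_at_left] by (simp add: u_1)
    then have "(\<lambda>n. ennreal (monomial k (u (approx_one n)))) \<longlonglongrightarrow> ennreal 1"
      by (rule tendsto_ennrealI)
    then show ?thesis
      using False by (simp add: F_def[abs_def] alive_def)
  qed (simp add: F_def[abs_def] alive_def)
  then have "(SUP n. F n) = alive k"
    using LIMSEQ_SUP[OF inc] LIMSEQ_unique by blast
  then show "(SUP n. ennreal (exp (L (approx_one n))) * alive_monomial (approx_one n) k) = alive k"
    "incseq (\<lambda>n. ennreal (exp (L (approx_one n))) * alive_monomial (approx_one n) k)"
    using inc by (simp_all add: F)
qed

text \<open>Monotone convergence twice, over the states and over time, reduces the survival integral
  to the occupation integrals for fixed \<open>z\<close>.\<close>

lemma nn_integral_survival: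
  assumes J: "(\<integral>\<^sup>+ y\<in>{0..<1}. ennreal (exp (- L y) / B k1 y) \<partial>lborel) = \<infinity>"
  shows "(\<integral>\<^sup>+ t\<in>{0..}. survival t i \<partial>lborel) =
    (SUP n. ennreal (exp (L (approx_one n))) * defect_integral (approx_one n) i)"
proof -
  let ?F = "\<lambda>n k. ennreal (exp (L (approx_one n))) * alive_monomial (approx_one n) k"
  have inc: "incseq (\<lambda>n. feller_semigroup Q t (?F n) i)" for t
    using alive_monomial_incseq by (intro monoI feller_semigroup_mono) (auto simp: incseq_def)
  have "survival t i = (SUP n. feller_semigroup Q t (?F n) i)" for t
  proof -
    have "survival t i = (\<integral>\<^sup>+ j. (SUP n. feller_minimal Q t i j * ?F n j) \<partial>count_space UNIV)"
      unfolding survival_def feller_semigroup_def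
      by (intro nn_integral_cong) (simp only: alive_monomial_SUP SUP_mult_left_ennreal[symmetric])
    also have "\<dots> = (SUP n. feller_semigroup Q t (?F n) i)"
      unfolding feller_semigroup_def
    proof (rule nn_integral_monotone_convergence_SUP)
      show "incseq (\<lambda>n j. feller_minimal Q t i j * ?F n j)"
        using alive_monomial_incseq by (intro monoI le_funI mult_left_mono) (auto simp: incseq_def)
    qed simp
    finally show ?thesis .
  qed
  then have "(\<integral>\<^sup>+ t\<in>{0..}. survival t i \<partial>lborel) =
      (\<integral>\<^sup>+ t. (SUP n. feller_semigroup Q t (?F n) i * indicator {0..} t) \<partial>lborel)"
    by (simp only: SUP_mult_right_ennreal)
  also have "\<dots> = (SUP n. \<integral>\<^sup>+ t\<in>{0..}. feller_semigroup Q t (?F n) i \<partial>lborel)"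
  proof (rule nn_integral_monotone_convergence_SUP)
    show "incseq (\<lambda>n t. feller_semigroup Q t (?F n) i * indicator {0..} t)"
      using inc by (intro monoI le_funI mult_right_mono) (auto simp: incseq_def)
  qed measurable
  also have "\<dots> = (SUP n. ennreal (exp (L (approx_one n))) * defect_integral (approx_one n) i)"
    by (simp add: feller_semigroup_cmult mult.assoc nn_integral_cmult total_alive_monomial[OF J] approx_one_bounds)
  finally show ?thesis .
qed

text \<open>The limit of \<open>L\<close> at 1, possibly infinite; hence in
  \<open>ennreal\<close>.\<close>

definition total_exponent :: ennreal where
  "total_exponent = (\<integral>\<^sup>+ y\<in>{0..<1}. ennreal (- A y / B k1 y) \<partial>lborel)"

lemma ratio_measurable: "(\<lambda>y. ennreal (- A y / B k1 y) * indicator {0..<1} y) \<in> borel_measurable borel"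
  by (intro continuous_on_indicator_measurable continuous_on_half_open ratio_cont) auto

lemma total_exponent_SUP: "total_exponent = (SUP n. ennreal (L (approx_one n)))"
  unfolding total_exponent_def
  by (subst nn_integral_approx_one[OF ratio_measurable]) (simp only: L_ennreal[OF approx_one_bounds(3)])

text \<open>Combining the factor with the weight produces the exponent \<open>L z - L y\<close>,
  which is increasing in \<open>z\<close>; domain and integrand then grow together.\<close>

lemma exp_L_defect_integral:
  assumes "0 \<le> z" "z < 1"
  shows "ennreal (exp (L z)) * defect_integral z i =
    (\<integral>\<^sup>+ y\<in>{0..z}. ennreal ((1 - monomial i (u y)) / B k1 y * exp (L z - L y)) \<partial>lborel)"
proof -
  have "ennreal (exp (L z)) * defect_integral z i = (\<integral>\<^sup>+ y. ennreal (exp (L z)) *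
      (ennreal ((1 - monomial i (u y)) * (exp (- L y) / B k1 y)) * indicator {0..z} y) \<partial>lborel)"
    unfolding defect_integral_def
    using continuous_on_indicator_measurable[OF defect_density_cont[OF assms]]
    by (intro nn_integral_cmult[symmetric]) simp
  also have "\<dots> = (\<integral>\<^sup>+ y\<in>{0..z}. ennreal ((1 - monomial i (u y)) / B k1 y * exp (L z - L y)) \<partial>lborel)"
  proof (intro nn_integral_cong)
    fix y
    have "exp (L z) * ((1 - monomial i (u y)) * (exp (- L y) / B k1 y)) =
        (1 - monomial i (u y)) / B k1 y * exp (L z - L y)"
      by (simp add: exp_diff exp_minus field_simps)
    then show "ennreal (exp (L z)) * (ennreal ((1 - monomial i (u y)) * (exp (- L y) / B k1 y)) * indicator {0..z} y) =
        ennreal ((1 - monomial i (u y)) / B k1 y * exp (L z - L y)) * indicator {0..z} y"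
      by (simp only: mult.assoc[symmetric] ennreal_mult'[symmetric] exp_ge_zero)
  qed
  finally show ?thesis .
qed

lemma f_less_1:
  assumes "i \<noteq> 0" "y \<in> {0..<1}"
  shows "monomial i (u y) < 1"
proof -
  obtain l where "i $ l \<noteq> 0"
    using assms(1) by (auto simp: vec_eq_iff)
  then have "monomial i (u y) \<le> u y $ l"
    using assms(2) by (intro monomial_le_coord u_cube) auto
  also have "\<dots> < 1"
    by (rule u_less_1[OF assms(2)])
  finally show ?thesis .
qed

lemma defect_integral_pos:
  assumes i: "i \<noteq> 0" and z: "0 < z" "z < 1"
  shows "0 < defect_integral z i"
proof -
  have cont: "continuous_on {0..z} (B k1)"
    by (rule continuous_on_subset[OF B_cont]) (use z in auto)
  obtain x where x: "x \<in> {0..z}" "\<And>y. y \<in> {0..z} \<Longrightarrow> B k1 y \<le> B k1 x"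
    using continuous_attains_sup[OF _ _ cont] z by auto
  have Bx: "0 < B k1 x"
    using x z by (intro B_k1_pos) auto
  define c where "c = (1 - monomial i (u z)) * (exp (- L z) / B k1 x)"
  have c: "0 < c"
    using f_less_1[OF i, of z] z Bx by (simp add: c_def)
  have "0 < ennreal c * ennreal z"
    using c z by (simp add: ennreal_zero_less_mult_iff)
  also have "\<dots> = (\<integral>\<^sup>+ y\<in>{0..z}. ennreal c \<partial>lborel)"
    using z by (simp add: nn_integral_cmult)
  also have "\<dots> \<le> defect_integral z i"
    unfolding defect_integral_def
  proof (rule nn_integral_mono)
    fix y
    show "ennreal c * indicator {0..z} y \<le>
        ennreal ((1 - monomial i (u y)) * (exp (- L y) / B k1 y)) * indicator {0..z} y"
    proof (cases "y \<in> {0..z}")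
      case True
      have "c \<le> (1 - monomial i (u y)) * (exp (- L y) / B k1 y)"
        unfolding c_def
        using True z f_mono[of y z i] f_bounds(2)[of z i] f_bounds(2)[of y i] L_mono[of y z] x(2)[OF True] B_k1_pos[of y]
        by (intro mult_mono frac_le) auto
      then show ?thesis
        using True by (simp add: ennreal_leI)
    qed simp
  qed
  finally show ?thesis .
qed

lemma defect_integral_mono: "x \<le> y \<Longrightarrow> defect_integral x i \<le> defect_integral y i"
  unfolding defect_integral_def by (intro nn_integral_mono mult_left_mono) (auto simp: indicator_def)

text \<open>The defect integral stays above its positive value at the first approximation point,
  while \<open>exp (L z) \<ge> L z\<close> is unbounded.\<close>

lemma mean_infinite:
  assumes "total_exponent = \<infinity>" "i \<noteq> 0"
  shows "(SUP n. ennreal (exp (L (approx_one n))) * defect_integral (approx_one n) i) = \<infinity>"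
proof -
  define D where "D = defect_integral (approx_one 0) i"
  have D: "0 < D"
    unfolding D_def by (rule defect_integral_pos[OF assms(2)]) (auto simp: approx_one_bounds)
  have "\<infinity> = total_exponent * D"
    using D assms(1) by (simp add: ennreal_top_mult)
  also have "\<dots> = (SUP n. ennreal (L (approx_one n)) * D)"
    unfolding total_exponent_SUP by (rule SUP_mult_right_ennreal)
  also have "\<dots> \<le> (SUP n. ennreal (exp (L (approx_one n))) * defect_integral (approx_one n) i)"
  proof (rule SUP_mono, intro bexI)
    fix n
    have "L (approx_one n) \<le> exp (L (approx_one n))"
      using exp_ge_add_one_self[of "L (approx_one n)"] by linarith
    then show "ennreal (L (approx_one n)) * D \<le> ennreal (exp (L (approx_one n))) * defect_integral (approx_one n) i"
      unfolding D_def by (intro mult_mono ennreal_leI defect_integral_mono approx_one_mono) auto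
  qed simp
  finally show ?thesis
    by (simp add: top_unique)
qed

text \<open>Both the interval and the factor \<open>exp (L z)\<close> increase with
  \<open>z\<close>, so monotone convergence replaces \<open>L z\<close> by its finite limit.\<close>

lemma mean_finite:
  assumes fin: "total_exponent < \<infinity>"
  shows "(SUP n. ennreal (exp (L (approx_one n))) * defect_integral (approx_one n) i) =
    (\<integral>\<^sup>+ y\<in>{0..<1}. ennreal ((1 - monomial i (u y)) / B k1 y * exp (enn2real total_exponent - L y)) \<partial>lborel)"
proof -
  define L1 where "L1 = enn2real total_exponent"
  have L1: "total_exponent = ennreal L1" "0 \<le> L1"
    using fin by (auto simp: L1_def less_top)
  have incL: "incseq (\<lambda>n. L (approx_one n))"
    by (intro monoI L_mono approx_one_mono approx_one_bounds)
  have "(\<lambda>n. ennreal (L (approx_one n))) \<longlonglongrightarrow> (SUP n. ennreal (L (approx_one n)))"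
    using incL by (intro LIMSEQ_SUP) (auto simp: incseq_def ennreal_leI)
  then have "(\<lambda>n. ennreal (L (approx_one n))) \<longlonglongrightarrow> ennreal L1"
    using L1 total_exponent_SUP by simp
  then have limL: "(\<lambda>n. L (approx_one n)) \<longlonglongrightarrow> L1"
    using L1 by (subst (asm) tendsto_ennreal_iff) (auto simp: L_nonneg approx_one_bounds)
  define X where "X n y = ennreal ((1 - monomial i (u y)) / B k1 y * exp (L (approx_one n) - L y)) *
      indicator {0..approx_one n} y" for n y
  have pos: "0 \<le> (1 - monomial i (u y)) / B k1 y" if "0 \<le> y" "y < 1" for y
    using that B_k1_pos[of y] f_bounds(2)[of y i] by (intro divide_nonneg_pos) auto
  have inc: "incseq X"
  proof (intro monoI le_funI)
    fix m n :: nat and y :: real assume mn: "m \<le> n"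
    show "X m y \<le> X n y"
    proof (cases "y \<in> {0..approx_one m}")
      case True
      then have y: "0 \<le> y" "y < 1" "y \<in> {0..approx_one n}"
        using approx_one_bounds(3)[of m] approx_one_mono[OF mn] by auto
      have "(1 - monomial i (u y)) / B k1 y * exp (L (approx_one m) - L y) \<le>
          (1 - monomial i (u y)) / B k1 y * exp (L (approx_one n) - L y)"
        using incseqD[OF incL mn] by (intro mult_left_mono pos y) auto
      then show ?thesis
        using True y by (simp add: X_def ennreal_leI)
    qed (simp add: X_def)
  qed
  have SUP_X: "(SUP n. X n y) = ennreal ((1 - monomial i (u y)) / B k1 y * exp (L1 - L y)) * indicator {0..<1} y" for y
  proof (cases "y \<in> {0..<1}")
    case True
    then obtain N where N: "\<And>n. n \<ge> N \<Longrightarrow> y < approx_one n"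
      using approx_one_exceeds[of y] by auto
    have "(\<lambda>n. ennreal ((1 - monomial i (u y)) / B k1 y * exp (L (approx_one n) - L y))) \<longlonglongrightarrow>
        ennreal ((1 - monomial i (u y)) / B k1 y * exp (L1 - L y))"
      by (intro tendsto_ennrealI tendsto_intros limL)
    moreover have "\<forall>\<^sub>F n in sequentially. X n y = ennreal ((1 - monomial i (u y)) / B k1 y * exp (L (approx_one n) - L y))"
      using N True by (auto simp: eventually_sequentially X_def less_imp_le intro!: exI[of _ N])
    ultimately have "(\<lambda>n. X n y) \<longlonglongrightarrow> ennreal ((1 - monomial i (u y)) / B k1 y * exp (L1 - L y))"
      by (simp add: tendsto_cong)
    moreover have "(\<lambda>n. X n y) \<longlonglongrightarrow> (SUP n. X n y)"
      using inc by (intro LIMSEQ_SUP) (auto simp: incseq_def le_fun_def)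
    ultimately show ?thesis
      using True LIMSEQ_unique by fastforce
  next
    case False
    then have "X n y = 0" for n
      using approx_one_bounds(3)[of n] by (auto simp: X_def)
    then show ?thesis
      using False by simp
  qed
  have "(SUP n. ennreal (exp (L (approx_one n))) * defect_integral (approx_one n) i) = (SUP n. \<integral>\<^sup>+ y. X n y \<partial>lborel)"
    by (simp add: exp_L_defect_integral approx_one_bounds X_def)
  also have "\<dots> = (\<integral>\<^sup>+ y. (SUP n. X n y) \<partial>lborel)"
  proof (rule nn_integral_monotone_convergence_SUP[symmetric, OF inc])
    fix n
    have "continuous_on {0..approx_one n} (\<lambda>y. (1 - monomial i (u y)) / B k1 y * exp (L (approx_one n) - L y))"
      using approx_one_bounds[of n] B_k1_pos
      by (intro continuous_intros continuous_on_subset[OF u_cont] continuous_on_subset[OF B_cont] L_cont)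
        (auto simp: less_le)
    then show "X n \<in> borel_measurable lborel"
      unfolding X_def using continuous_on_indicator_measurable by simp
  qed
  finally show ?thesis
    by (simp only: SUP_X L1_def)
qed

text \<open>Finiteness of the total exponent makes the Bochner integral genuine instead of its
  default value 0. At \<open>x = 1\<close> the integrand is 0 because \<open>A 1 = 0\<close>, so
  including the end point is harmless.\<close>

lemma exponent_tail:
  assumes fin: "total_exponent < \<infinity>" and y: "0 \<le> y" "y < 1"
  shows "(LINT x:{y..1}|lborel. A x / B k1 x) = L y - enn2real total_exponent"
proof -
  let ?g = "\<lambda>x. - A x / B k1 x"
  have "continuous_on {0..<1} ?g"
    by (intro continuous_on_half_open ratio_cont)
  then have [measurable]: "(\<lambda>x. indicator {0..<1} x *\<^sub>R ?g x) \<in> borel_measurable borel"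
    by (intro borel_measurable_continuous_on_indicator) auto
  have eq: "indicator {y..1} x *\<^sub>R ?g x = indicator {y..1} x *\<^sub>R (indicator {0..<1} x *\<^sub>R ?g x)" for x
    using y A_1 by (cases "x = 1") (auto simp: indicator_def)
  have nonneg: "0 \<le> indicator {y..1} x *\<^sub>R ?g x" for x
    using y A_1 ratio_nonneg[of x] by (cases "x = 1") (auto simp: indicator_def)
  have "(LINT x:{y..1}|lborel. ?g x) = enn2real (\<integral>\<^sup>+ x. ennreal (indicator {y..1} x *\<^sub>R ?g x) \<partial>lborel)"
    unfolding set_lebesgue_integral_def
  proof (rule integral_eq_nn_integral)
    show "(\<lambda>x. indicator {y..1} x *\<^sub>R ?g x) \<in> borel_measurable lborel"
      unfolding eq by measurable
  qed (use nonneg in auto)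
  also have "\<dots> = enn2real total_exponent - L y"
  proof -
    have "total_exponent = (\<integral>\<^sup>+ x. ennreal (?g x) * indicator {0..y} x + ennreal (indicator {y..1} x *\<^sub>R ?g x) \<partial>lborel)"
      unfolding total_exponent_def
    proof (rule nn_integral_cong_AE)
      have "AE x in lborel. x \<noteq> y"
        by (rule AE_lborel_singleton)
      moreover have "AE x in lborel. x \<noteq> (1 :: real)"
        by (rule AE_lborel_singleton)
      ultimately show "AE x in lborel. ennreal (?g x) * indicator {0..<1} x =
          ennreal (?g x) * indicator {0..y} x + ennreal (indicator {y..1} x *\<^sub>R ?g x)"
        by eventually_elim (use y in \<open>auto simp: indicator_def\<close>)
    qed
    also have "\<dots> = ennreal (L y) + (\<integral>\<^sup>+ x. ennreal (indicator {y..1} x *\<^sub>R ?g x) \<partial>lborel)"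
    proof (subst nn_integral_add)
      show "(\<lambda>x. ennreal (?g x) * indicator {0..y} x) \<in> borel_measurable lborel"
        using continuous_on_indicator_measurable[OF ratio_cont[OF y(2)]] by simp
      show "(\<lambda>x. ennreal (indicator {y..1} x *\<^sub>R ?g x)) \<in> borel_measurable lborel"
        unfolding eq by measurable
    qed (simp only: L_ennreal[OF y(2)])
    finally have "total_exponent = ennreal (L y) + (\<integral>\<^sup>+ x. ennreal (indicator {y..1} x *\<^sub>R ?g x) \<partial>lborel)" .
    moreover from this have "(\<integral>\<^sup>+ x. ennreal (indicator {y..1} x *\<^sub>R ?g x) \<partial>lborel) < \<top>"
      using fin by (auto simp only: infinity_ennreal_def ennreal_add_less_top)
    ultimately show ?thesis
      using L_nonneg[OF y(2)] by (simp only: enn2real_plus enn2real_ennreal ennreal_less_top)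
  qed
  finally have "(LINT x:{y..1}|lborel. ?g x) = enn2real total_exponent - L y" .
  moreover have "(LINT x:{y..1}|lborel. ?g x) = - (LINT x:{y..1}|lborel. A x / B k1 x)"
    by (simp add: set_lebesgue_integral_def)
  ultimately show ?thesis
    by simp
qed

text \<open>The product of all coordinates is the monomial with exponent 1 in every type. Any two
  nonzero exponents are comparable: bound one defect linearly by the coordinates, compare these with
  a coordinate occurring in the other, and use that a monomial is at most each of its
  coordinates.\<close>

lemma defect_equivalent:
  assumes "i \<noteq> 0"
  obtains C where "0 < C"
    "\<And>y. y \<in> {0..1} \<Longrightarrow> 1 - (\<Prod>k\<in>UNIV. u y $ k) \<le> C * (1 - monomial i (u y))"
    "\<And>y. y \<in> {0..1} \<Longrightarrow> 1 - monomial i (u y) \<le> C * (1 - (\<Prod>k\<in>UNIV. u y $ k))"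
proof -
  obtain K where K: "0 < K" "\<And>y k l. y \<in> {0..1} \<Longrightarrow> 1 - u y $ k \<le> K * (1 - u y $ l)"
    using defect_comparable by blast
  have compare: "1 - monomial i (u y) \<le> ((\<Sum>k\<in>UNIV. real (i $ k)) * K) * (1 - monomial j (u y))"
    if j: "j \<noteq> 0" and y: "y \<in> {0..1}" for i j y
  proof -
    obtain l where l: "j $ l \<noteq> 0"
      using j by (auto simp: vec_eq_iff)
    have "1 - monomial i (u y) \<le> (\<Sum>k\<in>UNIV. real (i $ k) * (1 - u y $ k))"
      by (rule one_minus_monomial_le[OF u_cube[OF y]])
    also have "\<dots> \<le> (\<Sum>k\<in>UNIV. real (i $ k) * (K * (1 - monomial j (u y))))"
    proof (intro sum_mono mult_left_mono)
      fix k
      have "K * (1 - u y $ l) \<le> K * (1 - monomial j (u y))"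
        using monomial_le_coord[OF u_cube[OF y], of j l] l K(1) by (intro mult_left_mono) auto
      then show "1 - u y $ k \<le> K * (1 - monomial j (u y))"
        using K(2)[OF y, of k l] by linarith
    qed auto
    also have "\<dots> = ((\<Sum>k\<in>UNIV. real (i $ k)) * K) * (1 - monomial j (u y))"
      by (simp add: sum_distrib_right mult.assoc)
    finally show ?thesis .
  qed
  have prod: "(\<Prod>k\<in>UNIV. u y $ k) = monomial 1 (u y)" for y
    by (simp add: monomial_def)
  have "(1 :: nat ^ 'n) \<noteq> 0"
    by (simp add: vec_eq_iff)
  define C where "C = (\<Sum>k\<in>UNIV. real (i $ k)) * K + (\<Sum>k\<in>UNIV. real ((1 :: nat ^ 'n) $ k)) * K"
  have s: "0 \<le> (\<Sum>k\<in>UNIV. real (i $ k)) * K" "0 < (\<Sum>k\<in>UNIV. real ((1 :: nat ^ 'n) $ k)) * K"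
    using K(1) by (auto intro!: mult_nonneg_nonneg sum_nonneg mult_pos_pos)
  show ?thesis
  proof (rule that[of C])
    show "0 < C"
      using s by (simp add: C_def)
    fix y :: real assume y: "y \<in> {0..1}"
    show "1 - (\<Prod>k\<in>UNIV. u y $ k) \<le> C * (1 - monomial i (u y))"
      unfolding prod using compare[OF assms y, of 1] f_bounds(2)[OF y, of i] s(1)
      by (intro order_trans[OF _ mult_right_mono[of "(\<Sum>k\<in>UNIV. real ((1 :: nat ^ 'n) $ k)) * K" C]]) (auto simp: C_def)
    show "1 - monomial i (u y) \<le> C * (1 - (\<Prod>k\<in>UNIV. u y $ k))"
      unfolding prod using compare[OF \<open>1 \<noteq> 0\<close> y, of i] f_bounds(2)[OF y, of 1] s(2)
      by (intro order_trans[OF _ mult_right_mono[of "(\<Sum>k\<in>UNIV. real (i $ k)) * K" C]]) (auto simp: C_def)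
  qed
qed

text \<open>Both parts are nonnegative, so the criterion splits into finiteness of the total
  exponent and finiteness of the integral of the defect.\<close>

lemma condition_integral_eq:
  "(\<integral>\<^sup>+ y\<in>{0..1}. ennreal ((1 - (\<Prod>k\<in>UNIV. u y $ k) - A y) / B k1 y) \<partial>lborel) =
    (\<integral>\<^sup>+ y\<in>{0..<1}. ennreal ((1 - (\<Prod>k\<in>UNIV. u y $ k)) / B k1 y) \<partial>lborel) + total_exponent"
proof -
  have "continuous_on {0..<1} (\<lambda>y. (1 - (\<Prod>k\<in>UNIV. u y $ k)) / B k1 y)"
    using B_k1_pos
    by (intro continuous_intros continuous_on_subset[OF u_cont] continuous_on_subset[OF B_cont])
      (auto simp: less_le)
  then have m: "(\<lambda>y. ennreal ((1 - (\<Prod>k\<in>UNIV. u y $ k)) / B k1 y) * indicator {0..<1} y) \<in> borel_measurable borel"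
    by (intro continuous_on_indicator_measurable) auto
  have eq: "ennreal ((1 - (\<Prod>k\<in>UNIV. u y $ k) - A y) / B k1 y) * indicator {0..<1} y =
      ennreal ((1 - (\<Prod>k\<in>UNIV. u y $ k)) / B k1 y) * indicator {0..<1} y +
      ennreal (- A y / B k1 y) * indicator {0..<1} y" for y
  proof (cases "y \<in> {0..<1}")
    case True
    have "(\<Prod>k\<in>UNIV. u y $ k) \<le> 1"
      using True u_bounds[of y] by (intro prod_le_1) auto
    then have "0 \<le> (1 - (\<Prod>k\<in>UNIV. u y $ k)) / B k1 y" "0 \<le> - A y / B k1 y"
      using True B_k1_pos[of y] ratio_nonneg[of y] by auto
    then have "ennreal ((1 - (\<Prod>k\<in>UNIV. u y $ k)) / B k1 y + - A y / B k1 y) =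
        ennreal ((1 - (\<Prod>k\<in>UNIV. u y $ k)) / B k1 y) + ennreal (- A y / B k1 y)"
      by (rule ennreal_plus)
    moreover have "(1 - (\<Prod>k\<in>UNIV. u y $ k)) / B k1 y + - A y / B k1 y =
        (1 - (\<Prod>k\<in>UNIV. u y $ k) - A y) / B k1 y"
      by (simp add: diff_divide_distrib)
    ultimately show ?thesis
      using True by (simp only: indicator_simps mult_1_right)
  qed simp
  show ?thesis
    unfolding nn_integral_Icc_01 total_exponent_def eq
    by (rule nn_integral_add[OF m[folded measurable_lborel2] ratio_measurable[folded measurable_lborel2]])
qed

text \<open>With infinite total exponent both sides of the criterion are infinite. Otherwise
  \<open>exp (L1 - L y)\<close> lies between 1 and \<open>exp L1\<close>, so together with
  \<open>defect_equivalent\<close> the mean and the defect integral differ by bounded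
  factors.\<close>

lemma mean_criterion:
  assumes i: "i \<noteq> 0"
    and T: "T = (SUP n. ennreal (exp (L (approx_one n))) * defect_integral (approx_one n) i)"
  shows "T < \<infinity> \<longleftrightarrow>
      (\<integral>\<^sup>+ y\<in>{0..1}. ennreal ((1 - (\<Prod>k\<in>UNIV. u y $ k) - A y) / B k1 y) \<partial>lborel) < \<infinity>"
    and "T < \<infinity> \<Longrightarrow> T = (\<integral>\<^sup>+ y\<in>{0..1}. ennreal ((1 - monomial i (u y)) / B k1 y *
           exp (- (LINT x:{y..1}|lborel. A x / B k1 x))) \<partial>lborel)"
proof -
  have "(T < \<infinity> \<longleftrightarrow>
      (\<integral>\<^sup>+ y\<in>{0..1}. ennreal ((1 - (\<Prod>k\<in>UNIV. u y $ k) - A y) / B k1 y) \<partial>lborel) < \<infinity>) \<and>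
    (T < \<infinity> \<longrightarrow> T = (\<integral>\<^sup>+ y\<in>{0..1}. ennreal ((1 - monomial i (u y)) / B k1 y *
           exp (- (LINT x:{y..1}|lborel. A x / B k1 x))) \<partial>lborel))"
  proof (cases "total_exponent < \<infinity>")
    case False
    then have inf: "total_exponent = \<infinity>"
      by (simp add: not_less top_unique)
    then show ?thesis
      unfolding T mean_infinite[OF inf i] condition_integral_eq by simp
  next
    case fin: True
    define L1 where "L1 = enn2real total_exponent"
    define P where "P = (\<integral>\<^sup>+ y\<in>{0..<1}. ennreal ((1 - (\<Prod>k\<in>UNIV. u y $ k)) / B k1 y) \<partial>lborel)"
    have T_eq: "T = (\<integral>\<^sup>+ y\<in>{0..<1}. ennreal ((1 - monomial i (u y)) / B k1 y * exp (L1 - L y)) \<partial>lborel)"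
      unfolding T L1_def by (rule mean_finite[OF fin])
    have tail: "(LINT x:{y..1}|lborel. A x / B k1 x) = L y - L1" if "y \<in> {0..<1}" for y
      using exponent_tail[OF fin, of y] that by (simp add: L1_def)
    have "T = (\<integral>\<^sup>+ y\<in>{0..1}. ennreal ((1 - monomial i (u y)) / B k1 y *
           exp (- (LINT x:{y..1}|lborel. A x / B k1 x))) \<partial>lborel)"
      unfolding nn_integral_Icc_01 T_eq
      by (rule set_nn_integral_cong) (use tail in auto)
    moreover have "T < \<infinity> \<longleftrightarrow> P < \<infinity>"
    proof -
      obtain C where C: "0 < C"
        "\<And>y. y \<in> {0..1} \<Longrightarrow> 1 - (\<Prod>k\<in>UNIV. u y $ k) \<le> C * (1 - monomial i (u y))"
        "\<And>y. y \<in> {0..1} \<Longrightarrow> 1 - monomial i (u y) \<le> C * (1 - (\<Prod>k\<in>UNIV. u y $ k))"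
        using defect_equivalent[OF i] by blast
      have L_le: "L y \<le> L1" if y: "y \<in> {0..<1}" for y
      proof -
        have "0 \<le> (LINT x:{y..1}|lborel. - A x / B k1 x)"
          unfolding set_lebesgue_integral_def
        proof (rule integral_nonneg_AE, intro AE_I2)
          fix x
          show "0 \<le> indicator {y..1} x *\<^sub>R (- A x / B k1 x)"
            using y A_1 ratio_nonneg[of x] by (cases "x = 1") (auto simp: indicator_def)
        qed
        moreover have "(LINT x:{y..1}|lborel. - A x / B k1 x) = - (LINT x:{y..1}|lborel. A x / B k1 x)"
          by (simp add: set_lebesgue_integral_def)
        ultimately show ?thesis
          using tail[OF y] by simp
      qed
      have "P \<le> (\<integral>\<^sup>+ y. ennreal C * (ennreal ((1 - monomial i (u y)) / B k1 y * exp (L1 - L y)) * indicator {0..<1} y) \<partial>lborel)"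
        unfolding P_def
      proof (rule nn_integral_mono)
        fix y
        show "ennreal ((1 - (\<Prod>k\<in>UNIV. u y $ k)) / B k1 y) * indicator {0..<1} y \<le>
          ennreal C * (ennreal ((1 - monomial i (u y)) / B k1 y * exp (L1 - L y)) * indicator {0..<1} y)"
        proof (cases "y \<in> {0..<1}")
          case True
          then have B: "0 < B k1 y" and f: "0 \<le> 1 - monomial i (u y)"
            using B_k1_pos[of y] f_bounds(2)[of y i] by auto
          have "(1 - (\<Prod>k\<in>UNIV. u y $ k)) / B k1 y \<le> C * (1 - monomial i (u y)) / B k1 y * 1"
            using C(2)[of y] True B by (simp add: divide_right_mono)
          also have "\<dots> \<le> C * (1 - monomial i (u y)) / B k1 y * exp (L1 - L y)"
            using C(1) B f L_le[OF True] by (intro mult_left_mono divide_nonneg_nonneg mult_nonneg_nonneg) auto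
          finally have "(1 - (\<Prod>k\<in>UNIV. u y $ k)) / B k1 y \<le> C * ((1 - monomial i (u y)) / B k1 y * exp (L1 - L y))"
            by simp
          then show ?thesis
            using True C(1) by (simp add: ennreal_mult'[symmetric] ennreal_leI)
        qed simp
      qed
      also have "\<dots> = ennreal C * T"
      proof -
        have "continuous_on {0..<1} (\<lambda>y. (1 - monomial i (u y)) / B k1 y * exp (L1 - L y))"
          using B_k1_pos
          by (intro continuous_intros continuous_on_subset[OF u_cont] continuous_on_subset[OF B_cont]
              continuous_on_half_open[OF L_cont]) (auto simp: less_le)
        then show ?thesis
          unfolding T_eq
          by (intro nn_integral_cmult) (use continuous_on_indicator_measurable in auto)
      qed
      finally have PT: "P \<le> ennreal C * T" .
      have "T \<le> (\<integral>\<^sup>+ y. ennreal (C * exp L1) * (ennreal ((1 - (\<Prod>k\<in>UNIV. u y $ k)) / B k1 y) * indicator {0..<1} y) \<partial>lborel)"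
        unfolding T_eq
      proof (rule nn_integral_mono)
        fix y
        show "ennreal ((1 - monomial i (u y)) / B k1 y * exp (L1 - L y)) * indicator {0..<1} y \<le>
          ennreal (C * exp L1) * (ennreal ((1 - (\<Prod>k\<in>UNIV. u y $ k)) / B k1 y) * indicator {0..<1} y)"
        proof (cases "y \<in> {0..<1}")
          case True
          then have B: "0 < B k1 y" and f: "0 \<le> 1 - monomial i (u y)"
            using B_k1_pos[of y] f_bounds(2)[of y i] by auto
          have "(1 - monomial i (u y)) / B k1 y * exp (L1 - L y) \<le> (1 - monomial i (u y)) / B k1 y * exp L1"
            using B f L_nonneg[of y] True by (intro mult_left_mono divide_nonneg_nonneg) auto
          also have "\<dots> \<le> C * (1 - (\<Prod>k\<in>UNIV. u y $ k)) / B k1 y * exp L1"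
            using C(3)[of y] True B by (intro mult_right_mono divide_right_mono) auto
          finally have "(1 - monomial i (u y)) / B k1 y * exp (L1 - L y) \<le>
              C * exp L1 * ((1 - (\<Prod>k\<in>UNIV. u y $ k)) / B k1 y)"
            by (simp add: mult_ac)
          then show ?thesis
            using True C(1) by (simp add: ennreal_mult'[symmetric] ennreal_leI del: ennreal_mult)
        qed simp
      qed
      also have "\<dots> = ennreal (C * exp L1) * P"
      proof -
        have "continuous_on {0..<1} (\<lambda>y. (1 - (\<Prod>k\<in>UNIV. u y $ k)) / B k1 y)"
          using B_k1_pos
          by (intro continuous_intros continuous_on_subset[OF u_cont] continuous_on_subset[OF B_cont])
            (auto simp: less_le)
        then show ?thesis
          unfolding P_def
          by (intro nn_integral_cmult) (use continuous_on_indicator_measurable in auto)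
      qed
      finally have TP: "T \<le> ennreal (C * exp L1) * P" .
      show ?thesis
        using le_less_trans[OF PT, of \<top>] le_less_trans[OF TP, of \<top>]
        by (auto simp: ennreal_mult_less_top)
    qed
    ultimately show ?thesis
      using fin by (simp add: condition_integral_eq P_def)
  qed
  then show "T < \<infinity> \<longleftrightarrow>
      (\<integral>\<^sup>+ y\<in>{0..1}. ennreal ((1 - (\<Prod>k\<in>UNIV. u y $ k) - A y) / B k1 y) \<partial>lborel) < \<infinity>"
    "T < \<infinity> \<Longrightarrow> T = (\<integral>\<^sup>+ y\<in>{0..1}. ennreal ((1 - monomial i (u y)) / B k1 y *
           exp (- (LINT x:{y..1}|lborel. A x / B k1 x))) \<partial>lborel)"
    by blast+
qed

end

theorem theorem3p3:
  fixes a :: "nat ^ 'n \<Rightarrow> real" and b :: "'n::finite \<Rightarrow> nat ^ 'n \<Rightarrow> real"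
    and k1 :: 'n and u :: "real \<Rightarrow> real ^ 'n"
    and A B1 :: "real \<Rightarrow> real"
    and i :: "nat ^ 'n" and M :: "'w measure" and X :: "real \<Rightarrow> 'w \<Rightarrow> (nat ^ 'n) option"
  assumes "tbi_data a b"
    and "nonsingular b"
    and "finite_first_moments b"
    and "positively_regular (g_matrix b 1)"
    and "gen_fun (b k1) 0 > 0"
    and "max_eigenvalue (gf_jacobian b 1) \<le> 0"
    and "branching_curve b k1 u"
  defines "A \<equiv> \<lambda>y. gen_fun a (u y)"
    and "B1 \<equiv> \<lambda>y. gen_fun (b k1) (u y)"
  assumes "(\<integral>\<^sup>+ y\<in>{0..1}. ennreal (1 / B1 y * exp (LINT x:{0..y}|lborel. A x / B1 x)) \<partial>lborel) = \<infinity>"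
    and "i \<noteq> 0"
    and "feller_minimal_process (absorptive_tbi a b) i M X"
  shows "measure M {\<omega> \<in> space M. hitting_time X 0 \<omega> < \<infinity>} = 1 \<and>
     ((\<integral>\<^sup>+ \<omega>. hitting_time X 0 \<omega> \<partial>M) < \<infinity> \<longleftrightarrow>
        (\<integral>\<^sup>+ y\<in>{0..1}. ennreal ((1 - (\<Prod>k\<in>UNIV. u y $ k) - A y) / B1 y) \<partial>lborel) < \<infinity>) \<and>
     ((\<integral>\<^sup>+ \<omega>. hitting_time X 0 \<omega> \<partial>M) < \<infinity> \<longrightarrow>
        (\<integral>\<^sup>+ \<omega>. hitting_time X 0 \<omega> \<partial>M) =
        (\<integral>\<^sup>+ y\<in>{0..1}. ennreal ((1 - monomial i (u y)) / B1 y *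
           exp (- (LINT x:{y..1}|lborel. A x / B1 x))) \<partial>lborel))"
proof -
  interpret tbi_curve a b k1 u
    by unfold_locales (use assms in auto)
  interpret P: minimal_process_absorbing "absorptive_tbi a b" i 0 M X
    by unfold_locales (use assms in \<open>auto simp: absorptive_tbi_def\<close>)
  \<comment> \<open>By \<open>L_eq\<close> the two integrands agree on [0, 1); the end point is a
    null set.\<close>
  have J: "(\<integral>\<^sup>+ y\<in>{0..<1}. ennreal (exp (- L y) / gen_fun (b k1) (u y)) \<partial>lborel) = \<infinity>"
  proof -
    have "(\<integral>\<^sup>+ y\<in>{0..<1}. ennreal (exp (- L y) / gen_fun (b k1) (u y)) \<partial>lborel) =
        (\<integral>\<^sup>+ y\<in>{0..1}. ennreal (1 / B1 y * exp (LINT x:{0..y}|lborel. A x / B1 x)) \<partial>lborel)"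
      unfolding nn_integral_Icc_01 by (rule set_nn_integral_cong) (auto simp: A_def B1_def L_eq)
    then show ?thesis
      using assms(10) by simp
  qed
  have mean: "(\<integral>\<^sup>+ \<omega>. hitting_time X 0 \<omega> \<partial>M) =
      (SUP n. ennreal (exp (L (approx_one n))) * defect_integral (approx_one n) i)"
  proof -
    have "1 - feller_minimal Q t i 0 = survival t i" if "0 \<le> t" for t
    proof -
      have "feller_minimal Q t i 0 \<noteq> \<top>"
        using survival_eq[OF that, of i] by (metis ennreal_add_eq_top ennreal_one_neq_top)
      then show ?thesis
        by (simp add: survival_eq[OF that, of i, symmetric])
    qed
    then have "(\<integral>\<^sup>+ \<omega>. hitting_time X 0 \<omega> \<partial>M) = (\<integral>\<^sup>+ t\<in>{0..}. survival t i \<partial>lborel)"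
      unfolding P.nn_integral_hitting_time by (intro set_nn_integral_cong) auto
    then show ?thesis
      by (simp only: nn_integral_survival[OF J])
  qed
  have "1 \<le> emeasure M {\<omega> \<in> space M. hitting_time X 0 \<omega> < \<infinity>}"
  proof (rule ennreal_le_epsilon)
    fix e :: real assume "0 < e"
    then obtain t where t: "0 \<le> t" "survival t i \<le> ennreal e"
      using survival_small[OF J] by blast
    have "1 = feller_minimal Q t i 0 + survival t i"
      using survival_eq[OF t(1)] by simp
    also have "\<dots> \<le> emeasure M {\<omega> \<in> space M. hitting_time X 0 \<omega> < \<infinity>} + ennreal e"
      by (intro add_mono P.feller_minimal_le_hitting t)
    finally show "1 \<le> emeasure M {\<omega> \<in> space M. hitting_time X 0 \<omega> < \<infinity>} + ennreal e" .
  qed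
  then have "1 \<le> measure M {\<omega> \<in> space M. hitting_time X 0 \<omega> < \<infinity>}"
    by (simp add: P.emeasure_eq_measure)
  then have "measure M {\<omega> \<in> space M. hitting_time X 0 \<omega> < \<infinity>} = 1"
    by (intro antisym P.prob_le_1)
  then show ?thesis
    unfolding A_def B1_def using mean_criterion[OF assms(11) mean] by blast
qed

end
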